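(* Let $\mathcal{M}$ be a finite set, let $\mathcal{H}$ be a two-dimensional Hilbert space, and let $\boldsymbol{\rho} \in \mathcal{E}(\mathcal{M},\mathcal{H})$ be an ensemble, bijective onto its range, whose range $\boldsymbol{\rho}(\mathcal{M})$ is proportional to (the vertex set of) a regular polyhedron in the Bloch sphere. Then $$G_{\min}(\boldsymbol{\rho}) = \begin{cases} \frac52 - \frac{\sqrt{15}}{6} \;(\sim 1.9) & \text{if } |\mathcal{M}| = 4,\\[1ex] \frac72 - \frac{\sqrt{35}}{6} \;(\sim 2.5) & \text{if } |\mathcal{M}| = 6,\\[1ex] \frac92 - \frac{\sqrt{7}}{2} \;(\sim 3.2) & \text{if } |\mathcal{M}| = 8,\\[1ex] \frac{13}{2} - \frac{\sqrt{110\,(65+29\sqrt5)}}{60} \;(\sim 4.5) & \text{if } |\mathcal{M}| = 12,\\[1ex] \frac{21}{2} - \frac{\sqrt{6\,(3321+1483\sqrt5)}}{60} \;(\sim 7.2) & \text{if } |\mathcal{M}| = 20,\end{cases}$$ where the decimal values in parentheses are approximations, rounded to one decimal place, of the exact values.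
   Context: Hilbert spaces are complex. $\mathcal{L}_+(\mathcal{H})$ is the cone of positive semidefinite operators on $\mathcal{H}$, $\mathbb{1}$ the identity. For a finite set $\mathcal{M}$: - $\mathcal{N}_{\mathcal{M}}$ is the set of numberings, i.e. bijections $\mathbf{n}:\{1,\dots,|\mathcal{M}|\}\to\mathcal{M}$. - $\mathcal{E}(\mathcal{M},\mathcal{H})$ is the set of ensembles, i.e. maps $\boldsymbol{\rho}:\mathcal{M}\to\mathcal{L}_+(\mathcal{H})$ with $\sum_{m\in\mathcal{M}}\operatorname{Tr}[\boldsymbol{\rho}(m)]=1$. - $\mathcal{P}(\mathcal{N}_{\mathcal{M}},\mathcal{H})$ is the set of numbering-valued measurements, i.e. maps $\boldsymbol{\pi}:\mathcal{N}_{\mathcal{M}}\to\mathcal{L}_+(\mathcal{H})$ with $\sum_{\mathbf{n}\in\mathcal{N}_{\mathcal{M}}}\boldsymbol{\pi}(\mathbf{n})=\mathbb{1}$. The guesswork is $G(\boldsymbol{\rho},\boldsymbol{\pi}) := \sum_{t=1}^{|\mathcal{M}|} t\, q_{\boldsymbol{\rho},\boldsymbol{\pi}}(t)$, where $q_{\boldsymbol{\rho},\boldsymbol{\pi}}(t) := \sum_{\mathbf{n}\in\mathcal{N}_{\mathcal{M}}}\operatorname{Tr}[\boldsymbol{\rho}(\mathbf{n}(t))\,\boldsymbol{\pi}(\mathbf{n})]$. The minimum guesswork is $G_{\min}(\boldsymbol{\rho}) := \min_{\boldsymbol{\pi}\in\mathcal{P}(\mathcal{N}_{\mathcal{M}},\mathcal{H})}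 G(\boldsymbol{\rho},\boldsymbol{\pi})$. Bloch sphere: with respect to an orthonormal basis of $\mathcal{H}$, the pure states are $\tfrac12(\mathbb{1}+v\cdot\sigma)$ with $v\in\mathbb{R}^3$ a unit vector, where $v\cdot\sigma = v_1\sigma_x+v_2\sigma_y+v_3\sigma_z$ and $\sigma_x,\sigma_y,\sigma_z$ are the Pauli matrices. "The range is proportional to a regular polyhedron in the Bloch sphere" means that $\boldsymbol{\rho}(m)=|\mathcal{M}|^{-1}\cdot\tfrac12(\mathbb{1}+v_m\cdot\sigma)$ for $m\in\mathcal{M}$, where $m\mapsto v_m$ is a bijection from $\mathcal{M}$ onto the vertex set of a regular convex polyhedron (Platonic solid) inscribed in the unit sphere (the proportionality factor is $|\mathcal{M}|^{-1}$ by normalization of the ensemble). Thus $|\mathcal{M}|=4,6,8,12,20$ corresponds to the tetrahedron, octahedron, cube, icosahedron, dodecahedron, respectively. *)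

theory Defs
  imports "HOL-Analysis.Analysis"
begin

text \<open>
  The inner product is linear in its second argument. Completeness is not required: the spaces
  considered here are finite-dimensional, where it is automatic.
\<close>

class complex_inner_product = ab_group_add +
  fixes scaleC :: "complex \<Rightarrow> 'a \<Rightarrow> 'a"  (infixr \<open>*\<^sub>C\<close> 75)
    and cinner :: "'a \<Rightarrow> 'a \<Rightarrow> complex"
  assumes scaleC_add_right: "c *\<^sub>C (x + y) = c *\<^sub>C x + c *\<^sub>C y"
    and scaleC_add_left: "(c + d) *\<^sub>C x = c *\<^sub>C x + d *\<^sub>C x"
    and scaleC_scaleC: "c *\<^sub>C (d *\<^sub>C x) = (c * d) *\<^sub>C x"
    and scaleC_one: "1 *\<^sub>C x = x"
    and cinner_commute: "cinner x y = cnj (cinner y x)"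
    and cinner_add_right: "cinner x (y + z) = cinner x y + cinner x z"
    and cinner_scaleC_right: "cinner x (c *\<^sub>C y) = c * cinner x y"
    and cinner_self_nonneg: "cinner x x \<in> \<real>\<^sub>\<ge>\<^sub>0"
    and cinner_self_eq_zero: "cinner x x = 0 \<longleftrightarrow> x = 0"

global_interpretation cvs: vector_space "scaleC :: complex \<Rightarrow> 'a \<Rightarrow> 'a::complex_inner_product"
  by standard (simp_all add: scaleC_add_right scaleC_add_left scaleC_scaleC scaleC_one)

definition orthonormal_basis :: "'h::complex_inner_product set \<Rightarrow> bool" where
  "orthonormal_basis B \<longleftrightarrow>
     (\<forall>x\<in>B. \<forall>y\<in>B. cinner x y = (if x = y then 1 else 0)) \<and> cvs.span B = UNIV"

text \<open>The trace is only meaningful on finite-dimensional spaces, where it does not depend on the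
  chosen basis.\<close>

definition op_trace :: "('h \<Rightarrow> 'h::complex_inner_product) \<Rightarrow> complex" where
  "op_trace A = (\<Sum>b\<in>(SOME B. orthonormal_basis B). cinner b (A b))"

definition positive_ops :: "('h \<Rightarrow> 'h::complex_inner_product) set" where
  "positive_ops = {A. Vector_Spaces.linear scaleC scaleC A \<and> (\<forall>x. cinner x (A x) \<in> \<real>\<^sub>\<ge>\<^sub>0)}"

text \<open>Numberings are made \<^const>\<open>undefined\<close> outside \<open>{1..card M}\<close>, so that there are finitely many.\<close>

definition numberings :: "'m set \<Rightarrow> (nat \<Rightarrow> 'm) set" where
  "numberings M = {n \<in> extensional {1..card M}. bij_betw n {1..card M} M}"

definition ensembles :: "'m set \<Rightarrow> ('m \<Rightarrow> 'h \<Rightarrow> 'h::complex_inner_product) set" where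
  "ensembles M = {\<rho>. (\<forall>m\<in>M. \<rho> m \<in> positive_ops) \<and> (\<Sum>m\<in>M. op_trace (\<rho> m)) = 1}"

definition numbering_measurements ::
    "'m set \<Rightarrow> ((nat \<Rightarrow> 'm) \<Rightarrow> 'h \<Rightarrow> 'h::complex_inner_product) set" where
  "numbering_measurements M =
     {\<pi>. (\<forall>n\<in>numberings M. \<pi> n \<in> positive_ops) \<and> (\<forall>x. (\<Sum>n\<in>numberings M. \<pi> n x) = x)}"

text \<open>The trace of a product of two positive operators is real, so taking the real part below only
  changes the type.\<close>

definition guess_prob ::
    "'m set \<Rightarrow> ('m \<Rightarrow> 'h \<Rightarrow> 'h::complex_inner_product) \<Rightarrow> ((nat \<Rightarrow> 'm) \<Rightarrow> 'h \<Rightarrow> 'h) \<Rightarrow> nat \<Rightarrow> real" where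
  "guess_prob M \<rho> \<pi> t = (\<Sum>n\<in>numberings M. Re (op_trace (\<rho> (n t) \<circ> \<pi> n)))"

definition guesswork ::
    "'m set \<Rightarrow> ('m \<Rightarrow> 'h \<Rightarrow> 'h::complex_inner_product) \<Rightarrow> ((nat \<Rightarrow> 'm) \<Rightarrow> 'h \<Rightarrow> 'h) \<Rightarrow> real" where
  "guesswork M \<rho> \<pi> = (\<Sum>t = 1..card M. real t * guess_prob M \<rho> \<pi> t)"

text \<open>A minimum, once the infimum is known to be attained by some measurement.\<close>

definition min_guesswork :: "'m set \<Rightarrow> ('m \<Rightarrow> 'h \<Rightarrow> 'h::complex_inner_product) \<Rightarrow> real" where
  "min_guesswork M \<rho> = (INF \<pi>\<in>numbering_measurements M. guesswork M \<rho> \<pi>)"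

definition pauli_x :: "complex^2^2" where
  "pauli_x = vector [vector [0, 1], vector [1, 0]]"

definition pauli_y :: "complex^2^2" where
  "pauli_y = vector [vector [0, - \<i>], vector [\<i>, 0]]"

definition pauli_z :: "complex^2^2" where
  "pauli_z = vector [vector [1, 0], vector [0, - 1]]"

definition bloch_matrix :: "real^3 \<Rightarrow> complex^2^2" where
  "bloch_matrix v =
     (1 / 2) *\<^sub>R (mat 1 + (v $ 1 *\<^sub>R pauli_x + v $ 2 *\<^sub>R pauli_y + v $ 3 *\<^sub>R pauli_z))"

text \<open>The operator whose matrix with respect to the orthonormal basis \<open>e\<close> is \<open>A\<close>.\<close>

definition matrix_op :: "('n::finite \<Rightarrow> 'h::complex_inner_product) \<Rightarrow> complex^'n^'n \<Rightarrow> 'h \<Rightarrow> 'h" where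
  "matrix_op e A x = (\<Sum>i\<in>UNIV. \<Sum>j\<in>UNIV. (A $ i $ j * cinner (e j) x) *\<^sub>C e i)"

definition flag_of :: "(real^3) set \<Rightarrow> real^3 \<Rightarrow> (real^3) set \<Rightarrow> (real^3) set \<Rightarrow> bool" where
  "flag_of P v e F \<longleftrightarrow>
     v extreme_point_of P \<and> e edge_of P \<and> F facet_of P \<and> v \<in> e \<and> e \<subseteq> F"

text \<open>The notion of regularity used is flag-transitivity of the symmetry group. An isometry of
  \<open>real^3\<close> is automatically affine and bijective, so only preservation of distances is required.\<close>

definition regular_polyhedron :: "(real^3) set \<Rightarrow> bool" where
  "regular_polyhedron P \<longleftrightarrow>
     polytope P \<and> aff_dim P = 3 \<and>
     (\<forall>v e F v' e' F'. flag_of P v e F \<longrightarrow> flag_of P v' e' F' \<longrightarrow>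
        (\<exists>f. (\<forall>x y. dist (f x) (f y) = dist x y) \<and> f ` P = P \<and>
             f v = v' \<and> f ` e = e' \<and> f ` F = F'))"

end

theory Submission
  imports Defs
begin

text \<open>
  Writing a positive operator on a qubit as a weight together with a Bloch vector of at most that
  length, the guesswork of a measurement \<open>\<pi>\<close> becomes \<open>(N + 1) / 2\<close> plus a linear expression in the inner
  products of the rank sums \<open>S\<^sub>n = \<Sum>\<^sub>t t v(n t)\<close> with the Bloch vectors of \<open>\<pi> n\<close>. Hence it is at least
  \<open>(N + 1) / 2 - C / N\<close>, where \<open>C\<close> is the largest length of an \<open>S\<^sub>n\<close>. A projective measurement along \<open>S\<^sub>n\<close>
  that answers with an optimal \<open>n\<close> or with its reversal attains this bound, because the vertices sum to
  zero.

  The symmetries of a regular polyhedron that move a flag to its three neighbours are reflections.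
  Convexity confines the angles between their mirrors to five cases, and the vertex set is the orbit
  of a vertex under the reflections; so it is one of the five standard solids up to an isometry.
  To find \<open>C\<close>, one may move \<open>S\<^sub>n\<close> into a fundamental chamber of the reflection group. By the
  rearrangement inequality \<open>S\<^sub>n \<bullet> S\<^sub>n\<close> is then at most \<open>S\<^sub>n \<bullet> S\<^sub>m\<close>, where \<open>m\<close> sorts the vertices in the direction
  of \<open>S\<^sub>n\<close>, and inside the chamber only a few sorted orders occur (fourteen for the dodecahedron).
\<close>

section \<open>Reflections and chambers\<close>

text \<open>Regularity supplies only isometries that carry flags to flags; neither mirrors nor their
  angles are given. Such an isometry \<open>f\<close> is linear, because \<open>f 0\<close> has
  distance 1 from all vertices and these do not lie in a plane. A map to a neighbouring flag fixes
  two independent vectors, hence is a reflection as soon as it moves a third.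

  A priori the angles need not even divide pi. They are controlled by a single facet plane: images
  of a vertex under words in the mirrors must stay below it, and for a rotation of k steps the
  relevant coordinate is a negative multiple of sin (k t) sin ((k + 1) t), where t is the angle
  between two mirrors. A few k suffice, since the Gram determinant of the normals is positive and so
  excludes small angles.

  The length C is handled through its square K. In the standard coordinates K is an integer or of
  the form p + q golden with integers p and q, so candidate orders are compared exactly. After
  scaling to circumradius 1 the minimum is (N + 1) / 2 - sqrt K / N, and only there is a root
  taken.\<close>

definition mirror :: "'a::real_inner \<Rightarrow> 'a \<Rightarrow> 'a" where
  "mirror n x = x - (2 * (n \<bullet> x) / (n \<bullet> n)) *\<^sub>R n"

lemma inner_mirror_right: "u \<bullet> mirror n x = u \<bullet> x - 2 * (n \<bullet> x) * (u \<bullet> n) / (n \<bullet> n)"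
  by (simp add: mirror_def inner_diff_right)

lemma mirror_mirror [simp]: "mirror n (mirror n x) = x"
  by (cases "n = 0") (simp_all add: mirror_def inner_diff_right scaleR_diff_right flip: scaleR_left.add)

lemma mirror_scaleR [simp]: "c \<noteq> 0 \<Longrightarrow> mirror (c *\<^sub>R n) x = mirror n x"
  by (simp add: mirror_def)

lemma linear_mirror: "linear (mirror n)"
  by (rule linearI)
     (simp_all add: mirror_def inner_add_right algebra_simps add_divide_distrib scaleR_left_distrib)

lemma norm_mirror [simp]: "norm (mirror n x) = norm x"
proof -
  have "mirror n x \<bullet> mirror n x = x \<bullet> x"
    by (cases "n = 0") (simp_all add: mirror_def inner_diff inner_commute field_simps power2_eq_square)
  then show ?thesis by (simp add: norm_eq_sqrt_inner)
qed

lemma mirror_image_commute: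
  assumes "orthogonal_transformation T"
  shows "T (mirror n x) = mirror (T n) (T x)"
  using assms by (simp add: mirror_def orthogonal_transformation_def linear_diff linear_scale)

text \<open>Maximising a functional that is positive on all the normals moves a point into the chamber.\<close>

lemma chamber_point_exists:
  fixes X :: "'a::real_inner set"
  assumes "finite X" "X \<noteq> {}" and closed: "\<And>n x. n \<in> R \<Longrightarrow> x \<in> X \<Longrightarrow> mirror n x \<in> X"
    and \<rho>: "\<And>n. n \<in> R \<Longrightarrow> n \<bullet> \<rho> > 0"
  obtains x where "x \<in> X" "\<And>n. n \<in> R \<Longrightarrow> n \<bullet> x \<ge> 0"
proof -
  obtain x where x: "x \<in> X" "\<And>y. y \<in> X \<Longrightarrow> \<rho> \<bullet> y \<le> \<rho> \<bullet> x"
    using assms(1,2) arg_min_if_finite(1)[of X "\<lambda>x. - (\<rho> \<bullet> x)"]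
      arg_min_least[of X _ "\<lambda>x. - (\<rho> \<bullet> x)"] by (metis neg_le_iff_le)
  have "n \<bullet> x \<ge> 0" if "n \<in> R" for n
  proof (rule ccontr)
    assume neg: "\<not> n \<bullet> x \<ge> 0"
    have pos: "n \<bullet> \<rho> > 0" and "n \<noteq> 0" using \<rho>[OF that] by auto
    then have "(n \<bullet> x) * (\<rho> \<bullet> n) / (n \<bullet> n) < 0"
      using neg by (simp add: inner_commute divide_neg_pos mult_neg_pos)
    then have "\<rho> \<bullet> mirror n x > \<rho> \<bullet> x" by (simp add: inner_mirror_right)
    then show False using x(2)[OF closed[OF that x(1)]] by simp
  qed
  with x(1) show thesis by (rule that)
qed

lemma orthogonal_triple_expansion:
  fixes x :: "real^3"
  assumes "u \<bullet> v = 0" "u \<bullet> w = 0" "v \<bullet> w = 0" "u \<noteq> 0" "v \<noteq> 0" "w \<noteq> 0"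
  shows "x = (x \<bullet> u / (u \<bullet> u)) *\<^sub>R u + (x \<bullet> v / (v \<bullet> v)) *\<^sub>R v + (x \<bullet> w / (w \<bullet> w)) *\<^sub>R w"
    (is "x = ?y")
proof -
  have ne: "u \<noteq> v" "u \<noteq> w" "v \<noteq> w" using assms by auto
  have "pairwise orthogonal {u, v, w}"
    using assms by (auto simp: pairwise_def orthogonal_def inner_commute)
  then have "independent {u, v, w}"
    using assms by (intro pairwise_orthogonal_independent) auto
  moreover have "card {u, v, w} = 3" using ne by simp
  ultimately have "span {u, v, w} = UNIV"
    using card_ge_dim_independent[of "{u, v, w}" UNIV] by auto
  moreover have "orthogonal (x - ?y) a" if "a \<in> {u, v, w}" for a
    using that assms by (auto simp: orthogonal_def inner_diff inner_add inner_commute)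
  ultimately have "orthogonal (x - ?y) (x - ?y)"
    using orthogonal_to_span[of "x - ?y" "{u, v, w}" "x - ?y"] by (metis UNIV_I)
  then show ?thesis by (simp add: orthogonal_self)
qed

text \<open>The square of \<open>cos (pi / p)\<close> for \<open>p = 3, 4, 5\<close>, or at least that of \<open>p = 6\<close>.\<close>

lemma cos_square_cases:
  fixes y :: real
  assumes "4 * y - 1 \<ge> 0" "(2 * y - 1) * (4 * y - 1) \<ge> 0"
    and "(16 * y\<^sup>2 - 12 * y + 1) * (2 * y - 1) \<ge> 0"
    and "(16 * y\<^sup>2 - 16 * y + 3) * (16 * y\<^sup>2 - 12 * y + 1) \<ge> 0"
  shows "y = 1 / 4 \<or> y = 1 / 2 \<or> y = (3 + sqrt 5) / 8 \<or> y \<ge> 3 / 4"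
\<comment> \<open>For y = (cos t)^2 with cos t > 0 the polynomials are, up to positive factors, sin
  (k t) / sin t for k = 3, 4, 5, 6, and the hypotheses forbid opposite signs of neighbours. If the
  first three do not vanish they are positive, so the last is nonnegative, which means that t is at
  most pi / 6.\<close>
proof (rule ccontr)
  assume "\<not> ?thesis"
  then have ne: "y \<noteq> 1 / 4" "y \<noteq> 1 / 2" "y \<noteq> (3 + sqrt 5) / 8" and lt: "y < 3 / 4" by auto
  have "4 * y - 1 > 0" using assms(1) ne by simp
  then have y: "2 * y - 1 > 0" using assms(2) ne by (simp add: zero_le_mult_iff)
  have s: "sqrt 5 * sqrt 5 = 5" "sqrt 5 > 2" by (auto simp: real_less_rsqrt)
  have "16 * y\<^sup>2 - 12 * y + 1 = 16 * (y - (3 + sqrt 5) / 8) * (y - (3 - sqrt 5) / 8)"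
    using s by (simp add: field_simps power2_eq_square)
  \<comment> \<open>The second root is the square of cos (2 pi / 5) and belongs to the pentagram; it
    lies below 1 / 2.\<close>
  moreover have "y - (3 - sqrt 5) / 8 \<noteq> 0" using y s by auto
  ultimately have "16 * y\<^sup>2 - 12 * y + 1 \<noteq> 0" using ne by simp
  moreover have "16 * y\<^sup>2 - 12 * y + 1 \<ge> 0" using assms(3) y by (simp add: zero_le_mult_iff)
  ultimately have "16 * y\<^sup>2 - 16 * y + 3 \<ge> 0" using assms(4) by (simp add: zero_le_mult_iff)
  moreover have "16 * y\<^sup>2 - 16 * y + 3 = (4 * y - 1) * (4 * y - 3)"
    by (simp add: algebra_simps power2_eq_square)
  moreover have "\<dots> < 0" using \<open>4 * y - 1 > 0\<close> lt by (simp add: mult_pos_neg)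
  ultimately show False by simp
qed

text \<open>The triple \<open>(\<alpha>, \<beta>, \<gamma>)\<close> stands for the point \<open>v + \<alpha> n\<^sub>0 + \<beta> n\<^sub>1 + \<gamma> n\<^sub>2\<close>; the rules are the actions of
  the three reflections, with \<open>p = n\<^sub>0 \<bullet> v\<close>. The points obtained by rotating \<open>v\<close> about the centre of the
  facet stay on the inner side of the neighbouring facet only if no rotation by \<open>k\<close> steps falls strictly
  between \<open>0\<close> and \<open>1\<close> steps; this is what excludes star polygons.\<close>

lemma height_words:
  fixes p x z :: real and st :: "real \<Rightarrow> real \<Rightarrow> real \<Rightarrow> bool"
  assumes st: "st 0 0 0"
    and s0: "\<And>\<alpha> \<beta> \<gamma>. st \<alpha> \<beta> \<gamma> \<Longrightarrow> st (- \<alpha> - 2 * p + 2 * x * \<beta>) \<beta> \<gamma>"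
    and s1: "\<And>\<alpha> \<beta> \<gamma>. st \<alpha> \<beta> \<gamma> \<Longrightarrow> st \<alpha> (- \<beta> + 2 * x * \<alpha> + 2 * z * \<gamma>) \<gamma>"
    and s2: "\<And>\<alpha> \<beta> \<gamma>. st \<alpha> \<beta> \<gamma> \<Longrightarrow> st \<alpha> \<beta> (- \<gamma> + 2 * z * \<beta>)"
    and le: "\<And>\<alpha> \<beta> \<gamma>. st \<alpha> \<beta> \<gamma> \<Longrightarrow> \<gamma> \<le> 0"
    and pos: "p > 0" "x > 0" "z > 0"
  defines "good \<equiv> \<lambda>y::real. y = 1 / 4 \<or> y = 1 / 2 \<or> y = (3 + sqrt 5) / 8 \<or> y \<ge> 3 / 4"
  shows "good (x\<^sup>2)" "good (z\<^sup>2)"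
proof -
  have nonneg: "0 \<le> t" if "0 < c" "0 \<le> c * t" for c t :: real
    using that by (simp add: zero_le_mult_iff)
  \<comment> \<open>\<open>s2\<close> moves \<beta> into the third coordinate, so \<open>le\<close>
    also bounds the second coordinate of points whose third one is 0.\<close>
  have \<beta>le: "\<beta> \<le> 0" if "st \<alpha> \<beta> 0" for \<alpha> \<beta>
    using le[OF s2[OF that]] pos by (simp add: mult_le_0_iff)
  have step: "st (- \<alpha> - 2 * p + 2 * x * \<beta>) (- \<beta> + 2 * x * (- \<alpha> - 2 * p + 2 * x * \<beta>)) 0"
    if "st \<alpha> \<beta> 0" for \<alpha> \<beta>
    using s1[OF s0[OF that]] by simp
  \<comment> \<open>Alternating \<open>s0\<close> and \<open>s1\<close> rotates about the facet
    centre. For x = cos t the second coordinate after k steps is - 2 p sin (k t) sin ((k + 1) t) /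
    (sin t)^2; this is where the products in \<open>cos_square_cases\<close> come from.\<close>
  note a1 = step[OF st]
  note a2 = step[OF a1]
  note a3 = step[OF a2]
  note a4 = step[OF a3]
  note a5 = step[OF a4]
  have "0 \<le> (4 * p * x) * ((4 * x\<^sup>2 - 1))"
    using \<beta>le[OF a2] by (simp add: algebra_simps power2_eq_square)
  from nonneg[OF _ this] have 1: "4 * x\<^sup>2 - 1 \<ge> 0" using pos by simp
  have "0 \<le> (8 * p * x) * (((2 * x\<^sup>2 - 1) * (4 * x\<^sup>2 - 1)))"
    using \<beta>le[OF a3] by (simp add: algebra_simps power2_eq_square)
  from nonneg[OF _ this] have 2: "(2 * x\<^sup>2 - 1) * (4 * x\<^sup>2 - 1) \<ge> 0" using pos by simp
  have "0 \<le> (8 * p * x) * (((16 * (x\<^sup>2)\<^sup>2 - 12 * x\<^sup>2 + 1) * (2 * x\<^sup>2 - 1)))"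
    using \<beta>le[OF a4] by (simp add: algebra_simps power2_eq_square)
  from nonneg[OF _ this] have 3: "(16 * (x\<^sup>2)\<^sup>2 - 12 * x\<^sup>2 + 1) * (2 * x\<^sup>2 - 1) \<ge> 0" using pos by simp
  have "0 \<le> (4 * p * x) * (((16 * (x\<^sup>2)\<^sup>2 - 16 * x\<^sup>2 + 3) * (16 * (x\<^sup>2)\<^sup>2 - 12 * x\<^sup>2 + 1)))"
    using \<beta>le[OF a5] by (simp add: algebra_simps power2_eq_square)
  from nonneg[OF _ this] have 4: "(16 * (x\<^sup>2)\<^sup>2 - 16 * x\<^sup>2 + 3) * (16 * (x\<^sup>2)\<^sup>2 - 12 * x\<^sup>2 + 1) \<ge> 0"
    using pos by simp
  show "good (x\<^sup>2)" unfolding good_def using cos_square_cases[OF 1 2 3 4] .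
  \<comment> \<open>Now \<open>s1\<close> and \<open>s2\<close> alternate, which rotates a neighbour
    of the base vertex about that vertex. For z = cos t the third coordinate after k steps is - 4 p
    x sin (k t) sin ((k + 1) t) / (sin t)^2.\<close>
  have step: "st \<alpha> (- \<beta> + 2 * x * \<alpha> + 2 * z * \<gamma>) (- \<gamma> + 2 * z * (- \<beta> + 2 * x * \<alpha> + 2 * z * \<gamma>))"
    if "st \<alpha> \<beta> \<gamma>" for \<alpha> \<beta> \<gamma>
    using s2[OF s1[OF that]] .
  note b1 = step[OF s0[OF st]]
  note b2 = step[OF b1]
  note b3 = step[OF b2]
  note b4 = step[OF b3]
  note b5 = step[OF b4]
  have "0 \<le> (8 * p * x * z) * ((4 * z\<^sup>2 - 1))"
    using le[OF b2] by (simp add: algebra_simps power2_eq_square)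
  from nonneg[OF _ this] have 1: "4 * z\<^sup>2 - 1 \<ge> 0" using pos by simp
  have "0 \<le> (16 * p * x * z) * (((2 * z\<^sup>2 - 1) * (4 * z\<^sup>2 - 1)))"
    using le[OF b3] by (simp add: algebra_simps power2_eq_square)
  from nonneg[OF _ this] have 2: "(2 * z\<^sup>2 - 1) * (4 * z\<^sup>2 - 1) \<ge> 0" using pos by simp
  have "0 \<le> (16 * p * x * z) * (((16 * (z\<^sup>2)\<^sup>2 - 12 * z\<^sup>2 + 1) * (2 * z\<^sup>2 - 1)))"
    using le[OF b4] by (simp add: algebra_simps power2_eq_square)
  from nonneg[OF _ this] have 3: "(16 * (z\<^sup>2)\<^sup>2 - 12 * z\<^sup>2 + 1) * (2 * z\<^sup>2 - 1) \<ge> 0" using pos by simp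
  have "0 \<le> (8 * p * x * z) * (((16 * (z\<^sup>2)\<^sup>2 - 16 * z\<^sup>2 + 3) * (16 * (z\<^sup>2)\<^sup>2 - 12 * z\<^sup>2 + 1)))"
    using le[OF b5] by (simp add: algebra_simps power2_eq_square)
  from nonneg[OF _ this] have 4: "(16 * (z\<^sup>2)\<^sup>2 - 16 * z\<^sup>2 + 3) * (16 * (z\<^sup>2)\<^sup>2 - 12 * z\<^sup>2 + 1) \<ge> 0"
    using pos by simp
  show "good (z\<^sup>2)" unfolding good_def using cos_square_cases[OF 1 2 3 4] .
qed

section \<open>Flags of a regular polyhedron\<close>

text \<open>An orthogonal map that fixes a plane pointwise acts on the normal line by 1 or - 1, and
  moving \<open>x\<close> excludes 1. The vector \<open>x - f x\<close> spans that line because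
  inner products with fixed vectors are preserved.\<close>

lemma orthogonal_transformation_eq_mirror:
  fixes f :: "real^3 \<Rightarrow> real^3"
  assumes f: "orthogonal_transformation f" and u: "f u = u" and w: "f w = w"
    and indep: "u \<noteq> 0" "\<And>c. w \<noteq> c *\<^sub>R u" and x: "f x \<noteq> x"
  shows "f = mirror (x - f x)"
proof -
  define n where "n = x - f x"
  define w' where "w' = w - (w \<bullet> u / (u \<bullet> u)) *\<^sub>R u"
  have lin: "linear f" and inner: "\<And>a b. f a \<bullet> f b = a \<bullet> b"
    using f by (auto simp: orthogonal_transformation_def)
  have w': "f w' = w'" "w' \<noteq> 0" "u \<bullet> w' = 0"
    using indep u w lin
    by (auto simp: w'_def linear_diff linear_scale inner_diff_right inner_commute)
  have n0: "n \<noteq> 0" using x by (simp add: n_def)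
  have n: "u \<bullet> n = 0" "w' \<bullet> n = 0"
    using inner[of u x] inner[of w' x] u w' by (auto simp: n_def inner_diff_right)
  note expand = orthogonal_triple_expansion[OF w'(3) n \<open>u \<noteq> 0\<close> w'(2) n0]
  have fn: "f n \<bullet> u = 0" "f n \<bullet> w' = 0"
    using inner[of n u] inner[of n w'] u w' n by (auto simp: inner_commute)
  define c where "c = f n \<bullet> n / (n \<bullet> n)"
  have c: "f n = c *\<^sub>R n" using expand[of "f n"] fn by (simp add: c_def)
  have "(c * c) * (n \<bullet> n) = n \<bullet> n" using inner[of n n] c by simp
  then have "c * c = 1" using n0 by simp
  then have "c = 1 \<or> c = - 1" by (simp add: square_eq_1_iff)
  have f_eq: "f y = y + ((c - 1) * (y \<bullet> n / (n \<bullet> n))) *\<^sub>R n" for y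
  proof -
    have "f y = f ((y \<bullet> u / (u \<bullet> u)) *\<^sub>R u + (y \<bullet> w' / (w' \<bullet> w')) *\<^sub>R w' + (y \<bullet> n / (n \<bullet> n)) *\<^sub>R n)"
      using expand[of y] by simp
    also have "\<dots> = (y \<bullet> u / (u \<bullet> u)) *\<^sub>R u + (y \<bullet> w' / (w' \<bullet> w')) *\<^sub>R w' + (y \<bullet> n / (n \<bullet> n)) *\<^sub>R n
        + ((c - 1) * (y \<bullet> n / (n \<bullet> n))) *\<^sub>R n"
      using u w' c lin
      by (simp add: linear_add linear_scale left_diff_distrib scaleR_diff_left diff_divide_distrib)
    also have "\<dots> = y + ((c - 1) * (y \<bullet> n / (n \<bullet> n))) *\<^sub>R n" using expand[of y] by simp
    finally show ?thesis .
  qed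
  have "c \<noteq> 1" using f_eq[of x] x by auto
  then have "c = - 1" using \<open>c = 1 \<or> c = - 1\<close> by simp
  have "f y = mirror n y" for y
    unfolding f_eq mirror_def \<open>c = - 1\<close> by (simp add: inner_commute)
  then show ?thesis unfolding n_def by blast
qed

lemma edge_of_polytope_segment:
  fixes P :: "'a::euclidean_space set"
  assumes "polytope P" "e edge_of P"
  obtains a b where "a \<noteq> b" "e = closed_segment a b" "a extreme_point_of P" "b extreme_point_of P"
    "{x. x extreme_point_of P} \<inter> e = {a, b}"
proof -
  have e: "e face_of P" "aff_dim e = 1" using assms(2) by (auto simp: edge_of_def)
  then have "polytope e" using assms(1) face_of_polytope_polytope by blast
  then obtain n where n: "n simplex e" using polytope_lowdim_imp_simplex[of e] e by auto
  then have "n = 1" using aff_dim_simplex e(2) by fastforce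
  then obtain C where C: "int (card C) = 2" "e = convex hull C" using n by (auto simp: simplex_def)
  then have "card C = 2" by simp
  then obtain a b where ab: "a \<noteq> b" "e = closed_segment a b"
    using C(2) by (auto simp: card_2_iff segment_convex_hull)
  have ext: "a extreme_point_of P" "b extreme_point_of P"
    using segment_face_of e(1) ab(2) by blast+
  have "x \<in> {a, b}" if "x extreme_point_of P" "x \<in> e" for x
  proof -
    have "x extreme_point_of e"
      using that e(1) by (meson extreme_point_of_face)
    then show ?thesis using extreme_point_of_segment ab(2) by auto
  qed
  then have "{x. x extreme_point_of P} \<inter> e = {a, b}" using ext ab by auto
  then show thesis using that ab ext by blast
qed

text \<open>A proper face is the intersection of the facets that contain it; a single such facet
  would have to equal \<open>C\<close>, against its dimension. The lemma yields the second facet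
  through an edge and, applied inside a facet, the second edge through a vertex.\<close>

lemma second_facet_exists:
  fixes P :: "'a::euclidean_space set"
  assumes "polytope P" "C face_of P" "C \<noteq> {}" "aff_dim C < aff_dim P - 1" "F facet_of P"
  obtains F' where "F' facet_of P" "C \<subseteq> F'" "F' \<noteq> F"
proof -
  have "C \<noteq> P" using assms(4) by auto
  then have C: "C = \<Inter>{F. F facet_of P \<and> C \<subseteq> F}"
    using face_of_polyhedron polytope_imp_polyhedron assms by blast
  have "\<exists>F'. F' facet_of P \<and> C \<subseteq> F' \<and> F' \<noteq> F"
  proof (rule ccontr)
    assume neg: "\<not> ?thesis"
    obtain F0 where "F0 facet_of P" "C \<subseteq> F0"
      using face_of_polyhedron_subset_facet[of P C] polytope_imp_polyhedron assms \<open>C \<noteq> P\<close> by blast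
    then have "{F. F facet_of P \<and> C \<subseteq> F} = {F}" using neg by blast
    then have "C = F" using C by simp
    then show False using assms by (simp add: facet_of_def)
  qed
  then show thesis using that by blast
qed

lemma flag_of_exists:
  fixes P :: "(real^3) set"
  assumes "polytope P" "aff_dim P = 3" "v extreme_point_of P"
  obtains e F where "flag_of P v e F"
proof -
  have vP: "{v} face_of P" using assms(3) by (simp add: face_of_singleton)
  then obtain F where F: "F facet_of P" "v \<in> F"
    using face_of_polyhedron_subset_facet[of P "{v}"] assms polytope_imp_polyhedron aff_dim_sing
    by (metis insert_not_empty insert_subset numeral_neq_zero)
  have dimF: "aff_dim F = 2" and "F face_of P" using F assms by (auto simp: facet_of_def)
  have "polytope F" using \<open>F face_of P\<close> assms face_of_polytope_polytope by blast
  have vF: "{v} face_of F" using vP F \<open>F face_of P\<close> by (simp add: face_of_face)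
  then obtain e where e: "e facet_of F" "v \<in> e"
    using face_of_polyhedron_subset_facet[of F "{v}"] \<open>polytope F\<close> polytope_imp_polyhedron
      aff_dim_sing dimF by (metis insert_not_empty insert_subset numeral_neq_zero)
  then have "e edge_of P"
    using \<open>F face_of P\<close> dimF by (auto simp: facet_of_def edge_of_def intro: face_of_trans)
  then have "flag_of P v e F"
    using e F assms facet_of_imp_subset by (auto simp: flag_of_def)
  then show thesis by (rule that)
qed

text \<open>An isometry is an orthogonal map followed by a translation, and both carry faces to
  faces.\<close>

lemma isometry_image_extreme_point:
  fixes P :: "(real^3) set"
  assumes "\<And>x y. dist (f x) (f y) = dist x y" "f ` P = P" "x extreme_point_of P"
  shows "f x extreme_point_of P"
proof -
  define g where "g y = f y - f 0" for y
  have "orthogonal_transformation g"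
    using assms(1) by (auto simp: orthogonal_transformation_isometry g_def dist_norm)
  then have g: "linear g" "inj g"
    by (auto simp: orthogonal_transformation_linear orthogonal_transformation_inj)
  have "g ` {x} face_of g ` P"
    using assms(3) g by (simp only: face_of_linear_image face_of_singleton)
  then have "(+) (f 0) ` {g x} face_of (+) (f 0) ` (g ` P)"
    using face_of_translation_eq[of "f 0" "{g x}" "g ` P"] by simp
  moreover have "(+) (f 0) ` (g ` P) = P" using assms(2) by (simp add: g_def image_image)
  ultimately show ?thesis by (simp add: g_def face_of_singleton)
qed

text \<open>The three mirrors take a flag to the flags that differ from it only in the vertex, only in the
  edge, and only in the facet; \<open>a\<close> is the outer normal of the facet.\<close>

lemma regular_polyhedron_mirrors:
  fixes P :: "(real^3) set"
  defines "V \<equiv> {x. x extreme_point_of P}"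
  assumes reg: "regular_polyhedron P" and sphere: "V \<subseteq> sphere 0 1"
  obtains n\<^sub>0 n\<^sub>1 n\<^sub>2 v a where "finite V" "(\<Sum>u\<in>V. u) = 0" "v \<in> V"
    "\<And>n u. n \<in> {n\<^sub>0, n\<^sub>1, n\<^sub>2} \<Longrightarrow> u \<in> V \<Longrightarrow> mirror n u \<in> V"
    "n\<^sub>0 \<bullet> n\<^sub>2 = 0" "n\<^sub>0 \<bullet> n\<^sub>1 < 0" "v \<bullet> n\<^sub>0 > 0" "v \<bullet> n\<^sub>1 = 0" "v \<bullet> n\<^sub>2 = 0"
    "a \<bullet> n\<^sub>0 = 0" "a \<bullet> n\<^sub>1 = 0" "a \<bullet> n\<^sub>2 > 0" "a \<bullet> v > 0" "\<And>u. u \<in> V \<Longrightarrow> a \<bullet> u \<le> a \<bullet> v"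
proof -
  have poly: "polytope P" and dim: "aff_dim P = 3" using reg by (auto simp: regular_polyhedron_def)
  have norm1: "norm u = 1" if "u \<in> V" for u using sphere that by auto
  have finV: "finite V"
    unfolding V_def using poly finite_polyhedron_extreme_points polytope_imp_polyhedron by blast
  have hull: "P = convex hull V" unfolding V_def
    by (rule Krein_Milman_Minkowski) (simp_all add: poly polytope_imp_compact polytope_imp_convex)
  have not_plane: "\<not> (\<forall>u\<in>V. c \<bullet> u = d)" if "c \<noteq> 0" for c d
  proof
    assume "\<forall>u\<in>V. c \<bullet> u = d"
    then have "P \<subseteq> {x. c \<bullet> x = d}" unfolding hull
      by (intro hull_minimal) (auto simp: convex_hyperplane)
    then have "aff_dim P \<le> aff_dim {x. c \<bullet> x = d}" by (rule aff_dim_subset)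
    then show False using dim that by simp
  qed
  have Vne: "V \<noteq> {}" using not_plane[of "axis 1 1"] by auto

  define sym where "sym f \<longleftrightarrow> orthogonal_transformation f \<and> f ` P = P" for f :: "real^3 \<Rightarrow> real^3"
  have symV: "f u \<in> V" if "sym f" "u \<in> V" for f u
    using that isometry_image_extreme_point[of f P u]
    by (auto simp: sym_def V_def orthogonal_transformation_isometry)
  have flag_map: "\<exists>f. sym f \<and> f v = v' \<and> f ` e = e' \<and> f ` F = F'"
    if "flag_of P v e F" "flag_of P v' e' F'" for v v' e e' F F'
  proof -
    obtain f where f: "\<And>x y. dist (f x) (f y) = dist x y" "f ` P = P"
      "f v = v'" "f ` e = e'" "f ` F = F'"
      using reg \<open>flag_of P v e F\<close> \<open>flag_of P v' e' F'\<close> unfolding regular_polyhedron_def by meson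
    have "f ` V \<subseteq> V" using isometry_image_extreme_point[OF f(1,2)] by (auto simp: V_def)
    moreover have "inj_on f V" by (rule inj_onI) (metis f(1) dist_eq_0_iff)
    ultimately have fV: "f ` V = V" using finV endo_inj_surj by blast
    \<comment> \<open>\<open>f\<close> permutes \<open>V\<close>, so \<open>f 0\<close> has distance
      1 from every vertex. The resulting linear equation would confine \<open>V\<close> to a plane
      unless \<open>f 0 = 0\<close>.\<close>
    have "2 * (f 0 \<bullet> u) = f 0 \<bullet> f 0" if "u \<in> V" for u
    proof -
      obtain w where w: "w \<in> V" "u = f w" using \<open>u \<in> V\<close> fV by (metis imageE)
      have "dist (f 0) u = 1" unfolding w(2) f(1) using norm1[OF w(1)] by simp
      then have "(norm (f 0 - u))\<^sup>2 = 1" unfolding dist_norm by simp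
      moreover have "u \<bullet> u = 1" using norm1[OF that] by (simp add: dot_square_norm)
      ultimately show ?thesis
        unfolding power2_norm_eq_inner by (simp add: inner_diff inner_commute)
    qed
    then have "\<forall>u\<in>V. f 0 \<bullet> u = (f 0 \<bullet> f 0) / 2" by (simp add: mult.commute)
    then have "f 0 = 0" using not_plane by blast
    then have "sym f" using f by (auto simp: sym_def orthogonal_transformation_isometry)
    then show ?thesis using f by blast
  qed

  \<comment> \<open>Symmetries fix the sum and act transitively on \<open>V\<close>, so it has the
    same inner product with every vertex; if nonzero, it would be normal to a plane containing
    \<open>V\<close>.\<close>
  have sum0: "(\<Sum>u\<in>V. u) = 0"
  proof (rule ccontr)
    assume g: "(\<Sum>u\<in>V. u) \<noteq> 0"
    obtain v where v: "v \<in> V" using Vne by blast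
    have "(\<Sum>u\<in>V. u) \<bullet> w = (\<Sum>u\<in>V. u) \<bullet> v" if w: "w \<in> V" for w
    proof -
      obtain e F where "flag_of P v e F" using flag_of_exists poly dim v V_def by blast
      moreover obtain e' F' where "flag_of P w e' F'" using flag_of_exists poly dim w V_def by blast
      ultimately obtain f where f: "sym f" "f v = w" using flag_map by blast
      have ot: "orthogonal_transformation f" using f by (simp add: sym_def)
      have "inj_on f V" using orthogonal_transformation_inj[OF ot] by (auto intro: inj_on_subset)
      moreover have "f ` V = V" using endo_inj_surj[OF finV _ \<open>inj_on f V\<close>] symV[OF f(1)] by blast
      ultimately have "f (\<Sum>u\<in>V. u) = (\<Sum>u\<in>V. u)"
        using sum.reindex[of f V "\<lambda>u. u"] linear_sum[OF orthogonal_transformation_linear[OF ot], of "\<lambda>u. u" V]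
        by simp
      then have "(\<Sum>u\<in>V. u) \<bullet> w = f (\<Sum>u\<in>V. u) \<bullet> f v" using f by simp
      also have "\<dots> = (\<Sum>u\<in>V. u) \<bullet> v" using ot by (simp add: orthogonal_transformation_def)
      finally show ?thesis .
    qed
    then show False using not_plane[OF g] by blast
  qed

  have facet: "\<exists>a. F = P \<inter> {x. a \<bullet> x = 1} \<and> P \<subseteq> {x. a \<bullet> x \<le> 1}" if F: "F facet_of P" for F
  proof -
    obtain a b where ab: "a \<noteq> 0" "P \<subseteq> {x. a \<bullet> x \<le> b}" "F = P \<inter> {x. a \<bullet> x = b}"
      using facet_of_polyhedron[OF polytope_imp_polyhedron[OF poly] F] by metis
    have VP: "V \<subseteq> P" by (auto simp: V_def extreme_point_of_def)
    have le: "a \<bullet> u \<le> b" if "u \<in> V" for u using ab VP that by blast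
    \<comment> \<open>Because the vertices sum to zero, \<open>b\<close> is the mean of the
      nonnegative slacks \<open>b - a \<bullet> u\<close>. These do not all vanish, so
      \<open>b > 0\<close> and the facet plane can be rescaled to height 1.\<close>
    have sum: "(\<Sum>u\<in>V. b - a \<bullet> u) = b * card V"
      using sum0 by (simp add: sum_subtractf flip: inner_sum_right)
    have "b \<noteq> 0"
    proof
      assume "b = 0"
      then have "\<forall>u\<in>V. b - a \<bullet> u = 0"
        using sum le finV by (subst sum_nonneg_eq_0_iff[symmetric]) auto
      then show False using not_plane[OF ab(1), of b] by auto
    qed
    moreover have "b * card V \<ge> 0" unfolding sum[symmetric] using le by (intro sum_nonneg) auto
    ultimately have "b > 0" using finV Vne by (simp add: zero_le_mult_iff card_gt_0_iff)
    then show ?thesis using ab by (intro exI[of _ "(1 / b) *\<^sub>R a"]) (auto simp: field_simps)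
  qed

  obtain v where v: "v \<in> V" using Vne by blast
  then obtain e F where flag: "flag_of P v e F" using flag_of_exists poly dim V_def by blast
  then have e: "e edge_of P" and F: "F facet_of P" and ve: "v \<in> e" and eF: "e \<subseteq> F"
    by (auto simp: flag_of_def)
  obtain v' where v': "v' \<in> V" "v' \<noteq> v" "e = closed_segment v v'" "V \<inter> e = {v, v'}"
  proof -
    obtain p q where pq: "p \<noteq> q" "e = closed_segment p q" "p \<in> V" "q \<in> V" "V \<inter> e = {p, q}"
      using edge_of_polytope_segment[OF poly e] unfolding V_def by (metis mem_Collect_eq)
    have "v = p \<or> v = q" using pq(5) v ve by auto
    then show thesis
    proof
      assume "v = p"
      with pq show thesis by (intro that[of q]) auto
    next
      assume "v = q"
      with pq show thesis by (intro that[of p]) (auto simp: closed_segment_commute)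
    qed
  qed
  obtain a where a: "F = P \<inter> {x. a \<bullet> x = 1}" "P \<subseteq> {x. a \<bullet> x \<le> 1}" using facet[OF F] by blast
  have v'e: "v' \<in> e" using v'(3) by simp
  have av: "a \<bullet> v = 1" "a \<bullet> v' = 1" using ve v'e eF a(1) by auto
  have nv: "v \<bullet> v = 1" "v' \<bullet> v' = 1" using norm1 v v'(1) by (auto simp: dot_square_norm)
  have dimF: "aff_dim F = 2" and "F face_of P" using F dim by (auto simp: facet_of_def)
  \<comment> \<open>The affine hull of \<open>F\<close> misses the origin, so \<open>F\<close> spans
    the space. Hence \<open>a\<close> is determined by \<open>F\<close> and is fixed by every
    symmetry that preserves \<open>F\<close>.\<close>
  have F_zero: "c = 0" if "\<And>x. x \<in> F \<Longrightarrow> c \<bullet> x = 0" for c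
  proof -
    have "affine hull F \<subseteq> {x. a \<bullet> x = 1}" using a(1) by (intro hull_minimal) (auto simp: affine_hyperplane)
    then have "0 \<notin> affine hull F" by auto
    then have "aff_dim (insert 0 F) = 3" using dimF by (simp add: aff_dim_insert)
    moreover have "aff_dim (insert 0 F) = int (dim (insert 0 F))"
      by (rule aff_dim_zero) (simp add: hull_inc)
    ultimately have "dim (insert 0 F) = DIM(real^3)" by simp
    then have "span F = UNIV" by (simp only: dim_eq_full span_insert_0)
    moreover have "orthogonal c y" if "y \<in> F" for y
      using \<open>\<And>x. x \<in> F \<Longrightarrow> c \<bullet> x = 0\<close> that by (simp add: orthogonal_def)
    ultimately have "orthogonal c c" using orthogonal_to_span[of c F c] by auto
    then show ?thesis by (simp add: orthogonal_self)
  qed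
  have fixa: "f a = a" if "sym f" "f ` F = F" for f
  proof -
    have "(f a - a) \<bullet> x = 0" if "x \<in> F" for x
    proof -
      obtain y where y: "y \<in> F" "x = f y" using \<open>x \<in> F\<close> \<open>f ` F = F\<close> by (metis imageE)
      have "f a \<bullet> x = a \<bullet> y" using y \<open>sym f\<close> by (simp add: sym_def orthogonal_transformation_def)
      then show ?thesis using y(1) \<open>x \<in> F\<close> a(1) by (simp add: inner_diff_left)
    qed
    then show ?thesis using F_zero[of "f a - a"] by simp
  qed

  have flag': "flag_of P v' e F" using flag v' v'e by (auto simp: flag_of_def V_def)
  obtain f\<^sub>0 where f0: "sym f\<^sub>0" "f\<^sub>0 v = v'" "f\<^sub>0 ` e = e" "f\<^sub>0 ` F = F"
    using flag_map[OF flag flag'] by blast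
  have inj: "inj f" if "sym f" for f using that by (simp add: sym_def orthogonal_transformation_inj)
  have f0v': "f\<^sub>0 v' = v"
  proof -
    have "f\<^sub>0 v' \<in> {v, v'}" using v'(4) symV[OF f0(1) v'(1)] f0(3) v'e by blast
    moreover have "f\<^sub>0 v' \<noteq> f\<^sub>0 v" using inj[OF f0(1)] v'(2) by (simp add: inj_eq)
    ultimately show ?thesis using f0(2) by simp
  qed

  have "polytope F" using \<open>F face_of P\<close> poly face_of_polytope_polytope by blast
  have "{v} face_of P" using v by (simp add: V_def face_of_singleton)
  then have "{v} face_of F" using \<open>F face_of P\<close> ve eF by (auto simp: face_of_face)
  moreover have "e facet_of F"
    using e eF dimF \<open>F face_of P\<close> ve by (auto simp: facet_of_def edge_of_def face_of_face)
  ultimately obtain e' where e': "e' facet_of F" "v \<in> e'" "e' \<noteq> e"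
    using second_facet_exists[OF \<open>polytope F\<close>, of "{v}" e] dimF by auto
  then have "e' edge_of P"
    using \<open>F face_of P\<close> dimF by (auto simp: facet_of_def edge_of_def intro: face_of_trans)
  then have "flag_of P v e' F"
    using e' F v facet_of_imp_subset by (auto simp: flag_of_def V_def)
  then obtain f\<^sub>1 where f1: "sym f\<^sub>1" "f\<^sub>1 v = v" "f\<^sub>1 ` e = e'" "f\<^sub>1 ` F = F"
    using flag_map[OF flag] by blast
  have f1v': "f\<^sub>1 v' \<noteq> v'"
  proof
    assume "f\<^sub>1 v' = v'"
    then have "f\<^sub>1 ` e = e"
      unfolding v'(3) using f1(1,2) closed_segment_linear_image[of f\<^sub>1 v v']
      by (simp add: sym_def orthogonal_transformation_linear)
    then show False using f1(3) e'(3) by simp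
  qed

  have "e face_of P" "aff_dim e = 1" "e \<noteq> {}" using e ve by (auto simp: edge_of_def)
  then obtain F' where F': "F' facet_of P" "e \<subseteq> F'" "F' \<noteq> F"
    using second_facet_exists[OF poly, of e F] dim F by auto
  then have "flag_of P v e F'" using flag by (auto simp: flag_of_def)
  then obtain f\<^sub>2 where f2: "sym f\<^sub>2" "f\<^sub>2 v = v" "f\<^sub>2 ` e = e" "f\<^sub>2 ` F = F'"
    using flag_map[OF flag] by blast
  have f2v': "f\<^sub>2 v' = v'"
  proof -
    have "f\<^sub>2 v' \<in> {v, v'}" using v'(4) symV[OF f2(1) v'(1)] f2(3) v'e by blast
    moreover have "f\<^sub>2 v' \<noteq> f\<^sub>2 v" using inj[OF f2(1)] v'(2) by (simp add: inj_eq)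
    ultimately show ?thesis using f2(2) by simp
  qed
  have f2a: "f\<^sub>2 a \<noteq> a"
  proof
    assume fa: "f\<^sub>2 a = a"
    have a2: "a \<bullet> f\<^sub>2 x = a \<bullet> x" for x
      using fa f2(1) unfolding sym_def orthogonal_transformation_def by metis
    have "f\<^sub>2 ` F = f\<^sub>2 ` P \<inter> {x. a \<bullet> x = 1}" unfolding a(1) using a2 by auto
    then show False using f2 F'(3) a(1) by (simp add: sym_def)
  qed

  have ot: "orthogonal_transformation f\<^sub>0" "orthogonal_transformation f\<^sub>1" "orthogonal_transformation f\<^sub>2"
    using f0(1) f1(1) f2(1) by (auto simp: sym_def)
  note lin = ot[THEN orthogonal_transformation_linear]
  have inner: "f\<^sub>0 x \<bullet> f\<^sub>0 y = x \<bullet> y" "f\<^sub>1 x \<bullet> f\<^sub>1 y = x \<bullet> y" "f\<^sub>2 x \<bullet> f\<^sub>2 y = x \<bullet> y" for x y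
    using ot by (auto simp: orthogonal_transformation_def)
  have fa: "f\<^sub>0 a = a" "f\<^sub>1 a = a" using fixa f0 f1 by auto
  have lt1: "v \<bullet> v' < 1"
  proof -
    have "(v - v') \<bullet> (v - v') > 0" using v'(2) by simp
    then show ?thesis using nv by (simp add: inner_diff inner_commute)
  qed

  \<comment> \<open>The fixed pairs are \<open>v + v'\<close>, \<open>a\<close> for
    \<open>f\<^sub>0\<close>, then \<open>v\<close>, \<open>a\<close> for \<open>f\<^sub>1\<close>,
    and \<open>v\<close>, \<open>v'\<close> for \<open>f\<^sub>2\<close>; the vectors shown to move
    are \<open>v\<close>, \<open>v'\<close> and \<open>a\<close>.\<close>
  have "f\<^sub>0 = mirror (v - f\<^sub>0 v)"
  proof (rule orthogonal_transformation_eq_mirror[OF ot(1)])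
    show "f\<^sub>0 (v + v') = v + v'" using f0(2) f0v' lin by (simp add: linear_add)
    show "f\<^sub>0 a = a" by fact
    show "v + v' \<noteq> 0" using av by (metis inner_add_right inner_zero_right one_add_one zero_neq_numeral)
    show "f\<^sub>0 v \<noteq> v" using f0(2) v'(2) by simp
    \<comment> \<open>If \<open>a\<close> were parallel to \<open>v + v'\<close>, then
      \<open>f\<^sub>1\<close>, which fixes \<open>a\<close> and \<open>v\<close>, would fix
      \<open>v'\<close> as well.\<close>
    show "a \<noteq> c *\<^sub>R (v + v')" for c
    proof
      assume ac: "a = c *\<^sub>R (v + v')"
      then have "c \<noteq> 0" using av(1) by auto
      have "f\<^sub>1 a = c *\<^sub>R (f\<^sub>1 v + f\<^sub>1 v')" using ac lin by (simp add: linear_add linear_scale)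
      then have "f\<^sub>1 v' = v'" using fa ac \<open>c \<noteq> 0\<close> f1(2) by simp
      then show False using f1v' by simp
    qed
  qed
  moreover have "f\<^sub>1 = mirror (v' - f\<^sub>1 v')"
  proof (rule orthogonal_transformation_eq_mirror[OF ot(2) f1(2) fa(2)])
    show "v \<noteq> 0" using nv by auto
    show "a \<noteq> c *\<^sub>R v" for c using av nv lt1 by (auto simp: inner_commute)
    show "f\<^sub>1 v' \<noteq> v'" by fact
  qed
  moreover have "f\<^sub>2 = mirror (a - f\<^sub>2 a)"
  proof (rule orthogonal_transformation_eq_mirror[OF ot(3) f2(2) f2v'])
    show "v \<noteq> 0" using nv by auto
    show "v' \<noteq> c *\<^sub>R v" for c
    proof
      assume c: "v' = c *\<^sub>R v"
      then have "c = 1" using av by simp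
      then show False using c v'(2) by simp
    qed
    show "f\<^sub>2 a \<noteq> a" by fact
  qed
  ultimately have mir: "f\<^sub>0 = mirror (v - v')" "f\<^sub>1 = mirror (v' - f\<^sub>1 v')" "f\<^sub>2 = mirror (a - f\<^sub>2 a)"
    using f0(2) by auto
  have e1: "v \<bullet> f\<^sub>1 v' = v \<bullet> v'" "a \<bullet> f\<^sub>1 v' = 1" using inner(2)[of v v'] inner(2)[of a v'] f1 fa av by auto
  have e2: "v \<bullet> f\<^sub>2 a = 1" "v' \<bullet> f\<^sub>2 a = 1"
    using inner(3)[of v a] inner(3)[of v' a] f2 f2v' av by (auto simp: inner_commute)
  show thesis
  \<comment> \<open>Each normal is orthogonal to two of \<open>v\<close>, \<open>v + v'\<close>,
    \<open>a\<close> and has positive inner product with the third: all of them point into the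
    chamber of the flag.\<close>
  proof (rule that[of v "v - v'" "v' - f\<^sub>1 v'" "a - f\<^sub>2 a" a])
    show "finite V" "(\<Sum>u\<in>V. u) = 0" "v \<in> V" by fact+
    show "mirror n u \<in> V" if "n \<in> {v - v', v' - f\<^sub>1 v', a - f\<^sub>2 a}" "u \<in> V" for n u
      using that symV[OF f0(1)] symV[OF f1(1)] symV[OF f2(1)] mir by (metis insertE singletonD)
    show "(v - v') \<bullet> (a - f\<^sub>2 a) = 0"
      using av e2 by (simp add: inner_diff inner_commute)
    have "(v' - f\<^sub>1 v') \<bullet> (v' - f\<^sub>1 v') > 0" using f1v' by simp
    then have "v' \<bullet> f\<^sub>1 v' < 1" using nv inner(2)[of v' v'] by (simp add: inner_diff inner_commute)
    then show "(v - v') \<bullet> (v' - f\<^sub>1 v') < 0" using nv e1 by (simp add: inner_diff)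
    show "v \<bullet> (v - v') > 0" using nv lt1 by (simp add: inner_diff)
    show "v \<bullet> (v' - f\<^sub>1 v') = 0" "v \<bullet> (a - f\<^sub>2 a) = 0" "a \<bullet> (v - v') = 0" "a \<bullet> (v' - f\<^sub>1 v') = 0"
      using e1 e2 av by (auto simp: inner_diff inner_commute)
    have "(a - f\<^sub>2 a) \<bullet> (a - f\<^sub>2 a) > 0" using f2a by simp
    then show "a \<bullet> (a - f\<^sub>2 a) > 0" using inner(3)[of a a] by (simp add: inner_diff inner_commute)
    show "a \<bullet> v > 0" using av by simp
    show "a \<bullet> u \<le> a \<bullet> v" if "u \<in> V" for u
    proof -
      have "u \<in> P" using that by (simp add: V_def extreme_point_of_def)
      then show ?thesis using a(2) av(1) by auto
    qed
  qed
qed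

section \<open>Classification by the angles between the mirrors\<close>

text \<open>The interface between convexity and reflection groups: from here on, faces enter only
  through the supporting functional \<open>a\<close>.\<close>

locale mirror_system =
  fixes V :: "(real^3) set" and n\<^sub>0 n\<^sub>1 n\<^sub>2 v a :: "real^3"
  assumes finite_V: "finite V" and v_in: "v \<in> V" and norm_V: "u \<in> V \<Longrightarrow> norm u = 1"
    and mirror_V: "n \<in> {n\<^sub>0, n\<^sub>1, n\<^sub>2} \<Longrightarrow> u \<in> V \<Longrightarrow> mirror n u \<in> V"
    and unit: "n\<^sub>0 \<bullet> n\<^sub>0 = 1" "n\<^sub>1 \<bullet> n\<^sub>1 = 1" "n\<^sub>2 \<bullet> n\<^sub>2 = 1"
    and n02: "n\<^sub>0 \<bullet> n\<^sub>2 = 0" and n01: "n\<^sub>0 \<bullet> n\<^sub>1 < 0"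
    and v: "v \<bullet> n\<^sub>0 > 0" "v \<bullet> n\<^sub>1 = 0" "v \<bullet> n\<^sub>2 = 0"
    and a: "a \<bullet> n\<^sub>0 = 0" "a \<bullet> n\<^sub>1 = 0" "a \<bullet> n\<^sub>2 > 0"
    and av: "a \<bullet> v > 0" and support: "u \<in> V \<Longrightarrow> a \<bullet> u \<le> a \<bullet> v"
begin

text \<open>\<open>x\<close> and \<open>z\<close> are the cosines of the angles between the first
  and second and between the second and third mirror; normals pointing into a chamber enclose obtuse
  angles, whence the sign.\<close>

definition x where "x = - (n\<^sub>0 \<bullet> n\<^sub>1)"
definition z where "z = - (n\<^sub>1 \<bullet> n\<^sub>2)"
text \<open>The component of \<open>n\<^sub>1\<close> orthogonal to \<open>n\<^sub>0\<close> and
  \<open>n\<^sub>2\<close>, so that \<open>n\<^sub>0\<close>, \<open>f\<close>,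
  \<open>n\<^sub>2\<close> is an orthogonal frame.\<close>

definition f where "f = n\<^sub>1 + x *\<^sub>R n\<^sub>0 + z *\<^sub>R n\<^sub>2"

lemma x_pos: "x > 0" using n01 by (simp add: x_def)

lemma f_orth: "n\<^sub>0 \<bullet> f = 0" "f \<bullet> n\<^sub>2 = 0"
  using n02 unit by (auto simp: f_def x_def z_def inner_add inner_diff inner_commute)

lemma f_nonzero: "f \<noteq> 0"
proof
  assume "f = 0"
  moreover have "a \<bullet> f = z * (a \<bullet> n\<^sub>2)" "v \<bullet> f = x * (v \<bullet> n\<^sub>0)"
    using a v by (auto simp: f_def inner_add)
  ultimately show False using x_pos v by simp
qed

lemma f_square: "f \<bullet> f = 1 - x\<^sup>2 - z\<^sup>2"
proof -
  have "f \<bullet> f = f \<bullet> n\<^sub>1" using f_orth by (subst (2) f_def) (simp add: inner_add inner_commute)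
  also have "\<dots> = 1 - x\<^sup>2 - z\<^sup>2"
  proof -
    have "n\<^sub>0 \<bullet> n\<^sub>1 = - x" "n\<^sub>2 \<bullet> n\<^sub>1 = - z" by (simp_all add: x_def z_def inner_commute)
    then show ?thesis using unit by (simp add: f_def inner_add_left power2_eq_square)
  qed
  finally show ?thesis .
qed

text \<open>\<open>f \<bullet> f\<close> is the Gram determinant of the three unit normals. Its
  positivity is the condition for a spherical triangle.\<close>

lemma sum_less_1: "x\<^sup>2 + z\<^sup>2 < 1"
  using f_square f_nonzero by (metis diff_gt_0_iff_gt diff_diff_eq inner_gt_zero_iff)

lemma expand: "y = (y \<bullet> n\<^sub>0) *\<^sub>R n\<^sub>0 + (y \<bullet> f / (f \<bullet> f)) *\<^sub>R f + (y \<bullet> n\<^sub>2) *\<^sub>R n\<^sub>2"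
proof -
  have "n\<^sub>0 \<noteq> 0" "n\<^sub>2 \<noteq> 0" using unit by auto
  from orthogonal_triple_expansion[OF f_orth(1) n02 f_orth(2) this(1) f_nonzero this(2), of y]
  show ?thesis using unit by simp
qed

text \<open>\<open>a\<close> is orthogonal to \<open>n\<^sub>0\<close> and \<open>v\<close> to
  \<open>n\<^sub>2\<close>, so in the frame \<open>n\<^sub>0\<close>, \<open>f\<close>,
  \<open>n\<^sub>2\<close> only the components along \<open>f\<close> contribute to
  \<open>a \<bullet> v\<close>. Their product is \<open>z\<close> times a positive number.\<close>

lemma z_pos: "z > 0"
proof -
  have "a \<bullet> f = z * (a \<bullet> n\<^sub>2)" "v \<bullet> f = x * (v \<bullet> n\<^sub>0)"
    using a v by (auto simp: f_def inner_add)
  moreover have "a \<bullet> v = (a \<bullet> f) * (v \<bullet> f) / (f \<bullet> f)"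
    using arg_cong[OF expand[of v], of "\<lambda>y. a \<bullet> y"] a v by (simp add: inner_add)
  ultimately have "0 < z * ((a \<bullet> n\<^sub>2) * (x * (v \<bullet> n\<^sub>0)) / (f \<bullet> f))"
    using av by (simp add: mult.assoc del: zero_less_divide_iff)
  moreover have "(a \<bullet> n\<^sub>2) * (x * (v \<bullet> n\<^sub>0)) / (f \<bullet> f) > 0"
    using a v x_pos f_nonzero by simp
  ultimately show ?thesis by (rule zero_less_mult_pos2)
qed

abbreviation pt :: "real \<Rightarrow> real \<Rightarrow> real \<Rightarrow> real^3" where
  "pt \<alpha> \<beta> \<gamma> \<equiv> v + \<alpha> *\<^sub>R n\<^sub>0 + \<beta> *\<^sub>R n\<^sub>1 + \<gamma> *\<^sub>R n\<^sub>2"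

text \<open>Along \<open>a\<close> only the \<open>n\<^sub>2\<close> component counts, so the
  supporting facet bounds \<gamma>.\<close>

lemma height: "pt \<alpha> \<beta> \<gamma> \<in> V \<Longrightarrow> \<gamma> \<le> 0"
  using support[of "pt \<alpha> \<beta> \<gamma>"] a by (simp add: inner_add mult_le_0_iff)

lemma mirror_pt:
  "mirror n\<^sub>0 (pt \<alpha> \<beta> \<gamma>) = pt (- \<alpha> - 2 * (v \<bullet> n\<^sub>0) + 2 * x * \<beta>) \<beta> \<gamma>"
  "mirror n\<^sub>1 (pt \<alpha> \<beta> \<gamma>) = pt \<alpha> (- \<beta> + 2 * x * \<alpha> + 2 * z * \<gamma>) \<gamma>"
  "mirror n\<^sub>2 (pt \<alpha> \<beta> \<gamma>) = pt \<alpha> \<beta> (- \<gamma> + 2 * z * \<beta>)"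
  using unit n02 v
  by (simp_all add: mirror_def inner_add inner_commute x_def z_def algebra_simps scaleR_2
      flip: scaleR_scaleR)

lemma angle_cases:
  defines "good \<equiv> \<lambda>y::real. y = 1 / 4 \<or> y = 1 / 2 \<or> y = (3 + sqrt 5) / 8 \<or> y \<ge> 3 / 4"
  shows "good (x\<^sup>2)" "good (z\<^sup>2)"
proof -
  have "pt 0 0 0 \<in> V" using v_in by simp
  moreover have "pt (- \<alpha> - 2 * (v \<bullet> n\<^sub>0) + 2 * x * \<beta>) \<beta> \<gamma> \<in> V"
    "pt \<alpha> (- \<beta> + 2 * x * \<alpha> + 2 * z * \<gamma>) \<gamma> \<in> V" "pt \<alpha> \<beta> (- \<gamma> + 2 * z * \<beta>) \<in> V"
    if "pt \<alpha> \<beta> \<gamma> \<in> V" for \<alpha> \<beta> \<gamma>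
    unfolding mirror_pt[symmetric] by (rule mirror_V[OF _ that]; simp)+
  ultimately show "good (x\<^sup>2)" "good (z\<^sup>2)"
    unfolding good_def
    using height_words[of "\<lambda>\<alpha> \<beta> \<gamma>. pt \<alpha> \<beta> \<gamma> \<in> V" "v \<bullet> n\<^sub>0" x z] height v(1) x_pos z_pos by blast+
qed

text \<open>These are the squares of cos (pi / p) and cos (pi / q). Both being at least 1 / 4, the
  bound on their sum also rules out values from 3 / 4 upwards.\<close>

lemma angle_pairs:
  "(x\<^sup>2, z\<^sup>2) \<in> {(1/4, 1/4), (1/4, 1/2), (1/2, 1/4), (1/4, (3 + sqrt 5) / 8), ((3 + sqrt 5) / 8, 1/4)}"
proof -
  have "sqrt 5 > 2" by (simp add: real_less_rsqrt)
  then show ?thesis using angle_cases sum_less_1 by auto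
qed

text \<open>For \<open>u = pt \<alpha> \<beta> \<gamma>\<close> the supporting facet gives \<gamma>
  \<le> 0, the wall of \<open>n\<^sub>2\<close> then \<beta> \<le> 0, and the wall of
  \<open>n\<^sub>1\<close> with \<open>sum_less_1\<close> finally \<alpha> \<le> 0. So
  \<open>u \<bullet> (u - v)\<close> is at most 0, which for unit vectors forces equality.\<close>

lemma chamber_vertex:
  assumes u: "u \<in> V" and pos: "n\<^sub>0 \<bullet> u \<ge> 0" "n\<^sub>1 \<bullet> u \<ge> 0" "n\<^sub>2 \<bullet> u \<ge> 0"
  shows "u = v"
proof -
  obtain \<alpha>' \<beta> \<gamma>' where "u - v = \<alpha>' *\<^sub>R n\<^sub>0 + \<beta> *\<^sub>R f + \<gamma>' *\<^sub>R n\<^sub>2" using expand by blast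
  then have u_v: "u - v = (\<alpha>' + x * \<beta>) *\<^sub>R n\<^sub>0 + \<beta> *\<^sub>R n\<^sub>1 + (\<gamma>' + z * \<beta>) *\<^sub>R n\<^sub>2"
    by (simp add: f_def scaleR_add_right scaleR_add_left mult.commute)
  define \<alpha> \<gamma> where "\<alpha> = \<alpha>' + x * \<beta>" and "\<gamma> = \<gamma>' + z * \<beta>"
  have u_eq: "u = pt \<alpha> \<beta> \<gamma>" using u_v by (simp add: \<alpha>_def \<gamma>_def algebra_simps)
  have \<gamma>: "\<gamma> \<le> 0" using height u u_eq by simp
  have "n\<^sub>2 \<bullet> u = - z * \<beta> + \<gamma>"
    using unit n02 v by (simp add: u_eq inner_add inner_commute z_def)
  then have z\<beta>: "z * \<beta> \<le> \<gamma>" using pos by simp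
  then have \<beta>: "\<beta> \<le> 0" using \<gamma> z_pos by (meson mult_le_0_iff not_less order_trans)
  have "n\<^sub>1 \<bullet> u = - x * \<alpha> + \<beta> - z * \<gamma>"
    using unit n02 v by (simp add: u_eq inner_add inner_commute x_def z_def)
  then have "z * (x * \<alpha>) \<le> z * (\<beta> - z * \<gamma>)" using pos z_pos by simp
  also have "\<dots> \<le> \<gamma> - z\<^sup>2 * \<gamma>" using z\<beta> by (simp add: algebra_simps power2_eq_square)
  also have "\<dots> = (1 - z\<^sup>2) * \<gamma>" by (simp add: algebra_simps)
  also have "\<dots> \<le> 0"
  proof (rule mult_nonneg_nonpos[OF _ \<gamma>])
    show "1 - z\<^sup>2 \<ge> 0" using sum_less_1 zero_le_power2[of x] by linarith
  qed
  finally have \<alpha>: "\<alpha> \<le> 0" using z_pos x_pos by (simp add: mult_le_0_iff)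
  have "u \<bullet> (u - v) = \<alpha> * (n\<^sub>0 \<bullet> u) + \<beta> * (n\<^sub>1 \<bullet> u) + \<gamma> * (n\<^sub>2 \<bullet> u)"
    unfolding u_v by (simp add: inner_add \<alpha>_def \<gamma>_def inner_commute)
  also have "\<dots> \<le> 0" using \<alpha> \<beta> \<gamma> pos by (intro add_nonpos_nonpos mult_nonpos_nonneg) auto
  finally have "u \<bullet> u \<le> u \<bullet> v" by (simp add: inner_diff)
  moreover have "u \<bullet> u = 1" "v \<bullet> v = 1" using norm_V u v_in by (auto simp: dot_square_norm)
  ultimately have "(u - v) \<bullet> (u - v) \<le> 0" by (simp add: inner_diff inner_commute)
  then have "(u - v) \<bullet> (u - v) = 0" using inner_ge_zero[of "u - v"] by linarith
  then show ?thesis by simp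
qed

text \<open>After the isometry that matches the two sets of normals, \<open>w\<close> is the only point of \<open>V\<close> in the closed
  chamber, whereas \<open>V - W\<close> is closed under the mirrors and so would contain such a point if it were not
  empty.\<close>

lemma standard_position:
  fixes N\<^sub>0 N\<^sub>1 N\<^sub>2 w \<rho> :: "real^3"
  assumes N02: "N\<^sub>0 \<bullet> N\<^sub>2 = 0" and N01: "N\<^sub>0 \<bullet> N\<^sub>1 < 0" and N12: "N\<^sub>1 \<bullet> N\<^sub>2 < 0"
    and x: "(N\<^sub>0 \<bullet> N\<^sub>1)\<^sup>2 = x\<^sup>2 * ((N\<^sub>0 \<bullet> N\<^sub>0) * (N\<^sub>1 \<bullet> N\<^sub>1))"
    and z: "(N\<^sub>1 \<bullet> N\<^sub>2)\<^sup>2 = z\<^sup>2 * ((N\<^sub>1 \<bullet> N\<^sub>1) * (N\<^sub>2 \<bullet> N\<^sub>2))"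
    and w: "w \<bullet> N\<^sub>0 > 0" "w \<bullet> N\<^sub>1 = 0" "w \<bullet> N\<^sub>2 = 0"
    and \<rho>: "N\<^sub>0 \<bullet> \<rho> > 0" "N\<^sub>1 \<bullet> \<rho> > 0" "N\<^sub>2 \<bullet> \<rho> > 0"
    and mirror_W: "\<And>n u. n \<in> {N\<^sub>0, N\<^sub>1, N\<^sub>2} \<Longrightarrow> u \<in> W \<Longrightarrow> mirror n u \<in> W" and "w \<in> W"
    and generated: "\<And>X. w \<in> X \<Longrightarrow> (\<And>n u. n \<in> {N\<^sub>0, N\<^sub>1, N\<^sub>2} \<Longrightarrow> u \<in> X \<Longrightarrow> mirror n u \<in> X) \<Longrightarrow> W \<subseteq> X"
  obtains T where "orthogonal_transformation T" "V = (\<lambda>u. (1 / norm w) *\<^sub>R T u) ` W"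
proof -
  have Nne: "N\<^sub>0 \<noteq> 0" "N\<^sub>1 \<noteq> 0" "N\<^sub>2 \<noteq> 0" using \<rho> by auto
  define m\<^sub>0 m\<^sub>1 m\<^sub>2 where m: "m\<^sub>0 = sgn N\<^sub>0" "m\<^sub>1 = sgn N\<^sub>1" "m\<^sub>2 = sgn N\<^sub>2"
  have mm: "m\<^sub>0 \<bullet> m\<^sub>0 = 1" "m\<^sub>1 \<bullet> m\<^sub>1 = 1" "m\<^sub>2 \<bullet> m\<^sub>2 = 1"
    using Nne by (simp_all add: m norm_sgn dot_square_norm)
  have m02: "m\<^sub>0 \<bullet> m\<^sub>2 = 0" using N02 by (simp add: m sgn_div_norm)
  have sgn_inner: "sgn p \<bullet> sgn q = - t"
    if "p \<bullet> q < 0" "(p \<bullet> q)\<^sup>2 = t\<^sup>2 * ((p \<bullet> p) * (q \<bullet> q))" "t > 0" for p q :: "real^3" and t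
  proof -
    have ne: "p \<noteq> 0" "q \<noteq> 0" using that by auto
    have "(p \<bullet> q)\<^sup>2 = (t * norm p * norm q)\<^sup>2"
      using that by (simp add: power_mult_distrib power2_norm_eq_inner)
    moreover have "t * norm p * norm q \<ge> 0" using that by simp
    ultimately have "p \<bullet> q = - (t * norm p * norm q)"
      using that(1) unfolding power2_eq_iff by linarith
    then show ?thesis using ne by (simp add: sgn_div_norm field_simps)
  qed
  have m01: "m\<^sub>0 \<bullet> m\<^sub>1 = - local.x" and m12: "m\<^sub>1 \<bullet> m\<^sub>2 = - local.z"
    using sgn_inner N01 N12 x z x_pos z_pos m by auto
  define F where "F = m\<^sub>1 + local.x *\<^sub>R m\<^sub>0 + local.z *\<^sub>R m\<^sub>2"
  have F: "m\<^sub>0 \<bullet> F = 0" "F \<bullet> m\<^sub>2 = 0"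
    using m02 mm m01 m12 by (auto simp: F_def inner_add inner_commute)
  have FF: "F \<bullet> F = f \<bullet> f"
  proof -
    have "F \<bullet> F = F \<bullet> m\<^sub>1" using F by (subst (2) F_def) (simp add: inner_add inner_commute)
    then show ?thesis
      using mm m01 m12 f_square by (simp add: F_def inner_add inner_commute power2_eq_square)
  qed
  have ff: "f \<bullet> f \<noteq> 0" using f_nonzero by simp
  \<comment> \<open>\<open>T\<close> matches the two orthogonal frames. It is orthogonal because the
    normals have the same Gram matrix on both sides.\<close>
  define T where "T y = (y \<bullet> n\<^sub>0) *\<^sub>R m\<^sub>0 + (y \<bullet> f / (f \<bullet> f)) *\<^sub>R F + (y \<bullet> n\<^sub>2) *\<^sub>R m\<^sub>2" for y
  have "linear T"
    by (rule linearI)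
       (simp_all add: T_def inner_add_left add_divide_distrib scaleR_add_left scaleR_add_right)
  have inner_T: "T y \<bullet> T y' = y \<bullet> y'" for y y'
  proof -
    have "T y \<bullet> T y' = (y \<bullet> n\<^sub>0) * (y' \<bullet> n\<^sub>0) + (y \<bullet> f) * (y' \<bullet> f) / (f \<bullet> f) + (y \<bullet> n\<^sub>2) * (y' \<bullet> n\<^sub>2)"
      using mm m02 F FF ff by (simp add: T_def inner_add inner_commute)
    also have "\<dots> = y \<bullet> y'"
      using arg_cong[OF expand[of y'], of "\<lambda>t. y \<bullet> t"] by (simp add: inner_add inner_commute)
    finally show ?thesis .
  qed
  have T: "orthogonal_transformation T"
    using \<open>linear T\<close> inner_T by (simp add: orthogonal_transformation_def)
  have T0: "T n\<^sub>0 = m\<^sub>0" and T2: "T n\<^sub>2 = m\<^sub>2"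
    using unit n02 f_orth by (simp_all add: T_def inner_commute)
  have "T f = F" using f_orth ff by (simp add: T_def inner_commute)
  moreover have "T (f - local.x *\<^sub>R n\<^sub>0 - local.z *\<^sub>R n\<^sub>2) = T f - local.x *\<^sub>R T n\<^sub>0 - local.z *\<^sub>R T n\<^sub>2"
    using \<open>linear T\<close> by (simp add: linear_diff linear_scale)
  moreover have "f - local.x *\<^sub>R n\<^sub>0 - local.z *\<^sub>R n\<^sub>2 = n\<^sub>1" by (simp add: f_def)
  ultimately have T1: "T n\<^sub>1 = m\<^sub>1" using T0 T2 by (simp add: F_def)

  define r where "r = norm w"
  have "w \<noteq> 0" using w by auto
  then have r: "r > 0" by (simp add: r_def)
  define X where "X = (\<lambda>u. r *\<^sub>R T u) ` V"
  have "finite X" using finite_V by (simp add: X_def)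
  have X_mirror: "mirror n u \<in> X" if n: "n \<in> {N\<^sub>0, N\<^sub>1, N\<^sub>2}" and u: "u \<in> X" for n u
  proof -
    obtain y where y: "y \<in> V" "u = r *\<^sub>R T y" using u by (auto simp: X_def)
    obtain k where k: "k \<in> {n\<^sub>0, n\<^sub>1, n\<^sub>2}" "T k = sgn n" using n T0 T1 T2 m by auto
    have "n \<noteq> 0" using n Nne by auto
    then have "mirror n u = mirror (T k) u"
      unfolding k sgn_div_norm by (subst mirror_scaleR) auto
    also have "\<dots> = r *\<^sub>R T (mirror k y)"
      using y(2) by (simp add: mirror_image_commute[OF T] linear_scale[OF linear_mirror])
    finally show ?thesis unfolding X_def using mirror_V[OF k(1) y(1)] by (rule image_eqI)
  qed
  have chamber: "u = r *\<^sub>R T v" if "u \<in> X" "\<And>n. n \<in> {N\<^sub>0, N\<^sub>1, N\<^sub>2} \<Longrightarrow> n \<bullet> u \<ge> 0" for u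
  proof -
    obtain y where y: "y \<in> V" "u = r *\<^sub>R T y" using \<open>u \<in> X\<close> by (auto simp: X_def)
    have "k \<bullet> y \<ge> 0" if "T k = sgn n" "n \<in> {N\<^sub>0, N\<^sub>1, N\<^sub>2}" for k n
    proof -
      have "r * (k \<bullet> y) = sgn n \<bullet> u" using y(2) inner_T[of k y] that by simp
      also have "\<dots> \<ge> 0" using \<open>\<And>n. n \<in> {N\<^sub>0, N\<^sub>1, N\<^sub>2} \<Longrightarrow> n \<bullet> u \<ge> 0\<close> that by (simp add: sgn_div_norm)
      finally show ?thesis using r by (simp add: zero_le_mult_iff)
    qed
    then have "y = v" using chamber_vertex[OF y(1)] T0 T1 T2 m by blast
    then show ?thesis using y(2) by simp
  qed
  have "r *\<^sub>R T v = w"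
  proof -
    have Tv: "T v \<bullet> m\<^sub>1 = 0" "T v \<bullet> m\<^sub>2 = 0" "T v \<bullet> m\<^sub>0 > 0"
      using inner_T[of v] v T0 T1 T2 by metis+
    have ww: "w \<bullet> m\<^sub>1 = 0" "w \<bullet> m\<^sub>2 = 0" "w \<bullet> m\<^sub>0 > 0" using w Nne by (simp_all add: m sgn_div_norm)
    have "m\<^sub>0 \<noteq> 0" "m\<^sub>2 \<noteq> 0" "F \<noteq> 0" using mm FF ff by auto
    note ex = orthogonal_triple_expansion[OF F(1) m02 F(2) this(1,3,2)]
    \<comment> \<open>\<open>b\<close> spans the line orthogonal to \<open>m\<^sub>1\<close> and
      \<open>m\<^sub>2\<close>. Both \<open>T v\<close> and \<open>w\<close> lie on it, and their
      positive inner products with \<open>m\<^sub>0\<close> put them on the same ray.\<close>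
    define b where "b = m\<^sub>0 + (local.x / (F \<bullet> F)) *\<^sub>R F"
    have "y = (y \<bullet> m\<^sub>0) *\<^sub>R b" if "y \<bullet> m\<^sub>1 = 0" "y \<bullet> m\<^sub>2 = 0" for y
    proof -
      have "y \<bullet> F = local.x * (y \<bullet> m\<^sub>0)" using that by (simp add: F_def inner_add)
      then have "(y \<bullet> m\<^sub>0 / (m\<^sub>0 \<bullet> m\<^sub>0)) *\<^sub>R m\<^sub>0 + (y \<bullet> F / (F \<bullet> F)) *\<^sub>R F + (y \<bullet> m\<^sub>2 / (m\<^sub>2 \<bullet> m\<^sub>2)) *\<^sub>R m\<^sub>2
          = (y \<bullet> m\<^sub>0) *\<^sub>R b"
        using mm that by (simp add: b_def algebra_simps)
      with ex[of y] show ?thesis by (rule trans)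
    qed
    then have eq: "T v = (T v \<bullet> m\<^sub>0) *\<^sub>R b" "w = (w \<bullet> m\<^sub>0) *\<^sub>R b" using Tv ww by auto
    have "norm (T v) = 1" using inner_T[of v v] norm_V[OF v_in] by (simp add: norm_eq_sqrt_inner)
    then have "T v = sgn (T v)" by (simp add: sgn_div_norm)
    also have "\<dots> = sgn b" by (subst eq) (use Tv in \<open>simp add: sgn_scaleR\<close>)
    also have "\<dots> = sgn w" by (subst eq(2)) (use ww in \<open>simp add: sgn_scaleR\<close>)
    finally show ?thesis using r by (simp add: r_def sgn_div_norm)
  qed
  then have "w \<in> X" using v_in by (auto simp: X_def)
  then have "W \<subseteq> X" using generated X_mirror by blast
  moreover have "X - W = {}"
  proof (rule ccontr)
    assume "X - W \<noteq> {}"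
    moreover have "mirror n u \<in> X - W" if "n \<in> {N\<^sub>0, N\<^sub>1, N\<^sub>2}" "u \<in> X - W" for n u
      using that X_mirror mirror_W by (metis DiffD1 DiffD2 DiffI mirror_mirror)
    ultimately obtain u where "u \<in> X - W" "\<And>n. n \<in> {N\<^sub>0, N\<^sub>1, N\<^sub>2} \<Longrightarrow> n \<bullet> u \<ge> 0"
      using chamber_point_exists[of "X - W" "{N\<^sub>0, N\<^sub>1, N\<^sub>2}" \<rho>] \<open>finite X\<close> \<rho> by (metis finite_Diff insertE singletonD)
    then show False using chamber \<open>r *\<^sub>R T v = w\<close> \<open>w \<in> W\<close> by blast
  qed
  ultimately have XW: "X = W" by blast
  obtain T' where T': "orthogonal_transformation T'" "\<And>y. T' (T y) = y"
    using orthogonal_transformation_inv[OF T] orthogonal_transformation_inj[OF T] by (metis inv_f_f)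
  have "(1 / norm w) *\<^sub>R T' (r *\<^sub>R T y) = y" for y
    using r T' by (simp add: r_def linear_scale[OF orthogonal_transformation_linear])
  then have "V = (\<lambda>u. (1 / norm w) *\<^sub>R T' u) ` W"
    unfolding XW[symmetric] X_def by (simp add: image_image)
  with T'(1) show thesis by (rule that)
qed

end

section \<open>Rank sums and rearrangement\<close>

abbreviation vec3 :: "real \<Rightarrow> real \<Rightarrow> real \<Rightarrow> real^3" where "vec3 a b c \<equiv> vector [a, b, c]"

lemma vec3_eq_iff: "vec3 a b c = vec3 a' b' c' \<longleftrightarrow> a = a' \<and> b = b' \<and> c = c'"
  by (simp add: vec_eq_iff forall_3)

lemma vec3_cases: obtains a b c where "w = vec3 a b c"
proof
  show "w = vec3 (w $ 1) (w $ 2) (w $ 3)" by (simp add: vec_eq_iff forall_3)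
qed

lemma inner_vec3 [simp]: "vec3 a b c \<bullet> vec3 a' b' c' = a * a' + b * b' + c * c'"
  by (simp add: inner_vec_def sum_3)

lemma vec3_arith [simp]:
  "vec3 a b c + vec3 a' b' c' = vec3 (a + a') (b + b') (c + c')"
  "vec3 a b c - vec3 a' b' c' = vec3 (a - a') (b - b') (c - c')"
  "- vec3 a b c = vec3 (- a) (- b) (- c)"
  "r *\<^sub>R vec3 a b c = vec3 (r * a) (r * b) (r * c)"
  by (simp_all add: vec_eq_iff forall_3)

lemma vec3_zero: "0 = vec3 0 0 0"
  by (simp add: vec_eq_iff forall_3)

lemma mirror_vec3 [simp]:
  "mirror (vec3 1 0 0) (vec3 a b c) = vec3 (- a) b c"
  "mirror (vec3 0 0 1) (vec3 a b c) = vec3 a b (- c)"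
  "mirror (vec3 1 (- 1) 0) (vec3 a b c) = vec3 b a c"
  "mirror (vec3 0 1 (- 1)) (vec3 a b c) = vec3 a c b"
  "mirror (vec3 0 1 1) (vec3 a b c) = vec3 a (- c) (- b)"
  by (simp_all add: mirror_def vec3_eq_iff field_simps)

definition golden :: real where "golden = (1 + sqrt 5) / 2"
text \<open>The reciprocal of \<open>golden\<close>, written as a difference to keep expressions
  linear in \<open>golden\<close>.\<close>

definition golden' :: real where "golden' = golden - 1"

text \<open>Used for rewriting, these reduce every polynomial in \<open>golden\<close> to degree
  one; the second form catches products nested to the right.\<close>

lemma golden_mult: "golden * golden = golden + 1" "golden * (golden * r) = golden * r + r"
proof -
  show "golden * golden = golden + 1" by (simp add: golden_def field_simps)
  then show "golden * (golden * r) = golden * r + r" by (simp add: algebra_simps flip: mult.assoc)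
qed

lemma golden_bounds: "809 / 500 < golden" "golden < 16181 / 10000"
proof -
  have "559 / 250 < sqrt 5" by (rule real_less_rsqrt) (simp add: power2_eq_square)
  moreover have "sqrt 5 < 11181 / 5000" by (rule real_less_lsqrt) (simp_all add: power2_eq_square)
  ultimately show "809 / 500 < golden" "golden < 16181 / 10000" by (simp_all add: golden_def)
qed

lemma golden_neq [simp]:
  "golden \<noteq> 0" "golden \<noteq> 1" "golden \<noteq> - 1" "golden' \<noteq> 0" "golden' \<noteq> 1" "golden' \<noteq> - 1"
  "1 \<noteq> golden'" "1 \<noteq> golden" "0 \<noteq> golden" "0 \<noteq> golden'" "- 1 \<noteq> golden" "- 1 \<noteq> golden'"
  "- golden \<noteq> golden" "golden \<noteq> - golden" "- golden' \<noteq> golden'" "golden' \<noteq> - golden'"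
  "golden \<noteq> golden'" "golden' \<noteq> golden" "- golden \<noteq> golden'" "- golden' \<noteq> golden"
  "golden \<noteq> - golden'" "golden' \<noteq> - golden" "- golden = - 1 \<longleftrightarrow> False" "- golden' = - 1 \<longleftrightarrow> False"
  using golden_bounds by (auto simp: golden'_def)

section \<open>Lists weighted by arithmetic progressions\<close>

primrec arith_sum :: "real \<Rightarrow> real \<Rightarrow> 'a::real_vector list \<Rightarrow> 'a" where
  "arith_sum d k [] = 0"
| "arith_sum d k (p # ps) = k *\<^sub>R p + arith_sum d (k + d) ps"

lemma arith_sum_eq: "arith_sum d k L = (\<Sum>i<length L. (k + d * real i) *\<^sub>R L ! i)"
  by (induction L arbitrary: k)
     (simp_all add: sum.lessThan_Suc_shift distrib_left add.assoc del: sum.lessThan_Suc)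

lemma arith_sum_append: "arith_sum d k (xs @ ys) = arith_sum d k xs + arith_sum d (k + d * length xs) ys"
  by (induction xs arbitrary: k) (simp_all add: algebra_simps)

lemma arith_sum_shift: "arith_sum d (k + j) L = arith_sum d k L + j *\<^sub>R sum_list L"
proof (induction L arbitrary: k)
  case (Cons p L)
  show ?case using Cons.IH[of "k + d"] by (simp add: algebra_simps)
qed simp

text \<open>For a centrally symmetric set, the points on the upper half, sorted upwards, determine the whole
  order; the ranks of antipodal points combine to the weights \<open>1, 3, 5, \<dots>\<close>.\<close>

abbreviation symmetrize :: "'a::uminus list \<Rightarrow> 'a list" where
  "symmetrize H \<equiv> map uminus (rev H) @ H"

lemma arith_sum_symmetrize:
  fixes H :: "'a::real_vector list"
  shows "arith_sum 1 1 (symmetrize H) = arith_sum 2 1 H"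
proof (induction H rule: rev_induct)
  case (snoc p H)
  have "sum_list (map uminus xs) = - sum_list xs" for xs :: "'a list" by (induction xs) auto
  \<comment> \<open>Putting \<open>- p\<close> in front raises all other ranks by one, which costs
    nothing as the list sums to zero. The outer pair contributes its difference of ranks, the next
    odd number, times \<open>p\<close>.\<close>
  then have "sum_list (symmetrize H) = 0" by (simp add: sum_list_rev)
  then have "arith_sum 1 2 (symmetrize H) = arith_sum 2 1 H"
    using arith_sum_shift[of 1 1 1 "symmetrize H"] snoc by simp
  moreover have "symmetrize (H @ [p]) = (- p # symmetrize H) @ [p]" by simp
  ultimately show ?case
    unfolding \<open>symmetrize (H @ [p]) = _\<close> arith_sum_append[of _ _ _ "[p]"] arith_sum_append[of _ _ H "[p]"]
    by (simp add: scaleR_add_left scaleR_2 add.assoc flip: arith_sum_append)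
qed simp

text \<open>The leading 0 expresses that all of \<open>H\<close> lies in the closed upper half
  space.\<close>

lemma sorted_symmetrize:
  fixes w :: "'a::real_inner"
  assumes "sorted (0 # map ((\<bullet>) w) H)"
  shows "sorted (map ((\<bullet>) w) (symmetrize H))"
proof -
  have "sorted_wrt (\<le>) (map ((\<bullet>) w) (map uminus (rev H)))"
    using assms by (simp add: sorted_wrt_map sorted_wrt_rev)
  moreover have "w \<bullet> x \<ge> 0" if "x \<in> set H" for x using assms that by auto
  ultimately show ?thesis using assms
    by (auto simp: sorted_append intro: order_trans[of _ 0])
qed

section \<open>The rearrangement inequality\<close>

lemma sum_sgn_diff:
  fixes t N :: nat
  assumes "t \<in> {1..N}"
  shows "(\<Sum>s=1..N. sgn (real t - real s)) = 2 * real t - real N - 1"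
proof -
  have eq: "{1..N} = {1..<t} \<union> {t} \<union> {t<..N}" using assms by auto
  have "(\<Sum>s=1..N. sgn (real t - real s))
      = (\<Sum>s\<in>{1..<t}. sgn (real t - real s)) + (\<Sum>s\<in>{t<..N}. sgn (real t - real s))"
    unfolding eq by (subst sum.union_disjoint; (subst sum.union_disjoint)?; force)
  also have "\<dots> = (\<Sum>s\<in>{1..<t}. 1) + (\<Sum>s\<in>{t<..N}. - 1)"
    by (intro arg_cong2[where f="(+)"] sum.cong) auto
  also have "\<dots> = real (t - 1) - real (N - t)" by simp
  finally show ?thesis using assms by (simp add: of_nat_diff)
qed

text \<open>The number of ranks below \<open>t\<close> minus the number above is
  \<open>2 t - N - 1\<close>, so a rank-weighted sum becomes a signed sum over pairs. The correction
  is the plain sum, which no reordering changes.\<close>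

lemma rank_sum_pairs:
  fixes y :: "nat \<Rightarrow> real"
  shows "(\<Sum>t=1..N. \<Sum>s=1..N. sgn (real t - real s) * (y t - y s))
    = 4 * (\<Sum>t=1..N. real t * y t) - 2 * (real N + 1) * (\<Sum>t=1..N. y t)"
proof -
  let ?S = "\<Sum>t=1..N. (2 * real t - real N - 1) * y t"
  have 1: "(\<Sum>t=1..N. \<Sum>s=1..N. sgn (real t - real s) * y t) = ?S"
    by (intro sum.cong refl) (simp only: sum_distrib_right[symmetric] sum_sgn_diff)
  have "(\<Sum>t=1..N. \<Sum>s=1..N. sgn (real t - real s) * y s)
      = (\<Sum>s=1..N. \<Sum>t=1..N. - (sgn (real s - real t) * y s))"
    by (subst sum.swap) (intro sum.cong refl, simp add: sgn_if)
  then have 2: "(\<Sum>t=1..N. \<Sum>s=1..N. sgn (real t - real s) * y s) = - ?S"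
    using 1 by (simp add: sum_negf)
  have "?S = (\<Sum>t=1..N. 2 * (real t * y t) - (real N + 1) * y t)"
    by (intro sum.cong refl) (simp add: algebra_simps)
  then have "?S = 2 * (\<Sum>t=1..N. real t * y t) - (real N + 1) * (\<Sum>t=1..N. y t)"
    by (simp only: sum_subtractf sum_distrib_left)
  moreover have "(\<Sum>t=1..N. \<Sum>s=1..N. sgn (real t - real s) * (y t - y s)) = ?S - - ?S"
    using 1 2 by (simp only: right_diff_distrib sum_subtractf)
  ultimately show ?thesis by simp
qed

text \<open>Each signed difference is at most its absolute value, with equality for the sorted
  order, and the total of the absolute values does not depend on the order.\<close>

lemma rearrangement:
  fixes x :: "'a \<Rightarrow> real" and N :: nat
  assumes n: "bij_betw n {1..N} A" and m: "bij_betw m {1..N} A"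
    and mono: "\<And>s t. 1 \<le> s \<Longrightarrow> s \<le> t \<Longrightarrow> t \<le> N \<Longrightarrow> x (m s) \<le> x (m t)"
  shows "(\<Sum>t=1..N. real t * x (n t)) \<le> (\<Sum>t=1..N. real t * x (m t))"
proof -
  have abs_sum: "(\<Sum>t=1..N. \<Sum>s=1..N. \<bar>x (k t) - x (k s)\<bar>) = (\<Sum>p\<in>A. \<Sum>q\<in>A. \<bar>x p - x q\<bar>)"
    if "bij_betw k {1..N} A" for k
    using sum.reindex_bij_betw[OF that, of "\<lambda>p. \<Sum>q\<in>A. \<bar>x p - x q\<bar>"]
      sum.reindex_bij_betw[OF that, of "\<lambda>q. \<bar>x p - x q\<bar>" for p] by simp
  have "(\<Sum>t=1..N. \<Sum>s=1..N. sgn (real t - real s) * (x (n t) - x (n s)))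
      \<le> (\<Sum>t=1..N. \<Sum>s=1..N. \<bar>x (n t) - x (n s)\<bar>)"
    by (intro sum_mono) (auto simp: sgn_if)
  also have "\<dots> = (\<Sum>t=1..N. \<Sum>s=1..N. \<bar>x (m t) - x (m s)\<bar>)" using abs_sum n m by simp
  also have "\<dots> = (\<Sum>t=1..N. \<Sum>s=1..N. sgn (real t - real s) * (x (m t) - x (m s)))"
  proof (intro sum.cong refl)
    fix t s assume "t \<in> {1..N}" "s \<in> {1..N}"
    then show "\<bar>x (m t) - x (m s)\<bar> = sgn (real t - real s) * (x (m t) - x (m s))"
      using mono[of s t] mono[of t s] by (auto simp: sgn_if)
  qed
  finally have "4 * (\<Sum>t=1..N. real t * x (n t)) - 2 * (real N + 1) * (\<Sum>t=1..N. x (n t))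
      \<le> 4 * (\<Sum>t=1..N. real t * x (m t)) - 2 * (real N + 1) * (\<Sum>t=1..N. x (m t))"
    by (simp only: rank_sum_pairs)
  moreover have "(\<Sum>t=1..N. x (n t)) = (\<Sum>t=1..N. x (m t))"
    using sum.reindex_bij_betw[OF n, of x] sum.reindex_bij_betw[OF m, of x] by simp
  ultimately show ?thesis by simp
qed

section \<open>Maximal rank sums\<close>

definition rank_sum :: "nat \<Rightarrow> (nat \<Rightarrow> 'a::real_vector) \<Rightarrow> 'a" where
  "rank_sum N n = (\<Sum>t=1..N. real t *\<^sub>R n t)"

lemma rank_sum_list: "rank_sum (length L) (\<lambda>t. L ! (t - 1)) = arith_sum 1 1 L"
proof -
  have "rank_sum (length L) (\<lambda>t. L ! (t - 1)) = (\<Sum>i<length L. real (Suc i) *\<^sub>R L ! i)"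
    unfolding rank_sum_def by (rule sum.reindex_bij_witness[of _ Suc "\<lambda>t. t - 1"]) auto
  then show ?thesis by (simp add: arith_sum_eq)
qed

lemma bij_betw_list:
  assumes "distinct L"
  shows "bij_betw (\<lambda>t. L ! (t - 1)) {1..length L} (set L)"
proof -
  have "bij_betw (\<lambda>t. t - 1) {1..length L} {..<length L}"
    by (rule bij_betw_byWitness[where f' = Suc]) auto
  from bij_betw_trans[OF this bij_betw_nth[OF assms refl refl]] show ?thesis by (simp add: o_def)
qed

text \<open>\<open>K\<close> is the square of the largest length, which avoids roots when candidates
  are compared.\<close>

definition max_rank_sum :: "'a::real_inner set \<Rightarrow> real \<Rightarrow> bool" where
  "max_rank_sum W K \<longleftrightarrow>
     (\<forall>n. bij_betw n {1..card W} W \<longrightarrow> rank_sum (card W) n \<bullet> rank_sum (card W) n \<le> K) \<and>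
     (\<exists>n. bij_betw n {1..card W} W \<and> rank_sum (card W) n \<bullet> rank_sum (card W) n = K)"

text \<open>A rank sum \<open>S\<close> may be moved into the chamber; there \<open>S \<bullet> S\<close> is bounded by the rearrangement
  inequality, applied to the functional given by \<open>S\<close> itself.\<close>

lemma max_rank_sumI:
  fixes W :: "'a::real_inner set"
  assumes fin: "finite W"
    and closed: "\<And>n u. n \<in> R \<Longrightarrow> u \<in> W \<Longrightarrow> mirror n u \<in> W"
    and \<rho>: "\<And>n. n \<in> R \<Longrightarrow> n \<bullet> \<rho> > 0"
    and sorting: "\<And>w. (\<And>n. n \<in> R \<Longrightarrow> n \<bullet> w \<ge> 0) \<Longrightarrow>
      \<exists>L. set L = W \<and> length L = card W \<and> sorted (map ((\<bullet>) w) L) \<and> arith_sum 1 1 L \<bullet> arith_sum 1 1 L \<le> K"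
    and best: "set L = W" "length L = card W" "arith_sum 1 1 L \<bullet> arith_sum 1 1 L = K"
  shows "max_rank_sum W K"
  unfolding max_rank_sum_def
proof (intro conjI allI impI)
  let ?N = "card W"
  have dist: "distinct L" if "set L = W" "length L = card W" for L
    using that by (intro card_distinct) simp
  show "\<exists>n. bij_betw n {1..?N} W \<and> rank_sum ?N n \<bullet> rank_sum ?N n = K"
    using bij_betw_list[OF dist[OF best(1,2)]] rank_sum_list[of L] best
    by (intro exI[of _ "\<lambda>t. L ! (t - 1)"]) simp
  fix n assume n: "bij_betw n {1..?N} W"
  define B where "B = {m \<in> {1..?N} \<rightarrow>\<^sub>E W. bij_betw m {1..?N} W}"
  \<comment> \<open>Mirrors permute \<open>W\<close> and preserve norms, so they act on
    \<open>X\<close>; the chamber point found in \<open>X\<close> still has the norm that is to be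
    bounded.\<close>
  define X where "X = {S \<in> rank_sum ?N ` B. norm S = norm (rank_sum ?N n)}"
  have "finite B" using fin by (simp add: B_def finite_PiE)
  then have "finite X" by (simp add: X_def)
  have B: "rank_sum ?N m \<in> rank_sum ?N ` B" if "bij_betw m {1..?N} W" for m
  proof
    show "rank_sum ?N m = rank_sum ?N (restrict m {1..?N})" by (simp add: rank_sum_def)
    show "restrict m {1..?N} \<in> B"
      using that bij_betwE[OF that] by (simp add: B_def bij_betw_restrict_eq)
  qed
  have "mirror k S \<in> X" if "k \<in> R" "S \<in> X" for k S
  proof -
    obtain m where m: "m \<in> B" "S = rank_sum ?N m" using \<open>S \<in> X\<close> by (auto simp: X_def)
    have "bij_betw (mirror k) W W"
      using closed[OF that(1)] by (intro bij_betw_byWitness[where f' = "mirror k"]) auto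
    then have "bij_betw (mirror k \<circ> m) {1..?N} W"
      using m(1) by (auto simp: B_def intro: bij_betw_trans)
    moreover have "mirror k S = rank_sum ?N (mirror k \<circ> m)"
      using linear_mirror[of k] by (simp add: m(2) rank_sum_def linear_sum linear_scale)
    ultimately have "mirror k S \<in> rank_sum ?N ` B" using B by metis
    then show ?thesis using that(2) by (simp add: X_def)
  qed
  moreover have "X \<noteq> {}" using B[OF n] by (auto simp: X_def)
  ultimately obtain S where S: "S \<in> X" "\<And>k. k \<in> R \<Longrightarrow> k \<bullet> S \<ge> 0"
    using chamber_point_exists[OF \<open>finite X\<close>, of R \<rho>] \<rho> by metis
  then obtain m where m: "bij_betw m {1..?N} W" "S = rank_sum ?N m" by (auto simp: X_def B_def)
  obtain L where L: "set L = W" "length L = card W" "sorted (map ((\<bullet>) S) L)"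
    "arith_sum 1 1 L \<bullet> arith_sum 1 1 L \<le> K" using sorting[OF S(2)] by blast
  have "S \<bullet> S = (\<Sum>t=1..?N. real t * (S \<bullet> m t))"
    by (subst (2) m(2)) (simp add: rank_sum_def inner_sum_right)
  also have "\<dots> \<le> (\<Sum>t=1..?N. real t * (S \<bullet> L ! (t - 1)))"
  proof (rule rearrangement[OF m(1)])
    show "bij_betw (\<lambda>t. L ! (t - 1)) {1..?N} W" using bij_betw_list[OF dist[OF L(1,2)]] L by simp
    show "S \<bullet> L ! (s - 1) \<le> S \<bullet> L ! (t - 1)" if "1 \<le> s" "s \<le> t" "t \<le> ?N" for s t
      using sorted_nth_mono[OF L(3), of "s - 1" "t - 1"] that L(2) by simp
  qed
  also have "\<dots> = S \<bullet> arith_sum 1 1 L"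
    unfolding rank_sum_list[symmetric] rank_sum_def L(2) by (simp add: inner_sum_right)
  also have "\<dots> \<le> norm S * norm (arith_sum 1 1 L)" by (rule norm_cauchy_schwarz)
  finally have "norm S * norm S \<le> norm S * norm (arith_sum 1 1 L)"
    by (simp add: dot_square_norm power2_eq_square)
  then have "norm S \<le> norm (arith_sum 1 1 L)" by (cases "S = 0") auto
  then have "S \<bullet> S \<le> K" using L(4) by (simp add: norm_le)
  moreover have "norm S = norm (rank_sum ?N n)" using S(1) by (simp add: X_def)
  ultimately show "rank_sum ?N n \<bullet> rank_sum ?N n \<le> K" by (simp add: dot_square_norm)
qed

section \<open>The five regular solids\<close>

definition tetrahedron :: "(real^3) set" where
  "tetrahedron = {vec3 1 1 1, vec3 1 (- 1) (- 1), vec3 (- 1) 1 (- 1), vec3 (- 1) (- 1) 1}"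

definition octahedron :: "(real^3) set" where
  "octahedron = {vec3 1 0 0, vec3 (- 1) 0 0, vec3 0 0 1, vec3 0 0 (- 1), vec3 0 1 0, vec3 0 (- 1) 0}"

definition cube :: "(real^3) set" where
  "cube = {vec3 1 1 1, vec3 1 1 (- 1), vec3 1 (- 1) 1, vec3 1 (- 1) (- 1), vec3 (- 1) 1 1,
    vec3 (- 1) 1 (- 1), vec3 (- 1) (- 1) 1, vec3 (- 1) (- 1) (- 1)}"

definition icosahedron :: "(real^3) set" where
  "icosahedron = {vec3 0 golden 1, vec3 0 golden (- 1), vec3 0 (- golden) 1, vec3 0 (- golden) (- 1),
    vec3 golden 1 0, vec3 golden (- 1) 0, vec3 (- golden) 1 0, vec3 (- golden) (- 1) 0,
    vec3 1 0 golden, vec3 1 0 (- golden), vec3 (- 1) 0 golden, vec3 (- 1) 0 (- golden)}"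

definition dodecahedron :: "(real^3) set" where
  "dodecahedron = {vec3 1 1 1, vec3 1 1 (- 1), vec3 1 (- 1) 1, vec3 1 (- 1) (- 1), vec3 (- 1) 1 1,
    vec3 (- 1) 1 (- 1), vec3 (- 1) (- 1) 1, vec3 (- 1) (- 1) (- 1), vec3 golden' golden 0,
    vec3 golden' (- golden) 0, vec3 (- golden') golden 0, vec3 (- golden') (- golden) 0,
    vec3 golden 0 golden', vec3 golden 0 (- golden'), vec3 (- golden) 0 golden',
    vec3 (- golden) 0 (- golden'), vec3 0 golden' golden, vec3 0 golden' (- golden),
    vec3 0 (- golden') golden, vec3 0 (- golden') (- golden)}"

lemma card_tetrahedron: "card tetrahedron = 4"
  by (simp add: tetrahedron_def vec3_eq_iff)

lemma card_octahedron: "card octahedron = 6"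
  by (simp add: octahedron_def vec3_eq_iff)

lemma card_cube: "card cube = 8"
  by (simp add: cube_def vec3_eq_iff)

lemma card_icosahedron: "card icosahedron = 12"
  by (simp add: icosahedron_def vec3_eq_iff)

lemma card_dodecahedron: "card dodecahedron = 20"
  by (simp add: dodecahedron_def vec3_eq_iff)

text \<open>Together with the first and third coordinate vectors, this is a system of simple roots of the
  icosahedral reflection group.\<close>

abbreviation oblique :: "real^3" where "oblique \<equiv> vec3 (- golden) golden' (- 1)"

lemma mirror_oblique: "mirror oblique u = u - (oblique \<bullet> u / 2) *\<^sub>R oblique"
proof -
  have "oblique \<bullet> oblique = 4" by (simp add: golden'_def algebra_simps golden_mult)
  then show ?thesis unfolding mirror_def by simp
qed

lemma mirror_oblique_icosahedron [simp]:
  "mirror oblique (vec3 0 golden 1) = vec3 0 golden 1"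
  "mirror oblique (vec3 0 golden (- 1)) = vec3 golden 1 0"
  "mirror oblique (vec3 0 (- golden) 1) = vec3 (- golden) (- 1) 0"
  "mirror oblique (vec3 0 (- golden) (- 1)) = vec3 0 (- golden) (- 1)"
  "mirror oblique (vec3 golden 1 0) = vec3 0 golden (- 1)"
  "mirror oblique (vec3 golden (- 1) 0) = vec3 (- 1) 0 (- golden)"
  "mirror oblique (vec3 (- golden) 1 0) = vec3 1 0 golden"
  "mirror oblique (vec3 (- golden) (- 1) 0) = vec3 0 (- golden) 1"
  "mirror oblique (vec3 1 0 golden) = vec3 (- golden) 1 0"
  "mirror oblique (vec3 1 0 (- golden)) = vec3 1 0 (- golden)"
  "mirror oblique (vec3 (- 1) 0 golden) = vec3 (- 1) 0 golden"
  "mirror oblique (vec3 (- 1) 0 (- golden)) = vec3 golden (- 1) 0"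
  unfolding mirror_oblique inner_vec3 vec3_arith vec3_eq_iff
  by (simp_all add: golden'_def field_simps golden_mult)

lemma mirror_oblique_dodecahedron [simp]:
  "mirror oblique (vec3 1 1 1) = vec3 (- golden') golden 0"
  "mirror oblique (vec3 1 1 (- 1)) = vec3 1 1 (- 1)"
  "mirror oblique (vec3 1 (- 1) 1) = vec3 (- golden) 0 (- golden')"
  "mirror oblique (vec3 1 (- 1) (- 1)) = vec3 0 (- golden') (- golden)"
  "mirror oblique (vec3 (- 1) 1 1) = vec3 0 golden' golden"
  "mirror oblique (vec3 (- 1) 1 (- 1)) = vec3 golden 0 golden'"
  "mirror oblique (vec3 (- 1) (- 1) 1) = vec3 (- 1) (- 1) 1"
  "mirror oblique (vec3 (- 1) (- 1) (- 1)) = vec3 golden' (- golden) 0"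
  "mirror oblique (vec3 golden' golden 0) = vec3 golden' golden 0"
  "mirror oblique (vec3 golden' (- golden) 0) = vec3 (- 1) (- 1) (- 1)"
  "mirror oblique (vec3 (- golden') golden 0) = vec3 1 1 1"
  "mirror oblique (vec3 (- golden') (- golden) 0) = vec3 (- golden') (- golden) 0"
  "mirror oblique (vec3 golden 0 golden') = vec3 (- 1) 1 (- 1)"
  "mirror oblique (vec3 golden 0 (- golden')) = vec3 0 golden' (- golden)"
  "mirror oblique (vec3 (- golden) 0 golden') = vec3 0 (- golden') golden"
  "mirror oblique (vec3 (- golden) 0 (- golden')) = vec3 1 (- 1) 1"
  "mirror oblique (vec3 0 golden' golden) = vec3 (- 1) 1 1"
  "mirror oblique (vec3 0 golden' (- golden)) = vec3 golden 0 (- golden')"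
  "mirror oblique (vec3 0 (- golden') golden) = vec3 (- golden) 0 golden'"
  "mirror oblique (vec3 0 (- golden') (- golden)) = vec3 1 (- 1) (- 1)"
  unfolding mirror_oblique inner_vec3 vec3_arith vec3_eq_iff
  by (simp_all add: golden'_def field_simps golden_mult)

section \<open>The solids as orbits\<close>

lemma mirror_tetrahedron:
  "m \<in> {vec3 0 1 1, vec3 1 (- 1) 0, vec3 0 1 (- 1)} \<Longrightarrow> u \<in> tetrahedron \<Longrightarrow> mirror m u \<in> tetrahedron"
  unfolding tetrahedron_def by (elim insertE emptyE; hypsubst; simp)

text \<open>Each vertex is one mirror away from a vertex reached before; the other four solids are
  treated in the same way.\<close>

lemma tetrahedron_generated:
  assumes "vec3 1 1 1 \<in> X" "\<And>m u. m \<in> {vec3 0 1 1, vec3 1 (- 1) 0, vec3 0 1 (- 1)} \<Longrightarrow> u \<in> X \<Longrightarrow> mirror m u \<in> X"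
  shows "tetrahedron \<subseteq> X"
proof -
  have r: "u \<in> X \<Longrightarrow> mirror (vec3 0 1 1) u \<in> X" "u \<in> X \<Longrightarrow> mirror (vec3 1 (- 1) 0) u \<in> X" "u \<in> X \<Longrightarrow> mirror (vec3 0 1 (- 1)) u \<in> X" for u
    using assms(2) by auto
  note x0 = assms(1)
  have x1: "vec3 1 (- 1) (- 1) \<in> X" using r(1)[OF x0] by simp
  have x2: "vec3 (- 1) 1 (- 1) \<in> X" using r(2)[OF x1] by simp
  have x3: "vec3 (- 1) (- 1) 1 \<in> X" using r(3)[OF x2] by simp
  show ?thesis unfolding tetrahedron_def
    using x0 x1 x2 x3 by (simp only: insert_subset empty_subsetI simp_thms)
qed

lemma mirror_octahedron:
  "m \<in> {vec3 1 (- 1) 0, vec3 0 1 (- 1), vec3 0 0 1} \<Longrightarrow> u \<in> octahedron \<Longrightarrow> mirror m u \<in> octahedron"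
  unfolding octahedron_def by (elim insertE emptyE; hypsubst; simp)

lemma octahedron_generated:
  assumes "vec3 1 0 0 \<in> X" "\<And>m u. m \<in> {vec3 1 (- 1) 0, vec3 0 1 (- 1), vec3 0 0 1} \<Longrightarrow> u \<in> X \<Longrightarrow> mirror m u \<in> X"
  shows "octahedron \<subseteq> X"
proof -
  have r: "u \<in> X \<Longrightarrow> mirror (vec3 1 (- 1) 0) u \<in> X" "u \<in> X \<Longrightarrow> mirror (vec3 0 1 (- 1)) u \<in> X" "u \<in> X \<Longrightarrow> mirror (vec3 0 0 1) u \<in> X" for u
    using assms(2) by auto
  note x0 = assms(1)
  have x1: "vec3 0 1 0 \<in> X" using r(1)[OF x0] by simp
  have x2: "vec3 0 0 1 \<in> X" using r(2)[OF x1] by simp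
  have x3: "vec3 0 0 (- 1) \<in> X" using r(3)[OF x2] by simp
  have x4: "vec3 0 (- 1) 0 \<in> X" using r(2)[OF x3] by simp
  have x5: "vec3 (- 1) 0 0 \<in> X" using r(1)[OF x4] by simp
  show ?thesis unfolding octahedron_def
    using x0 x1 x2 x3 x4 x5 by (simp only: insert_subset empty_subsetI simp_thms)
qed

lemma mirror_cube:
  "m \<in> {vec3 0 0 1, vec3 0 1 (- 1), vec3 1 (- 1) 0} \<Longrightarrow> u \<in> cube \<Longrightarrow> mirror m u \<in> cube"
  unfolding cube_def by (elim insertE emptyE; hypsubst; simp)

lemma cube_generated:
  assumes "vec3 1 1 1 \<in> X" "\<And>m u. m \<in> {vec3 0 0 1, vec3 0 1 (- 1), vec3 1 (- 1) 0} \<Longrightarrow> u \<in> X \<Longrightarrow> mirror m u \<in> X"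
  shows "cube \<subseteq> X"
proof -
  have r: "u \<in> X \<Longrightarrow> mirror (vec3 0 0 1) u \<in> X" "u \<in> X \<Longrightarrow> mirror (vec3 0 1 (- 1)) u \<in> X" "u \<in> X \<Longrightarrow> mirror (vec3 1 (- 1) 0) u \<in> X" for u
    using assms(2) by auto
  note x0 = assms(1)
  have x1: "vec3 1 1 (- 1) \<in> X" using r(1)[OF x0] by simp
  have x2: "vec3 1 (- 1) 1 \<in> X" using r(2)[OF x1] by simp
  have x3: "vec3 1 (- 1) (- 1) \<in> X" using r(1)[OF x2] by simp
  have x4: "vec3 (- 1) 1 1 \<in> X" using r(3)[OF x2] by simp
  have x5: "vec3 (- 1) 1 (- 1) \<in> X" using r(3)[OF x3] by simp
  have x6: "vec3 (- 1) (- 1) 1 \<in> X" using r(2)[OF x5] by simp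
  have x7: "vec3 (- 1) (- 1) (- 1) \<in> X" using r(1)[OF x6] by simp
  show ?thesis unfolding cube_def
    using x0 x1 x2 x3 x4 x5 x6 x7 by (simp only: insert_subset empty_subsetI simp_thms)
qed

lemma mirror_icosahedron:
  "m \<in> {vec3 0 0 1, oblique, vec3 1 0 0} \<Longrightarrow> u \<in> icosahedron \<Longrightarrow> mirror m u \<in> icosahedron"
  unfolding icosahedron_def by (elim insertE emptyE; hypsubst; simp)

lemma icosahedron_generated:
  assumes "vec3 0 golden 1 \<in> X" "\<And>m u. m \<in> {vec3 0 0 1, oblique, vec3 1 0 0} \<Longrightarrow> u \<in> X \<Longrightarrow> mirror m u \<in> X"
  shows "icosahedron \<subseteq> X"
proof -
  have r: "u \<in> X \<Longrightarrow> mirror (vec3 0 0 1) u \<in> X" "u \<in> X \<Longrightarrow> mirror (oblique) u \<in> X" "u \<in> X \<Longrightarrow> mirror (vec3 1 0 0) u \<in> X" for u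
    using assms(2) by auto
  note x0 = assms(1)
  have x1: "vec3 0 golden (- 1) \<in> X" using r(1)[OF x0] by simp
  have x2: "vec3 golden 1 0 \<in> X" using r(2)[OF x1] by simp
  have x3: "vec3 (- golden) 1 0 \<in> X" using r(3)[OF x2] by simp
  have x4: "vec3 1 0 golden \<in> X" using r(2)[OF x3] by simp
  have x5: "vec3 1 0 (- golden) \<in> X" using r(1)[OF x4] by simp
  have x6: "vec3 (- 1) 0 golden \<in> X" using r(3)[OF x4] by simp
  have x7: "vec3 (- 1) 0 (- golden) \<in> X" using r(3)[OF x5] by simp
  have x8: "vec3 golden (- 1) 0 \<in> X" using r(2)[OF x7] by simp
  have x9: "vec3 (- golden) (- 1) 0 \<in> X" using r(3)[OF x8] by simp
  have x10: "vec3 0 (- golden) 1 \<in> X" using r(2)[OF x9] by simp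
  have x11: "vec3 0 (- golden) (- 1) \<in> X" using r(1)[OF x10] by simp
  show ?thesis unfolding icosahedron_def
    using x0 x1 x2 x3 x4 x5 x6 x7 x8 x9 x10 x11 by (simp only: insert_subset empty_subsetI simp_thms)
qed

lemma mirror_dodecahedron:
  "m \<in> {vec3 1 0 0, oblique, vec3 0 0 1} \<Longrightarrow> u \<in> dodecahedron \<Longrightarrow> mirror m u \<in> dodecahedron"
  unfolding dodecahedron_def by (elim insertE emptyE; hypsubst; simp)

lemma dodecahedron_generated:
  assumes "vec3 golden' golden 0 \<in> X" "\<And>m u. m \<in> {vec3 1 0 0, oblique, vec3 0 0 1} \<Longrightarrow> u \<in> X \<Longrightarrow> mirror m u \<in> X"
  shows "dodecahedron \<subseteq> X"
proof -
  have r: "u \<in> X \<Longrightarrow> mirror (vec3 1 0 0) u \<in> X" "u \<in> X \<Longrightarrow> mirror (oblique) u \<in> X" "u \<in> X \<Longrightarrow> mirror (vec3 0 0 1) u \<in> X" for u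
    using assms(2) by auto
  note x0 = assms(1)
  have x1: "vec3 (- golden') golden 0 \<in> X" using r(1)[OF x0] by simp
  have x2: "vec3 1 1 1 \<in> X" using r(2)[OF x1] by simp
  have x3: "vec3 (- 1) 1 1 \<in> X" using r(1)[OF x2] by simp
  have x4: "vec3 1 1 (- 1) \<in> X" using r(3)[OF x2] by simp
  have x5: "vec3 0 golden' golden \<in> X" using r(2)[OF x3] by simp
  have x6: "vec3 (- 1) 1 (- 1) \<in> X" using r(3)[OF x3] by simp
  have x7: "vec3 0 golden' (- golden) \<in> X" using r(3)[OF x5] by simp
  have x8: "vec3 golden 0 golden' \<in> X" using r(2)[OF x6] by simp
  have x9: "vec3 golden 0 (- golden') \<in> X" using r(2)[OF x7] by simp
  have x10: "vec3 (- golden) 0 golden' \<in> X" using r(1)[OF x8] by simp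
  have x11: "vec3 (- golden) 0 (- golden') \<in> X" using r(1)[OF x9] by simp
  have x12: "vec3 0 (- golden') golden \<in> X" using r(2)[OF x10] by simp
  have x13: "vec3 1 (- 1) 1 \<in> X" using r(2)[OF x11] by simp
  have x14: "vec3 0 (- golden') (- golden) \<in> X" using r(3)[OF x12] by simp
  have x15: "vec3 (- 1) (- 1) 1 \<in> X" using r(1)[OF x13] by simp
  have x16: "vec3 1 (- 1) (- 1) \<in> X" using r(3)[OF x13] by simp
  have x17: "vec3 (- 1) (- 1) (- 1) \<in> X" using r(3)[OF x15] by simp
  have x18: "vec3 golden' (- golden) 0 \<in> X" using r(2)[OF x17] by simp
  have x19: "vec3 (- golden') (- golden) 0 \<in> X" using r(1)[OF x18] by simp
  show ?thesis unfolding dodecahedron_def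
    using x0 x1 x2 x3 x4 x5 x6 x7 x8 x9 x10 x11 x12 x13 x14 x15 x16 x17 x18 x19 by (simp only: insert_subset empty_subsetI simp_thms)
qed

section \<open>Cells of constant vertex order\<close>

lemma symmetrize_cell:
  fixes H :: "'a::real_inner list"
  assumes "sorted (0 # map ((\<bullet>) w) H)" "set (symmetrize H) = W" "card W = 2 * length H"
    and "arith_sum 2 1 H = S" "S \<bullet> S \<le> K"
  shows "\<exists>L. set L = W \<and> length L = card W \<and> sorted (map ((\<bullet>) w) L) \<and> arith_sum 1 1 L \<bullet> arith_sum 1 1 L \<le> K"
  using assms sorted_symmetrize[OF assms(1)]
  by (intro exI[of _ "symmetrize H"]) (simp only: arith_sum_symmetrize, simp)

text \<open>A point \<open>(a, y, c)\<close> of the chamber of the icosahedral group. The capital letters stand for the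
  golden multiples of the small ones; with them as separate atoms, all comparisons of inner products
  with vertices are linear with rational coefficients.\<close>

locale h3_chamber =
  fixes a y c :: real
  assumes chamber: "0 \<le> a" "0 \<le> c" "0 \<le> oblique \<bullet> vec3 a y c"
begin

definition A where "A = a * golden"
definition C where "C = c * golden"
text \<open>\<open>golden\<close> times the inner product with \<open>oblique\<close>; thus
  \<open>a\<close>, \<open>b\<close>, \<open>c\<close> are coordinates in which the chamber is the
  nonnegative octant.\<close>

definition b where "b = y - A - a - C"
definition B where "B = b * golden"
definition Y where "Y = y * golden"

lemmas defs = A_def C_def b_def B_def Y_def

lemma y_eq: "y = b + A + a + C" and Y_eq: "Y = B + 2 * A + a + C + c"
  by (simp_all add: defs algebra_simps golden_mult)

lemma eqs:
  "a * golden = A" "a * golden' = A - a" "c * golden = C" "c * golden' = C - c"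
  "y * golden = Y" "y * golden' = Y - y"
  by (simp_all add: defs golden'_def algebra_simps)

lemma base: "0 \<le> a" "0 \<le> b" "0 \<le> c" "a * (809 / 500) \<le> A" "A \<le> a * (16181 / 10000)"
  "b * (809 / 500) \<le> B" "B \<le> b * (16181 / 10000)" "c * (809 / 500) \<le> C" "C \<le> c * (16181 / 10000)"
proof -
  have "0 \<le> golden * (oblique \<bullet> vec3 a y c)" using chamber golden_bounds by simp
  also have "\<dots> = b" by (simp add: defs golden'_def algebra_simps golden_mult)
  finally have "0 \<le> b" .
  moreover have "t * (809 / 500) \<le> t * golden" "t * golden \<le> t * (16181 / 10000)" if "0 \<le> t" for t
    using that by (rule mult_left_mono[OF less_imp_le[OF golden_bounds(1)]] mult_left_mono[OF less_imp_le[OF golden_bounds(2)]])+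
  ultimately show "0 \<le> a" "0 \<le> b" "0 \<le> c" "a * (809 / 500) \<le> A" "A \<le> a * (16181 / 10000)"
    "b * (809 / 500) \<le> B" "B \<le> b * (16181 / 10000)" "c * (809 / 500) \<le> C" "C \<le> c * (16181 / 10000)"
    using chamber unfolding A_def B_def C_def by blast+
qed

text \<open>Linear arithmetic treats \<open>a\<close> and \<open>A\<close> as unrelated up to the
  bounds in \<open>base\<close>, so each case condition is supplied together with its multiple by
  \<open>golden\<close>.\<close>

lemma times_golden:
  assumes "0 \<le> p * a + q * A + r * b + s * B + t * c + u * C"
  shows "0 \<le> q * a + (p + q) * A + s * b + (r + s) * B + u * c + (t + u) * C"
proof -
  have "0 \<le> golden * (p * a + q * A + r * b + s * B + t * c + u * C)" using assms golden_bounds by simp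
  also have "\<dots> = q * a + (p + q) * A + s * b + (r + s) * B + u * c + (t + u) * C"
    unfolding A_def B_def C_def by (simp add: algebra_simps golden_mult)
  finally show ?thesis .
qed

end

text \<open>\<open>a\<close>, \<open>b\<close>, \<open>c\<close> are the inner products with the
  normals. One order serves the whole chamber.\<close>

lemma octahedron_sorting:
  assumes "0 \<le> a" "0 \<le> b" "0 \<le> c"
  shows "\<exists>L. set L = octahedron \<and> length L = card octahedron \<and>
    sorted (map ((\<bullet>) (vec3 (a + b + c) (b + c) c)) L) \<and> arith_sum 1 1 L \<bullet> arith_sum 1 1 L \<le> 35"
    (is "\<exists>L. _ \<and> _ \<and> sorted (map ((\<bullet>) ?w) L) \<and> _ \<le> ?K")
proof -
  note base = assms
  show ?thesis
  proof (rule symmetrize_cell)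
    let ?H = "[vec3 0 0 1, vec3 0 1 0, vec3 1 0 0]"
    let ?S = "vec3 5 3 1"
    show "sorted (0 # map ((\<bullet>) ?w) ?H)" using base by simp
    show "set (symmetrize ?H) = octahedron" unfolding octahedron_def by (simp, blast)
    show "card octahedron = 2 * length ?H" by (simp add: card_octahedron)
    show "arith_sum 2 1 ?H = ?S" "?S \<bullet> ?S \<le> ?K" by (simp_all add: vec3_zero)
  qed
qed

text \<open>An interior point of the chamber, which provides the functional for
  \<open>chamber_point_exists\<close>.\<close>

lemma octahedron_positive: "m \<in> {vec3 1 (- 1) 0, vec3 0 1 (- 1), vec3 0 0 1} \<Longrightarrow> m \<bullet> vec3 3 2 1 > 0"
  using golden_bounds by (auto simp: golden'_def)

lemma max_rank_sum_octahedron: "max_rank_sum octahedron 35"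
proof (rule max_rank_sumI[OF _ mirror_octahedron octahedron_positive])
  show "finite octahedron" by (simp add: octahedron_def)
  fix w assume pos: "\<And>m. m \<in> {vec3 1 (- 1) 0, vec3 0 1 (- 1), vec3 0 0 1} \<Longrightarrow> m \<bullet> w \<ge> 0"
  obtain a y c where w: "w = vec3 a y c" by (rule vec3_cases)
  show "\<exists>L. set L = octahedron \<and> length L = card octahedron \<and>
    sorted (map ((\<bullet>) w) L) \<and> arith_sum 1 1 L \<bullet> arith_sum 1 1 L \<le> 35"
    using octahedron_sorting[of "a - y" "y - c" c] pos[of "vec3 1 (- 1) 0"] pos[of "vec3 0 1 (- 1)"] pos[of "vec3 0 0 1"] by (simp add: w)
next
  let ?L = "symmetrize [vec3 0 0 1, vec3 0 1 0, vec3 1 0 0]"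
  show "set ?L = octahedron" unfolding octahedron_def by (simp, blast)
  show "length ?L = card octahedron" by (simp add: card_octahedron)
  have "arith_sum 1 1 ?L = vec3 5 3 1"
    by (simp only: arith_sum_symmetrize) (simp add: vec3_zero vec3_eq_iff golden'_def)
  then show "arith_sum 1 1 ?L \<bullet> arith_sum 1 1 ?L = 35" by (simp add: algebra_simps golden_mult)
qed

text \<open>Up to antipodes only \<open>vec3 1 (- 1) (- 1)\<close>, with inner product
  \<open>a - c\<close>, changes sign in the chamber. The two cells give 336 and 332.\<close>

lemma cube_sorting:
  assumes "0 \<le> a" "0 \<le> b" "0 \<le> c"
  shows "\<exists>L. set L = cube \<and> length L = card cube \<and>
    sorted (map ((\<bullet>) (vec3 (a + b + c) (b + c) c)) L) \<and> arith_sum 1 1 L \<bullet> arith_sum 1 1 L \<le> 336"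
    (is "\<exists>L. _ \<and> _ \<and> sorted (map ((\<bullet>) ?w) L) \<and> _ \<le> ?K")
proof -
  note base = assms
  show ?thesis
  proof (cases "0 \<le> 1 * a + 0 * b + (- 1) * c")
    case True
    note f0 = this
    show ?thesis
    proof (rule symmetrize_cell)
      let ?H = "[vec3 1 (- 1) (- 1), vec3 1 (- 1) 1, vec3 1 1 (- 1), vec3 1 1 1]"
      let ?S = "vec3 16 8 4"
      show "sorted (0 # map ((\<bullet>) ?w) ?H)" using base f0 by simp
      show "set (symmetrize ?H) = cube" unfolding cube_def by (simp, blast)
      show "card cube = 2 * length ?H" by (simp add: card_cube)
      show "arith_sum 2 1 ?H = ?S" "?S \<bullet> ?S \<le> ?K" by (simp_all add: vec3_zero)
    qed
  next
    case False
    note f0 = this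
    show ?thesis
    proof (rule symmetrize_cell)
      let ?H = "[vec3 (- 1) 1 1, vec3 1 (- 1) 1, vec3 1 1 (- 1), vec3 1 1 1]"
      let ?S = "vec3 14 10 6"
      show "sorted (0 # map ((\<bullet>) ?w) ?H)" using base f0 by simp
      show "set (symmetrize ?H) = cube" unfolding cube_def by (simp, blast)
      show "card cube = 2 * length ?H" by (simp add: card_cube)
      show "arith_sum 2 1 ?H = ?S" "?S \<bullet> ?S \<le> ?K" by (simp_all add: vec3_zero)
    qed
  qed
qed

lemma cube_positive: "m \<in> {vec3 0 0 1, vec3 0 1 (- 1), vec3 1 (- 1) 0} \<Longrightarrow> m \<bullet> vec3 3 2 1 > 0"
  using golden_bounds by (auto simp: golden'_def)

lemma max_rank_sum_cube: "max_rank_sum cube 336"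
proof (rule max_rank_sumI[OF _ mirror_cube cube_positive])
  show "finite cube" by (simp add: cube_def)
  fix w assume pos: "\<And>m. m \<in> {vec3 0 0 1, vec3 0 1 (- 1), vec3 1 (- 1) 0} \<Longrightarrow> m \<bullet> w \<ge> 0"
  obtain a y c where w: "w = vec3 a y c" by (rule vec3_cases)
  show "\<exists>L. set L = cube \<and> length L = card cube \<and>
    sorted (map ((\<bullet>) w) L) \<and> arith_sum 1 1 L \<bullet> arith_sum 1 1 L \<le> 336"
    using cube_sorting[of "a - y" "y - c" c] pos[of "vec3 0 0 1"] pos[of "vec3 0 1 (- 1)"] pos[of "vec3 1 (- 1) 0"] by (simp add: w)
next
  let ?L = "symmetrize [vec3 1 (- 1) (- 1), vec3 1 (- 1) 1, vec3 1 1 (- 1), vec3 1 1 1]"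
  show "set ?L = cube" unfolding cube_def by (simp, blast)
  show "length ?L = card cube" by (simp add: card_cube)
  have "arith_sum 1 1 ?L = vec3 16 8 4"
    by (simp only: arith_sum_symmetrize) (simp add: vec3_zero vec3_eq_iff golden'_def)
  then show "arith_sum 1 1 ?L \<bullet> arith_sum 1 1 ?L = 336" by (simp add: algebra_simps golden_mult)
qed

context h3_chamber
begin

lemma icosahedron_sorting:
  shows "\<exists>L. set L = icosahedron \<and> length L = card icosahedron \<and>
    sorted (map ((\<bullet>) (vec3 a y c)) L) \<and> arith_sum 1 1 L \<bullet> arith_sum 1 1 L \<le> 572 + 924 * golden"
    (is "\<exists>L. _ \<and> _ \<and> sorted (map ((\<bullet>) ?w) L) \<and> _ \<le> ?K")
proof -
  show ?thesis
  \<comment> \<open>The sign of the vertex \<open>vec3 1 0 (- golden)\<close>. Zero coefficients are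
    written out to fit the premise of \<open>times_golden\<close>.\<close>
  proof (cases "0 \<le> 1 * a + 0 * A + 0 * b + 0 * B + 0 * c + (- 1) * C")
    case True
    note f0 = True and f0g = times_golden[OF True]
    show ?thesis
    proof (rule symmetrize_cell)
      let ?H = "[vec3 1 0 (- golden), vec3 1 0 golden, vec3 (- golden) 1 0, vec3 golden 1 0,
                vec3 0 golden (- 1), vec3 0 golden 1]"
      let ?S = "vec3 (4 + 2 * golden) (12 + 20 * golden) (2 + 2 * golden)"
      show "sorted (0 # map ((\<bullet>) ?w) ?H)"
        by (simp add: eqs) (insert base y_eq Y_eq f0 f0g, intro conjI; linarith)
      show "set (symmetrize ?H) = icosahedron" unfolding icosahedron_def by (simp, blast)
      show "card icosahedron = 2 * length ?H" by (simp add: card_icosahedron)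
      show "arith_sum 2 1 ?H = ?S" by (simp add: vec3_zero vec3_eq_iff golden'_def)
      show "?S \<bullet> ?S \<le> ?K" using golden_bounds by (simp add: algebra_simps golden_mult)
    qed
  next
    case False
    then have f0: "0 \<le> (- 1) * a + 0 * A + 0 * b + 0 * B + 0 * c + 1 * C" by simp
    note f0g = times_golden[OF this]
    show ?thesis
    proof (rule symmetrize_cell)
      let ?H = "[vec3 (- 1) 0 golden, vec3 1 0 golden, vec3 (- golden) 1 0, vec3 golden 1 0,
                vec3 0 golden (- 1), vec3 0 golden 1]"
      \<comment> \<open>This cell attains the bound; the other one gives
        \<open>572 + 912 * golden\<close>.\<close>
      let ?S = "vec3 (2 + 2 * golden) (12 + 20 * golden) (2 + 4 * golden)"
      show "sorted (0 # map ((\<bullet>) ?w) ?H)"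
        by (simp add: eqs) (insert base y_eq Y_eq f0 f0g, intro conjI; linarith)
      show "set (symmetrize ?H) = icosahedron" unfolding icosahedron_def by (simp, blast)
      show "card icosahedron = 2 * length ?H" by (simp add: card_icosahedron)
      show "arith_sum 2 1 ?H = ?S" by (simp add: vec3_zero vec3_eq_iff golden'_def)
      show "?S \<bullet> ?S \<le> ?K" using golden_bounds by (simp add: algebra_simps golden_mult)
    qed
  qed
qed

text \<open>Up to a positive factor, every case condition is the sign of a vertex or the comparison
  of two vertices; the three highest vertices are the same in all cells.\<close>

lemma dodecahedron_sorting:
  shows "\<exists>L. set L = dodecahedron \<and> length L = card dodecahedron \<and>
    sorted (map ((\<bullet>) (vec3 a y c)) L) \<and> arith_sum 1 1 L \<bullet> arith_sum 1 1 L \<le> 3676 + 5932 * golden"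
    (is "\<exists>L. _ \<and> _ \<and> sorted (map ((\<bullet>) ?w) L) \<and> _ \<le> ?K")
proof -
  show ?thesis
  \<comment> \<open>Sign of \<open>vec3 golden 0 (- golden')\<close>.\<close>
  proof (cases "0 \<le> 0 * a + 1 * A + 0 * b + 0 * B + 1 * c + (- 1) * C")
    case True
    note f0 = True and f0g = times_golden[OF True]
    show ?thesis
    \<comment> \<open>Order of \<open>vec3 (- 1) 1 1\<close> and
      \<open>vec3 1 1 (- 1)\<close>.\<close>
    proof (cases "0 \<le> 1 * a + 0 * A + 0 * b + 0 * B + (- 1) * c + 0 * C")
      case True
      note f1 = True and f1g = times_golden[OF True]
      show ?thesis
      \<comment> \<open>Order of \<open>vec3 0 golden' golden\<close> and
        \<open>vec3 (- 1) 1 (- 1)\<close>.\<close>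
      proof (cases "0 \<le> 0 * a + 0 * A + 2 * b + (- 1) * B + (- 2) * c + 0 * C")
        case True
        note f2 = True and f2g = times_golden[OF True]
        show ?thesis
        proof (rule symmetrize_cell)
          let ?H = "[vec3 golden 0 (- golden'), vec3 golden 0 golden', vec3 0 golden' (- golden),
                    vec3 0 golden' golden, vec3 (- 1) 1 (- 1), vec3 (- 1) 1 1, vec3 1 1 (- 1), vec3 1 1 1,
                    vec3 (- golden') golden 0, vec3 golden' golden 0]"
          let ?S = "vec3 (6 + 6 * golden) (36 + 48 * golden) (2 + 4 * golden)"
          show "sorted (0 # map ((\<bullet>) ?w) ?H)"
            by (simp add: eqs) (insert base y_eq Y_eq f0 f0g f1 f1g f2 f2g, intro conjI; linarith)
          show "set (symmetrize ?H) = dodecahedron" unfolding dodecahedron_def by (simp, blast)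
          show "card dodecahedron = 2 * length ?H" by (simp add: card_dodecahedron)
          show "arith_sum 2 1 ?H = ?S" by (simp add: vec3_zero vec3_eq_iff golden'_def)
          show "?S \<bullet> ?S \<le> ?K" using golden_bounds by (simp add: algebra_simps golden_mult)
        qed
      next
        case False
        then have f2: "0 \<le> 0 * a + 0 * A + (- 2) * b + 1 * B + 2 * c + 0 * C" by simp
        note f2g = times_golden[OF this]
        show ?thesis
        \<comment> \<open>Order of \<open>vec3 0 golden' (- golden)\<close> and
          \<open>vec3 golden 0 golden'\<close>.\<close>
        proof (cases "0 \<le> 0 * a + 0 * A + (- 1) * b + 1 * B + 2 * c + (- 2) * C")
          case True
          note f3 = True and f3g = times_golden[OF True]
          show ?thesis
          proof (rule symmetrize_cell)
            let ?H = "[vec3 golden 0 (- golden'), vec3 golden 0 golden', vec3 0 golden' (- golden),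
                      vec3 (- 1) 1 (- 1), vec3 0 golden' golden, vec3 (- 1) 1 1, vec3 1 1 (- 1), vec3 1 1 1,
                      vec3 (- golden') golden 0, vec3 golden' golden 0]"
            let ?S = "vec3 (8 + 6 * golden) (32 + 50 * golden) (4 + 6 * golden)"
            show "sorted (0 # map ((\<bullet>) ?w) ?H)"
              by (simp add: eqs) (insert base y_eq Y_eq f0 f0g f1 f1g f2 f2g f3 f3g, intro conjI; linarith)
            show "set (symmetrize ?H) = dodecahedron" unfolding dodecahedron_def by (simp, blast)
            show "card dodecahedron = 2 * length ?H" by (simp add: card_dodecahedron)
            show "arith_sum 2 1 ?H = ?S" by (simp add: vec3_zero vec3_eq_iff golden'_def)
            show "?S \<bullet> ?S \<le> ?K" using golden_bounds by (simp add: algebra_simps golden_mult)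
          qed
        next
          case False
          then have f3: "0 \<le> 0 * a + 0 * A + 1 * b + (- 1) * B + (- 2) * c + 2 * C" by simp
          note f3g = times_golden[OF this]
          show ?thesis
          proof (rule symmetrize_cell)
            let ?H = "[vec3 golden 0 (- golden'), vec3 0 golden' (- golden), vec3 golden 0 golden',
                      vec3 (- 1) 1 (- 1), vec3 0 golden' golden, vec3 (- 1) 1 1, vec3 1 1 (- 1), vec3 1 1 1,
                      vec3 (- golden') golden 0, vec3 golden' golden 0]"
            let ?S = "vec3 (8 + 8 * golden) (34 + 48 * golden) (2 + 10 * golden)"
            show "sorted (0 # map ((\<bullet>) ?w) ?H)"
              by (simp add: eqs) (insert base y_eq Y_eq f0 f0g f1 f1g f2 f2g f3 f3g, intro conjI; linarith)
            show "set (symmetrize ?H) = dodecahedron" unfolding dodecahedron_def by (simp, blast)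
            show "card dodecahedron = 2 * length ?H" by (simp add: card_dodecahedron)
            show "arith_sum 2 1 ?H = ?S" by (simp add: vec3_zero vec3_eq_iff golden'_def)
            show "?S \<bullet> ?S \<le> ?K" using golden_bounds by (simp add: algebra_simps golden_mult)
          qed
        qed
      qed
    next
      case False
      then have f1: "0 \<le> (- 1) * a + 0 * A + 0 * b + 0 * B + 1 * c + 0 * C" by simp
      note f1g = times_golden[OF this]
      show ?thesis
      \<comment> \<open>Order of \<open>vec3 0 golden' golden\<close> and
        \<open>vec3 1 1 (- 1)\<close>.\<close>
      proof (cases "0 \<le> 2 * a + 0 * A + 2 * b + (- 1) * B + (- 2) * c + 0 * C")
        case True
        note f2 = True and f2g = times_golden[OF True]
        show ?thesis
        proof (cases "0 \<le> 0 * a + 0 * A + 2 * b + (- 1) * B + (- 2) * c + 0 * C")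
          case True
          note f3 = True and f3g = times_golden[OF True]
          show ?thesis
          proof (rule symmetrize_cell)
            let ?H = "[vec3 golden 0 (- golden'), vec3 golden 0 golden', vec3 0 golden' (- golden),
                      vec3 0 golden' golden, vec3 (- 1) 1 (- 1), vec3 1 1 (- 1), vec3 (- 1) 1 1, vec3 1 1 1,
                      vec3 (- golden') golden 0, vec3 golden' golden 0]"
            let ?S = "vec3 (2 + 6 * golden) (36 + 48 * golden) (6 + 4 * golden)"
            show "sorted (0 # map ((\<bullet>) ?w) ?H)"
              by (simp add: eqs) (insert base y_eq Y_eq f0 f0g f1 f1g f2 f2g f3 f3g, intro conjI; linarith)
            show "set (symmetrize ?H) = dodecahedron" unfolding dodecahedron_def by (simp, blast)
            show "card dodecahedron = 2 * length ?H" by (simp add: card_dodecahedron)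
            show "arith_sum 2 1 ?H = ?S" by (simp add: vec3_zero vec3_eq_iff golden'_def)
            show "?S \<bullet> ?S \<le> ?K" using golden_bounds by (simp add: algebra_simps golden_mult)
          qed
        next
          case False
          then have f3: "0 \<le> 0 * a + 0 * A + (- 2) * b + 1 * B + 2 * c + 0 * C" by simp
          note f3g = times_golden[OF this]
          show ?thesis
          proof (cases "0 \<le> 0 * a + 0 * A + (- 1) * b + 1 * B + 2 * c + (- 2) * C")
            case True
            note f4 = True and f4g = times_golden[OF True]
            show ?thesis
            proof (rule symmetrize_cell)
              let ?H = "[vec3 golden 0 (- golden'), vec3 golden 0 golden', vec3 0 golden' (- golden),
                        vec3 (- 1) 1 (- 1), vec3 0 golden' golden, vec3 1 1 (- 1), vec3 (- 1) 1 1, vec3 1 1 1,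
                        vec3 (- golden') golden 0, vec3 golden' golden 0]"
              let ?S = "vec3 (4 + 6 * golden) (32 + 50 * golden) (8 + 6 * golden)"
              show "sorted (0 # map ((\<bullet>) ?w) ?H)"
                by (simp add: eqs) (insert base y_eq Y_eq f0 f0g f1 f1g f2 f2g f3 f3g f4 f4g, intro conjI; linarith)
              show "set (symmetrize ?H) = dodecahedron" unfolding dodecahedron_def by (simp, blast)
              show "card dodecahedron = 2 * length ?H" by (simp add: card_dodecahedron)
              show "arith_sum 2 1 ?H = ?S" by (simp add: vec3_zero vec3_eq_iff golden'_def)
              show "?S \<bullet> ?S \<le> ?K" using golden_bounds by (simp add: algebra_simps golden_mult)
            qed
          next
            case False
            then have f4: "0 \<le> 0 * a + 0 * A + 1 * b + (- 1) * B + (- 2) * c + 2 * C" by simp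
            note f4g = times_golden[OF this]
            show ?thesis
            proof (rule symmetrize_cell)
              let ?H = "[vec3 golden 0 (- golden'), vec3 0 golden' (- golden), vec3 golden 0 golden',
                        vec3 (- 1) 1 (- 1), vec3 0 golden' golden, vec3 1 1 (- 1), vec3 (- 1) 1 1, vec3 1 1 1,
                        vec3 (- golden') golden 0, vec3 golden' golden 0]"
              let ?S = "vec3 (4 + 8 * golden) (34 + 48 * golden) (6 + 10 * golden)"
              show "sorted (0 # map ((\<bullet>) ?w) ?H)"
                by (simp add: eqs) (insert base y_eq Y_eq f0 f0g f1 f1g f2 f2g f3 f3g f4 f4g, intro conjI; linarith)
              show "set (symmetrize ?H) = dodecahedron" unfolding dodecahedron_def by (simp, blast)
              show "card dodecahedron = 2 * length ?H" by (simp add: card_dodecahedron)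
              show "arith_sum 2 1 ?H = ?S" by (simp add: vec3_zero vec3_eq_iff golden'_def)
              show "?S \<bullet> ?S \<le> ?K" using golden_bounds by (simp add: algebra_simps golden_mult)
            qed
          qed
        qed
      next
        case False
        then have f2: "0 \<le> (- 2) * a + 0 * A + (- 2) * b + 1 * B + 2 * c + 0 * C" by simp
        note f2g = times_golden[OF this]
        show ?thesis
        proof (cases "0 \<le> 0 * a + 0 * A + (- 1) * b + 1 * B + 2 * c + (- 2) * C")
          case True
          note f3 = True and f3g = times_golden[OF True]
          show ?thesis
          proof (rule symmetrize_cell)
            let ?H = "[vec3 golden 0 (- golden'), vec3 golden 0 golden', vec3 0 golden' (- golden),
                      vec3 (- 1) 1 (- 1), vec3 1 1 (- 1), vec3 0 golden' golden, vec3 (- 1) 1 1, vec3 1 1 1,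
                      vec3 (- golden') golden 0, vec3 golden' golden 0]"
            let ?S = "vec3 (2 + 6 * golden) (28 + 52 * golden) (10 + 8 * golden)"
            show "sorted (0 # map ((\<bullet>) ?w) ?H)"
              by (simp add: eqs) (insert base y_eq Y_eq f0 f0g f1 f1g f2 f2g f3 f3g, intro conjI; linarith)
            show "set (symmetrize ?H) = dodecahedron" unfolding dodecahedron_def by (simp, blast)
            show "card dodecahedron = 2 * length ?H" by (simp add: card_dodecahedron)
            show "arith_sum 2 1 ?H = ?S" by (simp add: vec3_zero vec3_eq_iff golden'_def)
            show "?S \<bullet> ?S \<le> ?K" using golden_bounds by (simp add: algebra_simps golden_mult)
          qed
        next
          case False
          then have f3: "0 \<le> 0 * a + 0 * A + 1 * b + (- 1) * B + (- 2) * c + 2 * C" by simp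
          note f3g = times_golden[OF this]
          show ?thesis
          proof (rule symmetrize_cell)
            let ?H = "[vec3 golden 0 (- golden'), vec3 0 golden' (- golden), vec3 golden 0 golden',
                      vec3 (- 1) 1 (- 1), vec3 1 1 (- 1), vec3 0 golden' golden, vec3 (- 1) 1 1, vec3 1 1 1,
                      vec3 (- golden') golden 0, vec3 golden' golden 0]"
            \<comment> \<open>The cell that attains the maximum.\<close>
            let ?S = "vec3 (2 + 8 * golden) (30 + 50 * golden) (8 + 12 * golden)"
            show "sorted (0 # map ((\<bullet>) ?w) ?H)"
              by (simp add: eqs) (insert base y_eq Y_eq f0 f0g f1 f1g f2 f2g f3 f3g, intro conjI; linarith)
            show "set (symmetrize ?H) = dodecahedron" unfolding dodecahedron_def by (simp, blast)
            show "card dodecahedron = 2 * length ?H" by (simp add: card_dodecahedron)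
            show "arith_sum 2 1 ?H = ?S" by (simp add: vec3_zero vec3_eq_iff golden'_def)
            show "?S \<bullet> ?S \<le> ?K" using golden_bounds by (simp add: algebra_simps golden_mult)
          qed
        qed
      qed
    qed
  next
    case False
    then have f0: "0 \<le> 0 * a + (- 1) * A + 0 * b + 0 * B + (- 1) * c + 1 * C" by simp
    note f0g = times_golden[OF this]
    show ?thesis
    proof (cases "0 \<le> 0 * a + 0 * A + (- 1) * b + 1 * B + 2 * c + (- 2) * C")
      case True
      note f1 = True and f1g = times_golden[OF True]
      show ?thesis
      proof (cases "0 \<le> 2 * a + 0 * A + 2 * b + (- 1) * B + (- 2) * c + 0 * C")
        case True
        note f2 = True and f2g = times_golden[OF True]
        show ?thesis
        proof (cases "0 \<le> 0 * a + 0 * A + 2 * b + (- 1) * B + (- 2) * c + 0 * C")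
          case True
          note f3 = True and f3g = times_golden[OF True]
          show ?thesis
          proof (rule symmetrize_cell)
            let ?H = "[vec3 (- golden) 0 golden', vec3 golden 0 golden', vec3 0 golden' (- golden),
                      vec3 0 golden' golden, vec3 (- 1) 1 (- 1), vec3 1 1 (- 1), vec3 (- 1) 1 1, vec3 1 1 1,
                      vec3 (- golden') golden 0, vec3 golden' golden 0]"
            let ?S = "vec3 (2 + 4 * golden) (36 + 48 * golden) (4 + 6 * golden)"
            show "sorted (0 # map ((\<bullet>) ?w) ?H)"
              by (simp add: eqs) (insert base y_eq Y_eq f0 f0g f1 f1g f2 f2g f3 f3g, intro conjI; linarith)
            show "set (symmetrize ?H) = dodecahedron" unfolding dodecahedron_def by (simp, blast)
            show "card dodecahedron = 2 * length ?H" by (simp add: card_dodecahedron)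
            show "arith_sum 2 1 ?H = ?S" by (simp add: vec3_zero vec3_eq_iff golden'_def)
            show "?S \<bullet> ?S \<le> ?K" using golden_bounds by (simp add: algebra_simps golden_mult)
          qed
        next
          case False
          then have f3: "0 \<le> 0 * a + 0 * A + (- 2) * b + 1 * B + 2 * c + 0 * C" by simp
          note f3g = times_golden[OF this]
          show ?thesis
          proof (rule symmetrize_cell)
            let ?H = "[vec3 (- golden) 0 golden', vec3 golden 0 golden', vec3 0 golden' (- golden),
                      vec3 (- 1) 1 (- 1), vec3 0 golden' golden, vec3 1 1 (- 1), vec3 (- 1) 1 1, vec3 1 1 1,
                      vec3 (- golden') golden 0, vec3 golden' golden 0]"
            let ?S = "vec3 (4 + 4 * golden) (32 + 50 * golden) (6 + 8 * golden)"
            show "sorted (0 # map ((\<bullet>) ?w) ?H)"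
              by (simp add: eqs) (insert base y_eq Y_eq f0 f0g f1 f1g f2 f2g f3 f3g, intro conjI; linarith)
            show "set (symmetrize ?H) = dodecahedron" unfolding dodecahedron_def by (simp, blast)
            show "card dodecahedron = 2 * length ?H" by (simp add: card_dodecahedron)
            show "arith_sum 2 1 ?H = ?S" by (simp add: vec3_zero vec3_eq_iff golden'_def)
            show "?S \<bullet> ?S \<le> ?K" using golden_bounds by (simp add: algebra_simps golden_mult)
          qed
        qed
      next
        case False
        then have f2: "0 \<le> (- 2) * a + 0 * A + (- 2) * b + 1 * B + 2 * c + 0 * C" by simp
        note f2g = times_golden[OF this]
        show ?thesis
        proof (rule symmetrize_cell)
          let ?H = "[vec3 (- golden) 0 golden', vec3 golden 0 golden', vec3 0 golden' (- golden),
                    vec3 (- 1) 1 (- 1), vec3 1 1 (- 1), vec3 0 golden' golden, vec3 (- 1) 1 1, vec3 1 1 1,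
                    vec3 (- golden') golden 0, vec3 golden' golden 0]"
          let ?S = "vec3 (2 + 4 * golden) (28 + 52 * golden) (8 + 10 * golden)"
          show "sorted (0 # map ((\<bullet>) ?w) ?H)"
            by (simp add: eqs) (insert base y_eq Y_eq f0 f0g f1 f1g f2 f2g, intro conjI; linarith)
          show "set (symmetrize ?H) = dodecahedron" unfolding dodecahedron_def by (simp, blast)
          show "card dodecahedron = 2 * length ?H" by (simp add: card_dodecahedron)
          show "arith_sum 2 1 ?H = ?S" by (simp add: vec3_zero vec3_eq_iff golden'_def)
          show "?S \<bullet> ?S \<le> ?K" using golden_bounds by (simp add: algebra_simps golden_mult)
        qed
      qed
    next
      case False
      then have f1: "0 \<le> 0 * a + 0 * A + 1 * b + (- 1) * B + (- 2) * c + 2 * C" by simp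
      note f1g = times_golden[OF this]
      show ?thesis
      \<comment> \<open>Order of \<open>vec3 0 golden' (- golden)\<close> and
        \<open>vec3 (- golden) 0 golden'\<close>.\<close>
      proof (cases "0 \<le> 0 * a + 2 * A + (- 1) * b + 1 * B + 2 * c + (- 2) * C")
        case True
        note f2 = True and f2g = times_golden[OF True]
        show ?thesis
        proof (rule symmetrize_cell)
          let ?H = "[vec3 (- golden) 0 golden', vec3 0 golden' (- golden), vec3 golden 0 golden',
                    vec3 (- 1) 1 (- 1), vec3 1 1 (- 1), vec3 0 golden' golden, vec3 (- 1) 1 1, vec3 1 1 1,
                    vec3 (- golden') golden 0, vec3 golden' golden 0]"
          let ?S = "vec3 (2 + 6 * golden) (30 + 50 * golden) (6 + 14 * golden)"
          show "sorted (0 # map ((\<bullet>) ?w) ?H)"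
            by (simp add: eqs) (insert base y_eq Y_eq f0 f0g f1 f1g f2 f2g, intro conjI; linarith)
          show "set (symmetrize ?H) = dodecahedron" unfolding dodecahedron_def by (simp, blast)
          show "card dodecahedron = 2 * length ?H" by (simp add: card_dodecahedron)
          show "arith_sum 2 1 ?H = ?S" by (simp add: vec3_zero vec3_eq_iff golden'_def)
          show "?S \<bullet> ?S \<le> ?K" using golden_bounds by (simp add: algebra_simps golden_mult)
        qed
      next
        case False
        then have f2: "0 \<le> 0 * a + (- 2) * A + 1 * b + (- 1) * B + (- 2) * c + 2 * C" by simp
        note f2g = times_golden[OF this]
        show ?thesis
        \<comment> \<open>Sign of \<open>vec3 0 golden' (- golden)\<close>.\<close>
        proof (cases "0 \<le> 0 * a + 1 * A + (- 1) * b + 1 * B + 1 * c + (- 1) * C")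
          case True
          note f3 = True and f3g = times_golden[OF True]
          show ?thesis
          proof (rule symmetrize_cell)
            let ?H = "[vec3 0 golden' (- golden), vec3 (- golden) 0 golden', vec3 golden 0 golden',
                      vec3 (- 1) 1 (- 1), vec3 1 1 (- 1), vec3 0 golden' golden, vec3 (- 1) 1 1, vec3 1 1 1,
                      vec3 (- golden') golden 0, vec3 golden' golden 0]"
            let ?S = "vec3 (2 + 4 * golden) (32 + 48 * golden) (4 + 18 * golden)"
            show "sorted (0 # map ((\<bullet>) ?w) ?H)"
              by (simp add: eqs) (insert base y_eq Y_eq f0 f0g f1 f1g f2 f2g f3 f3g, intro conjI; linarith)
            show "set (symmetrize ?H) = dodecahedron" unfolding dodecahedron_def by (simp, blast)
            show "card dodecahedron = 2 * length ?H" by (simp add: card_dodecahedron)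
            show "arith_sum 2 1 ?H = ?S" by (simp add: vec3_zero vec3_eq_iff golden'_def)
            show "?S \<bullet> ?S \<le> ?K" using golden_bounds by (simp add: algebra_simps golden_mult)
          qed
        next
          case False
          then have f3: "0 \<le> 0 * a + (- 1) * A + 1 * b + (- 1) * B + (- 1) * c + 1 * C" by simp
          note f3g = times_golden[OF this]
          show ?thesis
          proof (rule symmetrize_cell)
            let ?H = "[vec3 0 (- golden') golden, vec3 (- golden) 0 golden', vec3 golden 0 golden',
                      vec3 (- 1) 1 (- 1), vec3 1 1 (- 1), vec3 0 golden' golden, vec3 (- 1) 1 1, vec3 1 1 1,
                      vec3 (- golden') golden 0, vec3 golden' golden 0]"
            let ?S = "vec3 (2 + 4 * golden) (34 + 46 * golden) (4 + 20 * golden)"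
            show "sorted (0 # map ((\<bullet>) ?w) ?H)"
              by (simp add: eqs) (insert base y_eq Y_eq f0 f0g f1 f1g f2 f2g f3 f3g, intro conjI; linarith)
            show "set (symmetrize ?H) = dodecahedron" unfolding dodecahedron_def by (simp, blast)
            show "card dodecahedron = 2 * length ?H" by (simp add: card_dodecahedron)
            show "arith_sum 2 1 ?H = ?S" by (simp add: vec3_zero vec3_eq_iff golden'_def)
            show "?S \<bullet> ?S \<le> ?K" using golden_bounds by (simp add: algebra_simps golden_mult)
          qed
        qed
      qed
    qed
  qed
qed

end

lemma icosahedron_positive: "m \<in> {vec3 0 0 1, oblique, vec3 1 0 0} \<Longrightarrow> m \<bullet> vec3 1 10 1 > 0"
  using golden_bounds by (auto simp: golden'_def)

lemma max_rank_sum_icosahedron: "max_rank_sum icosahedron (572 + 924 * golden)"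
proof (rule max_rank_sumI[OF _ mirror_icosahedron icosahedron_positive])
  show "finite icosahedron" by (simp add: icosahedron_def)
  fix w assume pos: "\<And>m. m \<in> {vec3 0 0 1, oblique, vec3 1 0 0} \<Longrightarrow> m \<bullet> w \<ge> 0"
  obtain a y c where w: "w = vec3 a y c" by (rule vec3_cases)
  interpret h3_chamber a y c
    by unfold_locales (use pos[of "vec3 0 0 1"] pos[of "oblique"] pos[of "vec3 1 0 0"] in \<open>simp_all add: w\<close>)
  show "\<exists>L. set L = icosahedron \<and> length L = card icosahedron \<and>
    sorted (map ((\<bullet>) w) L) \<and> arith_sum 1 1 L \<bullet> arith_sum 1 1 L \<le> 572 + 924 * golden"
    unfolding w by (rule icosahedron_sorting)
next
  let ?L = "symmetrize [vec3 (- 1) 0 golden, vec3 1 0 golden, vec3 (- golden) 1 0, vec3 golden 1 0,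
      vec3 0 golden (- 1), vec3 0 golden 1]"
  show "set ?L = icosahedron" unfolding icosahedron_def by (simp, blast)
  show "length ?L = card icosahedron" by (simp add: card_icosahedron)
  have "arith_sum 1 1 ?L = vec3 (2 + 2 * golden) (12 + 20 * golden) (2 + 4 * golden)"
    by (simp only: arith_sum_symmetrize) (simp add: vec3_zero vec3_eq_iff golden'_def)
  then show "arith_sum 1 1 ?L \<bullet> arith_sum 1 1 ?L = 572 + 924 * golden" by (simp add: algebra_simps golden_mult)
qed

lemma dodecahedron_positive: "m \<in> {vec3 1 0 0, oblique, vec3 0 0 1} \<Longrightarrow> m \<bullet> vec3 1 10 1 > 0"
  using golden_bounds by (auto simp: golden'_def)

lemma max_rank_sum_dodecahedron: "max_rank_sum dodecahedron (3676 + 5932 * golden)"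
proof (rule max_rank_sumI[OF _ mirror_dodecahedron dodecahedron_positive])
  show "finite dodecahedron" by (simp add: dodecahedron_def)
  fix w assume pos: "\<And>m. m \<in> {vec3 1 0 0, oblique, vec3 0 0 1} \<Longrightarrow> m \<bullet> w \<ge> 0"
  obtain a y c where w: "w = vec3 a y c" by (rule vec3_cases)
  interpret h3_chamber a y c
    by unfold_locales (use pos[of "vec3 1 0 0"] pos[of "oblique"] pos[of "vec3 0 0 1"] in \<open>simp_all add: w\<close>)
  show "\<exists>L. set L = dodecahedron \<and> length L = card dodecahedron \<and>
    sorted (map ((\<bullet>) w) L) \<and> arith_sum 1 1 L \<bullet> arith_sum 1 1 L \<le> 3676 + 5932 * golden"
    unfolding w by (rule dodecahedron_sorting)
next
  let ?L = "symmetrize [vec3 golden 0 (- golden'), vec3 0 golden' (- golden), vec3 golden 0 golden',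
      vec3 (- 1) 1 (- 1), vec3 1 1 (- 1), vec3 0 golden' golden, vec3 (- 1) 1 1, vec3 1 1 1,
      vec3 (- golden') golden 0, vec3 golden' golden 0]"
  show "set ?L = dodecahedron" unfolding dodecahedron_def by (simp, blast)
  show "length ?L = card dodecahedron" by (simp add: card_dodecahedron)
  have "arith_sum 1 1 ?L = vec3 (2 + 8 * golden) (30 + 50 * golden) (8 + 12 * golden)"
    by (simp only: arith_sum_symmetrize) (simp add: vec3_zero vec3_eq_iff golden'_def)
  then show "arith_sum 1 1 ?L \<bullet> arith_sum 1 1 ?L = 3676 + 5932 * golden" by (simp add: algebra_simps golden_mult)
qed

lemma tetrahedron_positive: "m \<in> {vec3 0 1 1, vec3 1 (- 1) 0, vec3 0 1 (- 1)} \<Longrightarrow> m \<bullet> vec3 3 2 1 > 0"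
  by auto

text \<open>There is no central symmetry to exploit, but consecutive vertices of \<open>?L\<close>
  differ by twice a normal, so this one list is sorted on the whole chamber.\<close>

lemma max_rank_sum_tetrahedron: "max_rank_sum tetrahedron 20"
proof (rule max_rank_sumI[OF _ mirror_tetrahedron tetrahedron_positive])
  let ?L = "[vec3 (- 1) (- 1) 1, vec3 (- 1) 1 (- 1), vec3 1 (- 1) (- 1), vec3 1 1 1]"
  have L: "set ?L = tetrahedron" "length ?L = card tetrahedron" "arith_sum 1 1 ?L \<bullet> arith_sum 1 1 ?L = 20"
    by (simp add: tetrahedron_def, blast) (simp_all add: card_tetrahedron vec3_zero)
  then show "set ?L = tetrahedron" "length ?L = card tetrahedron" "arith_sum 1 1 ?L \<bullet> arith_sum 1 1 ?L = 20"
    by blast+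
  show "finite tetrahedron" by (simp add: tetrahedron_def)
  fix w assume pos: "\<And>m. m \<in> {vec3 0 1 1, vec3 1 (- 1) 0, vec3 0 1 (- 1)} \<Longrightarrow> m \<bullet> w \<ge> 0"
  obtain a b c where w: "w = vec3 a b c" by (rule vec3_cases)
  have "sorted (map ((\<bullet>) w) ?L)" using pos[of "vec3 0 1 1"] pos[of "vec3 1 (- 1) 0"] pos[of "vec3 0 1 (- 1)"] by (simp add: w)
  then show "\<exists>L. set L = tetrahedron \<and> length L = card tetrahedron \<and>
    sorted (map ((\<bullet>) w) L) \<and> arith_sum 1 1 L \<bullet> arith_sum 1 1 L \<le> 20"
    using L by (intro exI[of _ ?L]) simp
qed

lemma max_rank_sum_image:
  fixes W :: "'a::real_inner set"
  assumes "max_rank_sum W K" "orthogonal_transformation T" "c \<noteq> 0"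
  shows "max_rank_sum ((\<lambda>u. c *\<^sub>R T u) ` W) (c\<^sup>2 * K)"
proof -
  define h where "h u = c *\<^sub>R T u" for u
  have "linear h"
    unfolding h_def using assms(2) by (intro linear_compose_scale_right orthogonal_transformation_linear)
  then have sum_h: "rank_sum N (h \<circ> n) = h (rank_sum N n)" for N n
    by (simp add: rank_sum_def linear_sum linear_scale)
  have h_sq: "h u \<bullet> h u = c\<^sup>2 * (u \<bullet> u)" for u
    using assms(2) by (simp add: h_def orthogonal_transformation_def power2_eq_square)
  have "inj h" using orthogonal_transformation_inj[OF assms(2)] assms(3)
    by (auto simp: h_def inj_def)
  then have bij: "bij_betw h W (h ` W)" and card: "card (h ` W) = card W"
    by (auto intro: bij_betw_imageI inj_on_subset card_image)
  have "max_rank_sum (h ` W) (c\<^sup>2 * K)"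
    unfolding max_rank_sum_def card
  proof (intro conjI allI impI)
    let ?N = "card W"
    obtain n where n: "bij_betw n {1..?N} W" "rank_sum ?N n \<bullet> rank_sum ?N n = K"
      using assms(1) by (auto simp: max_rank_sum_def)
    then have "bij_betw (h \<circ> n) {1..?N} (h ` W)" using bij bij_betw_trans by blast
    then show "\<exists>n. bij_betw n {1..?N} (h ` W) \<and> rank_sum ?N n \<bullet> rank_sum ?N n = c\<^sup>2 * K"
      using n(2) h_sq sum_h by metis
    fix m assume m: "bij_betw m {1..?N} (h ` W)"
    define n where "n = inv_into W h \<circ> m"
    have n: "bij_betw n {1..?N} W"
      unfolding n_def using m bij_betw_inv_into[OF bij] by (rule bij_betw_trans)
    have "rank_sum ?N m = rank_sum ?N (h \<circ> n)"
      unfolding rank_sum_def using bij_betwE[OF m]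
      by (intro sum.cong refl) (simp add: n_def f_inv_into_f)
    then show "rank_sum ?N m \<bullet> rank_sum ?N m \<le> c\<^sup>2 * K"
      using n assms(1) by (simp add: sum_h h_sq max_rank_sum_def mult_left_mono)
  qed
  then show ?thesis by (simp add: h_def[abs_def])
qed

section \<open>Maxima for the regular polyhedra\<close>

context mirror_system
begin

lemma max_rank_sum_standard:
  assumes "orthogonal_transformation T" "V = (\<lambda>u. (1 / norm w) *\<^sub>R T u) ` W"
    and "max_rank_sum W K" "card W = N" "w \<bullet> w = R" "R > 0"
  shows "card V = N \<and> max_rank_sum V (K / R)"
proof
  have w: "w \<noteq> 0" "norm w * norm w = R" using assms(5,6) by (auto simp: power2_norm_eq_inner simp flip: power2_eq_square)
  then show "max_rank_sum V (K / R)"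
    using max_rank_sum_image[OF assms(3,1), of "1 / norm w"]
    unfolding assms(2) by (simp add: power2_eq_square)
  have "inj (\<lambda>u. (1 / norm w) *\<^sub>R T u)"
    using orthogonal_transformation_inj[OF assms(1)] w(1) by (auto simp: inj_def)
  then show "card V = N"
    unfolding assms(2) assms(4)[symmetric] by (intro card_image) (auto intro: inj_on_subset)
qed

text \<open>The angle pairs correspond to the Schlaefli symbols {3,3}, {3,4}, {4,3}, {3,5}, {5,3}.
  Each value is the maximum for the standard solid divided by its squared circumradius: 3, 1, 3,
  \<open>golden + 2\<close>, 3.\<close>

lemma max_rank_sum_cases:
  "(card V = 4 \<and> max_rank_sum V (20 / 3)) \<or> (card V = 6 \<and> max_rank_sum V 35) \<or>
   (card V = 8 \<and> max_rank_sum V 112) \<or>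
   (card V = 12 \<and> max_rank_sum V ((572 + 924 * golden) / (golden + 2))) \<or>
   (card V = 20 \<and> max_rank_sum V ((3676 + 5932 * golden) / 3))"
proof -
  have gold: "(golden)\<^sup>2 = (3 + sqrt 5) / 2"
    unfolding power2_eq_square golden_mult by (simp add: golden_def field_simps)
  have gpos: "golden > 0" "golden' > 0" using golden_bounds by (auto simp: golden'_def)
  have obl: "oblique \<bullet> oblique = 4" by (simp add: golden'_def algebra_simps golden_mult)
  have g1: "golden * golden' = 1" "golden' * golden = 1" by (simp_all add: golden'_def algebra_simps golden_mult)
  consider "x\<^sup>2 = 1/4" "z\<^sup>2 = 1/4" | "x\<^sup>2 = 1/4" "z\<^sup>2 = 1/2" | "x\<^sup>2 = 1/2" "z\<^sup>2 = 1/4"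
    | "x\<^sup>2 = 1/4" "z\<^sup>2 = (3 + sqrt 5) / 8" | "x\<^sup>2 = (3 + sqrt 5) / 8" "z\<^sup>2 = 1/4"
    using angle_pairs by auto
  then show ?thesis
  proof cases
    case 1
    obtain T where "orthogonal_transformation T" "V = (\<lambda>u. (1 / norm (vec3 1 1 1)) *\<^sub>R T u) ` tetrahedron"
    \<comment> \<open>The instantiation follows first occurrence in the statement:
      \<open>N\<^sub>0\<close>, \<open>N\<^sub>2\<close>, \<open>N\<^sub>1\<close>, then
      \<open>w\<close>, \<rho>, \<open>W\<close>.\<close>
    proof (rule standard_position[of "vec3 0 1 1" "vec3 0 1 (- 1)" "vec3 1 (- 1) 0" "vec3 1 1 1" "vec3 3 2 1" tetrahedron])
      show "vec3 1 1 1 \<in> tetrahedron" by (simp add: tetrahedron_def)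
      show "tetrahedron \<subseteq> X" if "vec3 1 1 1 \<in> X"
        "\<And>m u. m \<in> {vec3 0 1 1, vec3 1 (- 1) 0, vec3 0 1 (- 1)} \<Longrightarrow> u \<in> X \<Longrightarrow> mirror m u \<in> X" for X
        by (rule tetrahedron_generated[OF that])
    qed (simp_all add: 1 tetrahedron_positive mirror_tetrahedron)
    from max_rank_sum_standard[OF this max_rank_sum_tetrahedron card_tetrahedron]
    show ?thesis by simp
  next
    case 2
    obtain T where "orthogonal_transformation T" "V = (\<lambda>u. (1 / norm (vec3 1 0 0)) *\<^sub>R T u) ` octahedron"
    proof (rule standard_position[of "vec3 1 (- 1) 0" "vec3 0 0 1" "vec3 0 1 (- 1)" "vec3 1 0 0" "vec3 3 2 1" octahedron])
      show "vec3 1 0 0 \<in> octahedron" by (simp add: octahedron_def)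
      show "octahedron \<subseteq> X" if "vec3 1 0 0 \<in> X"
        "\<And>m u. m \<in> {vec3 1 (- 1) 0, vec3 0 1 (- 1), vec3 0 0 1} \<Longrightarrow> u \<in> X \<Longrightarrow> mirror m u \<in> X" for X
        by (rule octahedron_generated[OF that])
    qed (simp_all add: 2 octahedron_positive mirror_octahedron)
    from max_rank_sum_standard[OF this max_rank_sum_octahedron card_octahedron]
    show ?thesis by simp
  next
    case 3
    obtain T where "orthogonal_transformation T" "V = (\<lambda>u. (1 / norm (vec3 1 1 1)) *\<^sub>R T u) ` cube"
    proof (rule standard_position[of "vec3 0 0 1" "vec3 1 (- 1) 0" "vec3 0 1 (- 1)" "vec3 1 1 1" "vec3 3 2 1" cube])
      show "vec3 1 1 1 \<in> cube" by (simp add: cube_def)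
      show "cube \<subseteq> X" if "vec3 1 1 1 \<in> X"
        "\<And>m u. m \<in> {vec3 0 0 1, vec3 0 1 (- 1), vec3 1 (- 1) 0} \<Longrightarrow> u \<in> X \<Longrightarrow> mirror m u \<in> X" for X
        by (rule cube_generated[OF that])
    qed (simp_all add: 3 cube_positive mirror_cube)
    from max_rank_sum_standard[OF this max_rank_sum_cube card_cube]
    show ?thesis by simp
  next
    case 4
    obtain T where "orthogonal_transformation T" "V = (\<lambda>u. (1 / norm (vec3 0 golden 1)) *\<^sub>R T u) ` icosahedron"
    proof (rule standard_position[of "vec3 0 0 1" "vec3 1 0 0" oblique "vec3 0 golden 1" "vec3 1 10 1" icosahedron])
      show "vec3 0 golden 1 \<in> icosahedron" by (simp add: icosahedron_def)
      show "icosahedron \<subseteq> X" if "vec3 0 golden 1 \<in> X"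
        "\<And>m u. m \<in> {vec3 0 0 1, oblique, vec3 1 0 0} \<Longrightarrow> u \<in> X \<Longrightarrow> mirror m u \<in> X" for X
        by (rule icosahedron_generated[OF that])
    qed (simp_all add: 4 obl g1 gold gpos icosahedron_positive mirror_icosahedron del: inner_vec3, simp_all add: gpos g1 gold)
    from max_rank_sum_standard[OF this max_rank_sum_icosahedron card_icosahedron]
    show ?thesis using gpos by (simp add: golden_mult add.commute)
  next
    case 5
    obtain T where "orthogonal_transformation T" "V = (\<lambda>u. (1 / norm (vec3 golden' golden 0)) *\<^sub>R T u) ` dodecahedron"
    proof (rule standard_position[of "vec3 1 0 0" "vec3 0 0 1" oblique "vec3 golden' golden 0" "vec3 1 10 1" dodecahedron])
      show "vec3 golden' golden 0 \<in> dodecahedron" by (simp add: dodecahedron_def)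
      show "dodecahedron \<subseteq> X" if "vec3 golden' golden 0 \<in> X"
        "\<And>m u. m \<in> {vec3 1 0 0, oblique, vec3 0 0 1} \<Longrightarrow> u \<in> X \<Longrightarrow> mirror m u \<in> X" for X
        by (rule dodecahedron_generated[OF that])
    qed (simp_all add: 5 obl g1 gold gpos dodecahedron_positive mirror_dodecahedron del: inner_vec3, simp_all add: gpos g1 gold)
    from max_rank_sum_standard[OF this max_rank_sum_dodecahedron card_dodecahedron]
    show ?thesis by (simp add: golden'_def algebra_simps golden_mult)
  qed
qed

end

section \<open>Operators on a qubit\<close>

lemma cinner_add_left: "cinner (x + y) z = cinner x z + cinner y z"
  for x :: "'h::complex_inner_product"
  by (metis cinner_add_right cinner_commute complex_cnj_add)

lemma cinner_scaleC_left: "cinner (c *\<^sub>C x) z = cnj c * cinner x z"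
  for x :: "'h::complex_inner_product"
  by (metis cinner_commute cinner_scaleC_right complex_cnj_mult)

lemma cinner_zero_right [simp]: "cinner x 0 = 0" for x :: "'h::complex_inner_product"
  using cinner_add_right[of x 0 0] by simp

lemma cinner_zero_left [simp]: "cinner 0 x = 0" for x :: "'h::complex_inner_product"
  using cinner_add_left[of 0 0 x] by simp

lemma cinner_sum_right: "cinner x (sum f A) = (\<Sum>i\<in>A. cinner x (f i))"
  for x :: "'h::complex_inner_product"
  by (induction A rule: infinite_finite_induct) (simp_all add: cinner_add_right)

lemma cinner_diff_right: "cinner x (y - z) = cinner x y - cinner x z"
  for x :: "'h::complex_inner_product"
  using cinner_add_right[of x "y - z" z] by simp

lemma orthonormal_expansion:
  fixes x :: "'h::complex_inner_product"
  assumes "orthonormal_basis B" "finite B"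
  shows "x = (\<Sum>b\<in>B. cinner b x *\<^sub>C b)"
proof -
  let ?y = "x - (\<Sum>b\<in>B. cinner b x *\<^sub>C b)"
  have orth: "cinner c ?y = 0" if "c \<in> B" for c
  proof -
    have "(\<Sum>b\<in>B. cinner b x * cinner c b) = (\<Sum>b\<in>B. if b = c then cinner c x else 0)"
      using assms(1) that by (intro sum.cong) (auto simp: orthonormal_basis_def)
    then show ?thesis
      using assms(2) that by (simp add: cinner_diff_right cinner_sum_right cinner_scaleC_right)
  qed
  have y: "?y \<in> cvs.span B" using assms(1) by (simp add: orthonormal_basis_def)
  have "cinner z ?y = 0" if "z \<in> cvs.span B" for z
    using that by (induction rule: cvs.span_induct_alt)
      (simp_all add: orth cinner_add_left cinner_scaleC_left)
  from this[OF y] have "cinner ?y ?y = 0" .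
  then show ?thesis by (simp add: cinner_self_eq_zero)
qed

text \<open>\<open>op_trace\<close> sums over an arbitrarily chosen orthonormal basis, and a sum
  over an infinite set would be 0.\<close>

lemma orthonormal_basis_finite:
  fixes B C :: "'h::complex_inner_product set"
  assumes "orthonormal_basis B" "orthonormal_basis C" "finite C"
  shows "finite B"
proof -
  have "cvs.independent B"
    unfolding cvs.dependent_explicit
  proof clarsimp
    fix S u b assume S: "finite S" "S \<subseteq> B" "b \<in> S" "(\<Sum>v\<in>S. u v *\<^sub>C v) = 0"
    have "(\<Sum>v\<in>S. u v * cinner b v) = (\<Sum>v\<in>S. if v = b then u b else 0)"
      using assms(1) S(2,3) by (intro sum.cong) (auto simp: orthonormal_basis_def subset_iff)
    then have "cinner b (\<Sum>v\<in>S. u v *\<^sub>C v) = u b"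
      using S(1,3) by (simp add: cinner_sum_right cinner_scaleC_right)
    then show "u b = 0" unfolding S(4) by simp
  qed
  moreover have "B \<subseteq> cvs.span C" using assms(2) by (simp add: orthonormal_basis_def)
  ultimately show ?thesis using cvs.independent_span_bound[OF assms(3)] by blast
qed

lemma op_trace_eq:
  fixes A :: "'h::complex_inner_product \<Rightarrow> 'h"
  assumes "Vector_Spaces.linear scaleC scaleC A" and C: "orthonormal_basis C" "finite C"
  shows "op_trace A = (\<Sum>c\<in>C. cinner c (A c))"
proof -
  interpret A: Vector_Spaces.linear scaleC scaleC A by fact
  define B where "B = (SOME B :: 'h set. orthonormal_basis B)"
  have B: "orthonormal_basis B" unfolding B_def using C(1) by (rule someI)
  then have "finite B" using orthonormal_basis_finite C by blast
  have "op_trace A = (\<Sum>b\<in>B. cinner b (A b))" by (simp add: op_trace_def B_def)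
  also have "\<dots> = (\<Sum>b\<in>B. \<Sum>c\<in>C. cinner b c * cinner c (A b))"
  proof (rule sum.cong[OF refl])
    fix b
    show "cinner b (A b) = (\<Sum>c\<in>C. cinner b c * cinner c (A b))"
      by (subst orthonormal_expansion[OF C, of "A b"])
         (simp add: cinner_sum_right cinner_scaleC_right mult.commute)
  qed
  also have "\<dots> = (\<Sum>c\<in>C. \<Sum>b\<in>B. cinner b c * cinner c (A b))" by (rule sum.swap)
  also have "\<dots> = (\<Sum>c\<in>C. cinner c (A c))"
  proof (rule sum.cong[OF refl])
    fix c
    have "A c = (\<Sum>b\<in>B. cinner b c *\<^sub>C A b)"
      by (subst orthonormal_expansion[OF B \<open>finite B\<close>, of c]) (simp add: A.sum A.scale)
    then show "(\<Sum>b\<in>B. cinner b c * cinner c (A b)) = cinner c (A c)"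
      by (simp add: cinner_sum_right cinner_scaleC_right)
  qed
  finally show ?thesis .
qed

section \<open>The Bloch representation\<close>

locale qubit =
  fixes e :: "2 \<Rightarrow> 'h::complex_inner_product"
  assumes inj_e: "inj e" and basis: "orthonormal_basis (range e)"
begin

lemma cinner_e [simp]: "cinner (e i) (e j) = (if i = j then 1 else 0)"
  using basis inj_e by (auto simp: orthonormal_basis_def inj_eq)

lemma expand: "x = cinner (e 1) x *\<^sub>C e 1 + cinner (e 2) x *\<^sub>C e 2"
  using orthonormal_expansion[OF basis, of x] inj_e by (simp add: sum.reindex sum_2)

abbreviation mat_elt :: "('h \<Rightarrow> 'h) \<Rightarrow> 2 \<Rightarrow> 2 \<Rightarrow> complex" where
  "mat_elt A i j \<equiv> cinner (e i) (A (e j))"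

lemma op_trace_qubit:
  assumes "Vector_Spaces.linear scaleC scaleC A"
  shows "op_trace A = mat_elt A 1 1 + mat_elt A 2 2"
  using op_trace_eq[OF assms basis] inj_e by (simp add: sum.reindex sum_2)

lemma matrix_op_eq: "matrix_op e A x = (A $ 1 $ 1 * cinner (e 1) x + A $ 1 $ 2 * cinner (e 2) x) *\<^sub>C e 1
    + (A $ 2 $ 1 * cinner (e 1) x + A $ 2 $ 2 * cinner (e 2) x) *\<^sub>C e 2"
  by (simp add: matrix_op_def sum_2 scaleC_add_left add_ac)

lemma linear_matrix_op: "Vector_Spaces.linear scaleC scaleC (matrix_op e A)"
  by unfold_locales
     (simp_all add: matrix_op_eq scaleC_add_right scaleC_add_left scaleC_scaleC cinner_add_right
       cinner_scaleC_right algebra_simps)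

lemma bloch_matrix_elts:
  "bloch_matrix v $ 1 $ 1 = complex_of_real ((1 + v $ 3) / 2)"
  "bloch_matrix v $ 1 $ 2 = Complex (v $ 1 / 2) (- v $ 2 / 2)"
  "bloch_matrix v $ 2 $ 1 = Complex (v $ 1 / 2) (v $ 2 / 2)"
  "bloch_matrix v $ 2 $ 2 = complex_of_real ((1 - v $ 3) / 2)"
  by (simp_all add: bloch_matrix_def pauli_x_def pauli_y_def pauli_z_def vector_2 mat_def complex_eq_iff)

definition weight :: "('h \<Rightarrow> 'h) \<Rightarrow> real" where
  "weight A = Re (mat_elt A 1 1) + Re (mat_elt A 2 2)"

text \<open>The components are the real parts of the traces of \<open>A\<close> times the Pauli
  matrices.\<close>

definition bloch_vector :: "('h \<Rightarrow> 'h) \<Rightarrow> real^3" where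
  "bloch_vector A = vec3 (Re (mat_elt A 1 2) + Re (mat_elt A 2 1)) (Im (mat_elt A 2 1) - Im (mat_elt A 1 2))
     (Re (mat_elt A 1 1) - Re (mat_elt A 2 2))"

lemma trace_product:
  assumes "Vector_Spaces.linear scaleC scaleC A"
  shows "Re (op_trace (matrix_op e (r *\<^sub>R bloch_matrix v) \<circ> A)) = r / 2 * (weight A + v \<bullet> bloch_vector A)"
proof -
  have "Vector_Spaces.linear scaleC scaleC (matrix_op e (r *\<^sub>R bloch_matrix v) \<circ> A)"
    by (rule Vector_Spaces.linear_compose[OF assms linear_matrix_op])
  then show ?thesis
    by (simp add: op_trace_qubit matrix_op_eq cinner_add_right cinner_scaleC_right bloch_matrix_elts
        weight_def bloch_vector_def inner_vec_def sum_3 field_simps)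
qed

text \<open>Positivity makes the matrix Hermitian with nonnegative determinant, and four times the
  determinant is the squared weight minus the squared length of the Bloch vector.\<close>

lemma positive_op_bloch:
  assumes "A \<in> positive_ops"
  shows "norm (bloch_vector A) \<le> weight A"
proof -
  have lin: "Vector_Spaces.linear scaleC scaleC A" and pos: "\<And>x. cinner x (A x) \<in> \<real>\<^sub>\<ge>\<^sub>0"
    using assms by (auto simp: positive_ops_def)
  interpret A: Vector_Spaces.linear scaleC scaleC A by fact
  define \<alpha> \<beta> \<gamma> \<delta> where m: "\<alpha> = mat_elt A 1 1" "\<beta> = mat_elt A 1 2" "\<gamma> = mat_elt A 2 1" "\<delta> = mat_elt A 2 2"
  have form: "cnj s * s * \<alpha> + cnj s * t * \<beta> + cnj t * s * \<gamma> + cnj t * t * \<delta> \<in> \<real>\<^sub>\<ge>\<^sub>0" for s t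
    using pos[of "s *\<^sub>C e 1 + t *\<^sub>C e 2"]
    by (simp add: A.add A.scale cinner_add_left cinner_add_right cinner_scaleC_left cinner_scaleC_right m algebra_simps)
  have \<alpha>: "Re \<alpha> \<ge> 0" "Im \<alpha> = 0" and \<delta>: "Re \<delta> \<ge> 0" "Im \<delta> = 0"
    using form[of 1 0] form[of 0 1] by (auto simp: complex_nonneg_Reals_iff)
  have herm: "Im \<gamma> = - Im \<beta>" "Re \<gamma> = Re \<beta>"
    using form[of 1 1] form[of 1 \<i>] \<alpha> \<delta> by (auto simp: complex_nonneg_Reals_iff)
  have quad: "0 \<le> (p\<^sup>2 + q\<^sup>2) * Re \<alpha> + 2 * r * (p * Re \<beta> + q * Im \<beta>) + r\<^sup>2 * Re \<delta>" for p q r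
    using form[of "Complex p q" "of_real r"] \<alpha> \<delta> herm
    by (simp add: complex_nonneg_Reals_iff algebra_simps power2_eq_square)
  have det: "(Re \<beta>)\<^sup>2 + (Im \<beta>)\<^sup>2 \<le> Re \<alpha> * Re \<delta>"
  proof -
    define n where "n = (Re \<beta>)\<^sup>2 + (Im \<beta>)\<^sup>2"
    \<comment> \<open>Taking the first coordinate to be \<open>- k\<close> times \<beta> aligns the
      phases and leaves a real quadratic form in \<open>k\<close> and \<open>r\<close>.\<close>
    have q: "0 \<le> k\<^sup>2 * n * Re \<alpha> - 2 * r * k * n + r\<^sup>2 * Re \<delta>" for k r
      using quad[of "- k * Re \<beta>" "- k * Im \<beta>" r] by (simp add: n_def algebra_simps power2_eq_square)
    show ?thesis
    proof (cases "Re \<alpha> = 0 \<and> Re \<delta> = 0")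
      case True
      then show ?thesis using q[of 1 1] by (simp add: n_def)
    next
      case False
      have "0 \<le> Re \<delta> * (n * (Re \<alpha> * Re \<delta> - n))"
        using q[of "Re \<delta>" n] by (simp add: algebra_simps power2_eq_square)
      moreover have "0 \<le> Re \<alpha> * (Re \<alpha> * Re \<delta> - n)"
        using q[of 1 "Re \<alpha>"] by (simp add: algebra_simps power2_eq_square)
      moreover have "n \<ge> 0" by (simp add: n_def)
      ultimately show ?thesis using False \<alpha> \<delta> n_def
        by (smt (verit, ccfv_SIG) mult_eq_0_iff mult_pos_neg mult_nonneg_nonneg mult_le_0_iff)
    qed
  qed
  have "bloch_vector A \<bullet> bloch_vector A = 4 * ((Re \<beta>)\<^sup>2 + (Im \<beta>)\<^sup>2) + (Re \<alpha> - Re \<delta>)\<^sup>2"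
    using herm by (simp add: bloch_vector_def m[symmetric] power2_eq_square algebra_simps)
  also have "\<dots> \<le> (weight A)\<^sup>2"
    using det by (simp add: weight_def m[symmetric] power2_eq_square algebra_simps)
  finally have "(norm (bloch_vector A))\<^sup>2 \<le> (weight A)\<^sup>2" by (simp add: power2_norm_eq_inner)
  moreover have "weight A \<ge> 0" using \<alpha> \<delta> by (simp add: weight_def m)
  ultimately show ?thesis by (rule power2_le_imp_le)
qed

lemma positive_bloch_op:
  assumes "norm v \<le> 1"
  shows "matrix_op e (bloch_matrix v) \<in> positive_ops"
  unfolding positive_ops_def
proof (intro CollectI conjI allI linear_matrix_op)
  fix x
  define s t where st: "s = cinner (e 1) x" "t = cinner (e 2) x"
  have "cinner x (matrix_op e (bloch_matrix v) x)
    = cnj s * (bloch_matrix v $ 1 $ 1 * s + bloch_matrix v $ 1 $ 2 * t) + cnj t * (bloch_matrix v $ 2 $ 1 * s + bloch_matrix v $ 2 $ 2 * t)"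
    unfolding matrix_op_eq st
    by (simp add: cinner_add_right cinner_scaleC_right cinner_commute[of x] algebra_simps)
  also have "\<dots> = of_real (((cmod s)\<^sup>2 + (cmod t)\<^sup>2
     + v \<bullet> vec3 (2 * Re (cnj s * t)) (2 * Im (cnj s * t)) ((cmod s)\<^sup>2 - (cmod t)\<^sup>2)) / 2)"
    unfolding cmod_power2
    by (simp add: complex_eq_iff bloch_matrix_elts inner_vec_def sum_3 field_simps power2_eq_square)
  also have "\<dots> \<in> \<real>\<^sub>\<ge>\<^sub>0"
  proof -
    \<comment> \<open>The Bloch vector of the unnormalised state with coordinates \<open>s\<close>,
      \<open>t\<close>; its length is the squared norm of the state.\<close>
    let ?u = "vec3 (2 * Re (cnj s * t)) (2 * Im (cnj s * t)) ((cmod s)\<^sup>2 - (cmod t)\<^sup>2)"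
    have "?u \<bullet> ?u = ((cmod s)\<^sup>2 + (cmod t)\<^sup>2)\<^sup>2"
      unfolding cmod_power2 by (simp add: algebra_simps power2_eq_square)
    then have "norm ?u = (cmod s)\<^sup>2 + (cmod t)\<^sup>2" by (simp add: norm_eq_sqrt_inner)
    moreover have "norm (v \<bullet> ?u) \<le> norm v * norm ?u" by (rule Cauchy_Schwarz_ineq2[folded real_norm_def])
    moreover have "norm v * norm ?u \<le> norm ?u" using assms by (simp add: mult_left_le_one_le)
    ultimately have "0 \<le> (cmod s)\<^sup>2 + (cmod t)\<^sup>2 + v \<bullet> ?u" by simp
    then show ?thesis unfolding nonneg_Reals_of_real_iff by simp
  qed
  finally show "cinner x (matrix_op e (bloch_matrix v) x) \<in> \<real>\<^sub>\<ge>\<^sub>0" .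
qed

lemma bloch_op_data:
  "weight (matrix_op e (bloch_matrix v)) = 1" "bloch_vector (matrix_op e (bloch_matrix v)) = v"
proof -
  show "weight (matrix_op e (bloch_matrix v)) = 1"
    by (simp add: weight_def matrix_op_eq cinner_add_right cinner_scaleC_right bloch_matrix_elts field_simps)
  show "bloch_vector (matrix_op e (bloch_matrix v)) = v"
    by (simp add: bloch_vector_def matrix_op_eq cinner_add_right cinner_scaleC_right bloch_matrix_elts
        vec_eq_iff forall_3 field_simps)
qed

lemma bloch_op_antipodal: "matrix_op e (bloch_matrix v) x + matrix_op e (bloch_matrix (- v)) x = x"
proof -
  have "matrix_op e (bloch_matrix v) x + matrix_op e (bloch_matrix (- v)) x
      = matrix_op e (bloch_matrix v + bloch_matrix (- v)) x"
    by (simp add: matrix_op_def sum_2 scaleC_add_left distrib_right add_ac)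
  also have "bloch_matrix v + bloch_matrix (- v) = mat 1"
    by (simp add: vec_eq_iff forall_2 bloch_matrix_elts mat_def complex_eq_iff field_simps)
  also have "matrix_op e (mat 1) x = x"
    using expand[of x] by (simp add: matrix_op_eq mat_def)
  finally show ?thesis .
qed

end

section \<open>Minimum guesswork\<close>

lemma finite_numberings: "finite M \<Longrightarrow> finite (numberings M)"
proof -
  assume "finite M"
  then have "finite ({1..card M} \<rightarrow>\<^sub>E M)" by (intro finite_PiE) auto
  moreover have "numberings M \<subseteq> {1..card M} \<rightarrow>\<^sub>E M"
    by (auto simp: numberings_def PiE_iff extensional_def dest: bij_betwE)
  ultimately show ?thesis by (rule rev_finite_subset)
qed

lemma rank_sum_reverse: "rank_sum N (\<lambda>t. u (N + 1 - t)) = (real N + 1) *\<^sub>R (\<Sum>t=1..N. u t) - rank_sum N u"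
proof -
  have "rank_sum N (\<lambda>t. u (N + 1 - t)) = (\<Sum>t=1..N. (real N + 1 - real t) *\<^sub>R u t)"
    unfolding rank_sum_def
    by (rule sum.reindex_bij_witness[of _ "\<lambda>t. N + 1 - t" "\<lambda>t. N + 1 - t"]) (auto simp: of_nat_diff)
  then show ?thesis by (simp add: rank_sum_def scaleR_diff_left sum_subtractf scaleR_sum_right)
qed

context qubit
begin

lemma weight_bloch_sum:
  assumes "\<And>x. (\<Sum>n\<in>I. \<pi> n x) = x"
  shows "(\<Sum>n\<in>I. weight (\<pi> n)) = 2"
proof -
  have "(\<Sum>n\<in>I. mat_elt (\<pi> n) i i) = 1" for i
    using assms by (simp flip: cinner_sum_right)
  then have "Re (\<Sum>n\<in>I. mat_elt (\<pi> n) i i) = 1" for i by simp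
  then show ?thesis by (simp add: weight_def sum.distrib)
qed

text \<open>The total weight 2, the trace of the identity, produces the constant term; exchanging
  the sums over ranks and numberings collects the Bloch parts into rank sums.\<close>

lemma guesswork_eq:
  assumes "finite M" "M \<noteq> {}" and \<pi>: "\<And>n. n \<in> numberings M \<Longrightarrow> \<pi> n \<in> positive_ops"
    and total: "(\<Sum>n\<in>numberings M. weight (\<pi> n)) = 2"
    and \<rho>: "\<And>m. m \<in> M \<Longrightarrow> \<rho> m = matrix_op e ((1 / real (card M)) *\<^sub>R bloch_matrix (v m))"
  shows "guesswork M \<rho> \<pi> = (real (card M) + 1) / 2 +
    (\<Sum>n\<in>numberings M. rank_sum (card M) (v \<circ> n) \<bullet> bloch_vector (\<pi> n)) / (2 * real (card M))"
proof -
  let ?N = "card M"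
  have N: "real ?N > 0" using assms(1,2) by (simp add: card_gt_0_iff)
  have gauss: "(\<Sum>t=1..?N. real t) = real ?N * (real ?N + 1) / 2"
    using double_gauss_sum_from_Suc_0[of ?N, where 'a = real] by (simp add: field_simps)
  have prob: "guess_prob M \<rho> \<pi> t
      = (\<Sum>n\<in>numberings M. 1 / (2 * ?N) * (weight (\<pi> n) + v (n t) \<bullet> bloch_vector (\<pi> n)))"
    if t: "t \<in> {1..?N}" for t
    unfolding guess_prob_def
  proof (rule sum.cong[OF refl])
    fix n assume n: "n \<in> numberings M"
    then have "n t \<in> M" using t bij_betwE by (fastforce simp: numberings_def)
    moreover have "Vector_Spaces.linear scaleC scaleC (\<pi> n)" using \<pi>[OF n] by (simp add: positive_ops_def)
    ultimately show "Re (op_trace (\<rho> (n t) \<circ> \<pi> n))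
        = 1 / (2 * ?N) * (weight (\<pi> n) + v (n t) \<bullet> bloch_vector (\<pi> n))"
      by (simp add: \<rho> trace_product)
  qed
  have "guesswork M \<rho> \<pi> = (\<Sum>t=1..?N. \<Sum>n\<in>numberings M.
      1 / (2 * ?N) * (real t * weight (\<pi> n) + (real t *\<^sub>R v (n t)) \<bullet> bloch_vector (\<pi> n)))"
    unfolding guesswork_def by (intro sum.cong refl) (simp add: prob sum_distrib_left algebra_simps)
  also have "\<dots> = (\<Sum>n\<in>numberings M. 1 / (2 * ?N) *
      ((\<Sum>t=1..?N. real t) * weight (\<pi> n) + rank_sum ?N (v \<circ> n) \<bullet> bloch_vector (\<pi> n)))"
    by (subst sum.swap)
       (simp only: sum_distrib_left[symmetric] sum.distrib sum_distrib_right inner_sum_left rank_sum_def o_apply)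
  also have "\<dots> = 1 / (2 * ?N) * ((\<Sum>t=1..?N. real t) * 2
      + (\<Sum>n\<in>numberings M. rank_sum ?N (v \<circ> n) \<bullet> bloch_vector (\<pi> n)))"
    by (simp only: sum_distrib_left[symmetric] sum.distrib total)
  finally show ?thesis using N unfolding gauss by (simp add: field_simps)
qed

lemma min_guesswork_eq:
  fixes M :: "'m set"
  assumes fin: "finite M" and v: "bij_betw v M V" and sum0: "(\<Sum>u\<in>V. u) = 0"
    and K: "max_rank_sum V K" "K > 0"
    and \<rho>: "\<And>m. m \<in> M \<Longrightarrow> \<rho> m = matrix_op e ((1 / real (card M)) *\<^sub>R bloch_matrix (v m))"
  defines "G \<equiv> (real (card M) + 1) / 2 - sqrt K / real (card M)"
  shows "\<exists>\<pi>\<in>numbering_measurements M. guesswork M \<rho> \<pi> = G"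
    and "\<forall>\<pi>\<in>numbering_measurements M. G \<le> guesswork M \<rho> \<pi>"
    and "min_guesswork M \<rho> = G"
proof -
  let ?N = "card M"
  have card: "card V = ?N" using bij_betw_same_card[OF v] by simp
  have bound: "norm (rank_sum ?N (v \<circ> n)) \<le> sqrt K" if "n \<in> numberings M" for n
  proof -
    have "bij_betw (v \<circ> n) {1..?N} V"
      using that v by (auto simp: numberings_def intro: bij_betw_trans)
    then show ?thesis using K(1) by (simp add: max_rank_sum_def card norm_eq_sqrt_inner)
  qed
  obtain k where k: "bij_betw k {1..?N} V" "norm (rank_sum ?N k) = sqrt K"
    using K(1) by (auto simp: max_rank_sum_def card norm_eq_sqrt_inner)
  have "M \<noteq> {}"
  proof
    assume "M = {}"
    then show False using k(2) K(2) by (simp add: rank_sum_def)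
  qed
  then have N: "real ?N > 0" using fin by (simp add: card_gt_0_iff)

  have lower: "G \<le> guesswork M \<rho> \<pi>" if "\<pi> \<in> numbering_measurements M" for \<pi>
  proof -
    have \<pi>: "\<And>n. n \<in> numberings M \<Longrightarrow> \<pi> n \<in> positive_ops" and total: "\<And>x. (\<Sum>n\<in>numberings M. \<pi> n x) = x"
      using that by (auto simp: numbering_measurements_def)
    have "- (sqrt K * weight (\<pi> n)) \<le> rank_sum ?N (v \<circ> n) \<bullet> bloch_vector (\<pi> n)" if "n \<in> numberings M" for n
    proof -
      have "- (rank_sum ?N (v \<circ> n) \<bullet> bloch_vector (\<pi> n)) \<le> norm (rank_sum ?N (v \<circ> n)) * norm (bloch_vector (\<pi> n))"
        using norm_cauchy_schwarz[of "- rank_sum ?N (v \<circ> n)" "bloch_vector (\<pi> n)"] by simp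
      also have "\<dots> \<le> sqrt K * weight (\<pi> n)"
        using bound[OF that] positive_op_bloch[OF \<pi>[OF that]] K(2) by (intro mult_mono) auto
      finally show ?thesis by simp
    qed
    then have "(\<Sum>n\<in>numberings M. - (sqrt K * weight (\<pi> n)))
        \<le> (\<Sum>n\<in>numberings M. rank_sum ?N (v \<circ> n) \<bullet> bloch_vector (\<pi> n))"
      by (intro sum_mono) auto
    then have "- (sqrt K * 2) \<le> (\<Sum>n\<in>numberings M. rank_sum ?N (v \<circ> n) \<bullet> bloch_vector (\<pi> n))"
      by (simp only: sum_negf sum_distrib_left[symmetric] weight_bloch_sum[OF total])
    moreover have "guesswork M \<rho> \<pi> = (real ?N + 1) / 2 +
        (\<Sum>n\<in>numberings M. rank_sum ?N (v \<circ> n) \<bullet> bloch_vector (\<pi> n)) / (2 * real ?N)"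
      using guesswork_eq[OF fin \<open>M \<noteq> {}\<close> \<pi> weight_bloch_sum[OF total] \<rho>] .
    ultimately show ?thesis using N unfolding G_def by (simp add: field_simps)
  qed

  have attained: "\<exists>\<pi>\<in>numbering_measurements M. guesswork M \<rho> \<pi> = G"
  proof -
    define a where "a = restrict (inv_into M v \<circ> k) {1..?N}"
    define b where "b = restrict (\<lambda>t. a (?N + 1 - t)) {1..?N}"
    have "bij_betw (inv_into M v \<circ> k) {1..?N} M"
      using k(1) bij_betw_inv_into[OF v] by (rule bij_betw_trans)
    then have a: "a \<in> numberings M" "bij_betw a {1..?N} M" by (auto simp: a_def numberings_def)
    have "bij_betw (\<lambda>t. ?N + 1 - t) {1..?N} {1..?N}"
      by (rule bij_betw_byWitness[where f' = "\<lambda>t. ?N + 1 - t"]) auto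
    from bij_betw_trans[OF this a(2)] have b: "b \<in> numberings M"
      by (simp add: b_def numberings_def o_def)
    define S where "S = rank_sum ?N (v \<circ> a)"
    have "rank_sum ?N (v \<circ> a) = rank_sum ?N k"
      unfolding rank_sum_def using bij_betwE[OF k(1)] bij_betw_imp_surj_on[OF v]
      by (intro sum.cong refl) (simp add: a_def f_inv_into_f)
    then have S: "norm S = sqrt K" using k(2) by (simp add: S_def)
    have "(\<Sum>t=1..?N. (v \<circ> a) t) = 0"
      using sum.reindex_bij_betw[OF bij_betw_trans[OF a(2) v], of "\<lambda>u. u"] sum0 by simp
    moreover have "rank_sum ?N (v \<circ> b) = rank_sum ?N (\<lambda>t. (v \<circ> a) (?N + 1 - t))"
      by (simp add: rank_sum_def b_def)
    ultimately have Sb: "rank_sum ?N (v \<circ> b) = - S"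
      by (simp only: rank_sum_reverse S_def scaleR_zero_right diff_0)
    have "S \<noteq> 0" using S K(2) by auto
    \<comment> \<open>The two outcomes must differ, or \<pi> would contain only one of the two
      projections.\<close>
    then have "S \<noteq> - S" by (metis add_eq_0_iff scaleR_2 scaleR_eq_0_iff zero_neq_numeral)
    then have ab: "a \<noteq> b" using Sb S_def by auto
    \<comment> \<open>\<open>S\<close> leans towards the vertices guessed last, so answer
      \<open>a\<close> belongs to the opposite direction.\<close>
    define u where "u = (- 1 / norm S) *\<^sub>R S"
    have u: "norm u = 1" using \<open>S \<noteq> 0\<close> by (simp add: u_def)
    define \<pi> where "\<pi> n = (if n = a then matrix_op e (bloch_matrix u)
      else if n = b then matrix_op e (bloch_matrix (- u)) else (\<lambda>x. 0))" for n
    have two: "(\<Sum>n\<in>numberings M. f n) = f a + f b"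
      if "\<And>n. n \<noteq> a \<Longrightarrow> n \<noteq> b \<Longrightarrow> f n = 0" for f :: "(nat \<Rightarrow> 'm) \<Rightarrow> 'c::comm_monoid_add"
    proof -
      have "(\<Sum>n\<in>numberings M. f n) = (\<Sum>n\<in>{a, b}. f n)"
        using that a(1) b finite_numberings[OF fin] by (intro sum.mono_neutral_right) auto
      then show ?thesis using ab by simp
    qed
    have zero: "(\<lambda>x. 0 :: 'h) \<in> positive_ops" "bloch_vector (\<lambda>x. 0) = 0" "weight (\<lambda>x. 0) = 0"
      by (simp_all add: positive_ops_def bloch_vector_def weight_def vec3_zero) (unfold_locales; simp)
    have pos: "\<pi> n \<in> positive_ops" for n
      using u zero(1) by (simp add: \<pi>_def positive_bloch_op)
    have total: "(\<Sum>n\<in>numberings M. \<pi> n x) = x" for x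
      using ab by (subst two) (simp_all add: \<pi>_def bloch_op_antipodal)
    then have "\<pi> \<in> numbering_measurements M" using pos by (simp add: numbering_measurements_def)
    moreover have "(\<Sum>n\<in>numberings M. rank_sum ?N (v \<circ> n) \<bullet> bloch_vector (\<pi> n)) = - 2 * sqrt K"
    proof (subst two)
      show "rank_sum ?N (v \<circ> a) \<bullet> bloch_vector (\<pi> a) + rank_sum ?N (v \<circ> b) \<bullet> bloch_vector (\<pi> b) = - 2 * sqrt K"
        unfolding Sb S_def[symmetric] S[symmetric] using ab \<open>S \<noteq> 0\<close>
        by (simp add: \<pi>_def bloch_op_data u_def dot_square_norm power2_eq_square)
    qed (simp add: \<pi>_def zero)
    moreover have "guesswork M \<rho> \<pi> = (real ?N + 1) / 2 +
        (\<Sum>n\<in>numberings M. rank_sum ?N (v \<circ> n) \<bullet> bloch_vector (\<pi> n)) / (2 * real ?N)"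
      using guesswork_eq[OF fin \<open>M \<noteq> {}\<close> pos weight_bloch_sum[OF total] \<rho>] .
    ultimately have "guesswork M \<rho> \<pi> = G" "\<pi> \<in> numbering_measurements M"
      using N unfolding G_def by (simp_all add: field_simps)
    then show ?thesis by blast
  qed
  show "\<exists>\<pi>\<in>numbering_measurements M. guesswork M \<rho> \<pi> = G" by (rule attained)
  show "\<forall>\<pi>\<in>numbering_measurements M. G \<le> guesswork M \<rho> \<pi>" using lower by blast
  show "min_guesswork M \<rho> = G"
    unfolding min_guesswork_def using attained lower by (intro cInf_eq_minimum) auto
qed

end

lemma regular_polyhedron_max_rank_sum:
  fixes P :: "(real^3) set"
  defines "V \<equiv> {x. x extreme_point_of P}"
  assumes "regular_polyhedron P" "V \<subseteq> sphere 0 1"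
  shows "(\<Sum>u\<in>V. u) = 0"
    "(card V = 4 \<and> max_rank_sum V (20 / 3)) \<or> (card V = 6 \<and> max_rank_sum V 35) \<or>
     (card V = 8 \<and> max_rank_sum V 112) \<or>
     (card V = 12 \<and> max_rank_sum V ((572 + 924 * golden) / (golden + 2))) \<or>
     (card V = 20 \<and> max_rank_sum V ((3676 + 5932 * golden) / 3))"
proof -
  obtain n\<^sub>0 n\<^sub>1 n\<^sub>2 v a where facts: "finite V" "(\<Sum>u\<in>V. u) = 0" "v \<in> V"
    "\<And>n u. n \<in> {n\<^sub>0, n\<^sub>1, n\<^sub>2} \<Longrightarrow> u \<in> V \<Longrightarrow> mirror n u \<in> V"
    "n\<^sub>0 \<bullet> n\<^sub>2 = 0" "n\<^sub>0 \<bullet> n\<^sub>1 < 0" "v \<bullet> n\<^sub>0 > 0" "v \<bullet> n\<^sub>1 = 0" "v \<bullet> n\<^sub>2 = 0"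
    "a \<bullet> n\<^sub>0 = 0" "a \<bullet> n\<^sub>1 = 0" "a \<bullet> n\<^sub>2 > 0" "a \<bullet> v > 0" "\<And>u. u \<in> V \<Longrightarrow> a \<bullet> u \<le> a \<bullet> v"
    using regular_polyhedron_mirrors[OF assms(2)] assms(3) unfolding V_def by metis
  have ne: "n\<^sub>0 \<noteq> 0" "n\<^sub>1 \<noteq> 0" "n\<^sub>2 \<noteq> 0" using facts by auto
  have mirror_sgn: "mirror (sgn n) = mirror n" if "n \<noteq> 0" for n :: "real^3"
    using that by (auto simp: sgn_div_norm)
  interpret mirror_system V "sgn n\<^sub>0" "sgn n\<^sub>1" "sgn n\<^sub>2" v a
  proof
    show "mirror n u \<in> V" if "n \<in> {sgn n\<^sub>0, sgn n\<^sub>1, sgn n\<^sub>2}" "u \<in> V" for n u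
      using that facts(4) ne by (auto simp: mirror_sgn)
    show "norm u = 1" if "u \<in> V" for u using that assms(3) by auto
    show "sgn n\<^sub>0 \<bullet> sgn n\<^sub>0 = 1" "sgn n\<^sub>1 \<bullet> sgn n\<^sub>1 = 1" "sgn n\<^sub>2 \<bullet> sgn n\<^sub>2 = 1"
      using ne by (simp_all add: dot_square_norm norm_sgn)
    show "sgn n\<^sub>0 \<bullet> sgn n\<^sub>1 < 0" using facts ne by (simp add: sgn_div_norm mult_pos_neg)
  qed (use facts ne in \<open>auto simp: sgn_div_norm\<close>)
  show "(\<Sum>u\<in>V. u) = 0" by fact
  show "(card V = 4 \<and> max_rank_sum V (20 / 3)) \<or> (card V = 6 \<and> max_rank_sum V 35) \<or>
     (card V = 8 \<and> max_rank_sum V 112) \<or>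
     (card V = 12 \<and> max_rank_sum V ((572 + 924 * golden) / (golden + 2))) \<or>
     (card V = 20 \<and> max_rank_sum V ((3676 + 5932 * golden) / 3))"
    by (rule max_rank_sum_cases)
qed

theorem corollary3:
  fixes M :: "'m set"
    and \<rho> :: "'m \<Rightarrow> 'h \<Rightarrow> 'h::complex_inner_product"
    and e :: "2 \<Rightarrow> 'h"
    and P :: "(real^3) set"
    and v :: "'m \<Rightarrow> real^3"
  assumes "finite M"
    and "cvs.dim (UNIV :: 'h set) = 2"
    and "\<rho> \<in> ensembles M"
    and "inj_on \<rho> M"
    and "inj e" and "orthonormal_basis (range e)"
    and "regular_polyhedron P" and "{x. x extreme_point_of P} \<subseteq> sphere 0 1"
    and "bij_betw v M {x. x extreme_point_of P}"
    and "\<And>m. m \<in> M \<Longrightarrow> \<rho> m = matrix_op e ((1 / real (card M)) *\<^sub>R bloch_matrix (v m))"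
  shows "(\<exists>\<pi>\<in>numbering_measurements M. guesswork M \<rho> \<pi> = min_guesswork M \<rho>) \<and>
    (\<forall>\<pi>\<in>numbering_measurements M. min_guesswork M \<rho> \<le> guesswork M \<rho> \<pi>) \<and>
    (card M = 4 \<and> min_guesswork M \<rho> = 5 / 2 - sqrt 15 / 6
        \<and> round (10 * min_guesswork M \<rho>) = 19 \<or>
     card M = 6 \<and> min_guesswork M \<rho> = 7 / 2 - sqrt 35 / 6
        \<and> round (10 * min_guesswork M \<rho>) = 25 \<or>
     card M = 8 \<and> min_guesswork M \<rho> = 9 / 2 - sqrt 7 / 2
        \<and> round (10 * min_guesswork M \<rho>) = 32 \<or>
     card M = 12 \<and> min_guesswork M \<rho> = 13 / 2 - sqrt (110 * (65 + 29 * sqrt 5)) / 60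
        \<and> round (10 * min_guesswork M \<rho>) = 45 \<or>
     card M = 20 \<and> min_guesswork M \<rho> = 21 / 2 - sqrt (6 * (3321 + 1483 * sqrt 5)) / 60
        \<and> round (10 * min_guesswork M \<rho>) = 72)"
proof -
  interpret qubit e using assms(5,6) by unfold_locales
  let ?V = "{x. x extreme_point_of P}"
  have card: "card ?V = card M" using bij_betw_same_card[OF assms(9)] by simp
  note V = regular_polyhedron_max_rank_sum[OF assms(7,8)]
  note minG = min_guesswork_eq[OF assms(1,9) V(1) _ _ assms(10)]
  have reduce: ?thesis if K: "max_rank_sum ?V K" "K > 0"
    and eq: "card M = 4 \<and> sqrt K / 4 = sqrt 15 / 6 \<or> card M = 6 \<and> sqrt K / 6 = sqrt 35 / 6 \<or>
      card M = 8 \<and> sqrt K / 8 = sqrt 7 / 2 \<or>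
      card M = 12 \<and> sqrt K / 12 = sqrt (110 * (65 + 29 * sqrt 5)) / 60 \<or>
      card M = 20 \<and> sqrt K / 20 = sqrt (6 * (3321 + 1483 * sqrt 5)) / 60" for K
  proof -
    define G where "G = min_guesswork M \<rho>"
    have opt: "(\<exists>\<pi>\<in>numbering_measurements M. guesswork M \<rho> \<pi> = G) \<and>
        (\<forall>\<pi>\<in>numbering_measurements M. G \<le> guesswork M \<rho> \<pi>)"
      and G: "G = (real (card M) + 1) / 2 - sqrt K / real (card M)"
      using minG[OF K] by (simp_all add: G_def)
    have s5: "2236 / 1000 < sqrt 5" "sqrt 5 < 2237 / 1000"
      by (rule real_less_rsqrt real_less_lsqrt; simp add: power2_eq_square)+
    have sq: "p < sqrt q \<and> sqrt q < r" if "p\<^sup>2 < q" "q < r\<^sup>2" "0 < r" for p q r :: real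
      using that(1) real_sqrt_less_mono[OF that(2)] that(3) by (auto intro: real_less_rsqrt)
    \<comment> \<open>Enclosures narrow enough to place \<open>10 * G\<close> within 1 / 2 of the
      stated integer.\<close>
    have b: "387 / 100 < sqrt 15 \<and> sqrt 15 < 388 / 100" "591 / 100 < sqrt 35 \<and> sqrt 35 < 592 / 100"
      "264 / 100 < sqrt 7 \<and> sqrt 7 < 265 / 100"
      "119 < sqrt (110 * (65 + 29 * sqrt 5)) \<and> sqrt (110 * (65 + 29 * sqrt 5)) < 120"
      "199 < sqrt (6 * (3321 + 1483 * sqrt 5)) \<and> sqrt (6 * (3321 + 1483 * sqrt 5)) < 200"
      by (rule sq; use s5 in \<open>simp add: power2_eq_square\<close>)+
    from eq have "card M = 4 \<and> G = 5 / 2 - sqrt 15 / 6 \<and> round (10 * G) = 19 \<or>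
      card M = 6 \<and> G = 7 / 2 - sqrt 35 / 6 \<and> round (10 * G) = 25 \<or>
      card M = 8 \<and> G = 9 / 2 - sqrt 7 / 2 \<and> round (10 * G) = 32 \<or>
      card M = 12 \<and> G = 13 / 2 - sqrt (110 * (65 + 29 * sqrt 5)) / 60 \<and> round (10 * G) = 45 \<or>
      card M = 20 \<and> G = 21 / 2 - sqrt (6 * (3321 + 1483 * sqrt 5)) / 60 \<and> round (10 * G) = 72"
    proof (elim disjE conjE)
      assume "card M = 4" "sqrt K / 4 = sqrt 15 / 6"
      moreover from this have "G = 5 / 2 - sqrt 15 / 6" using G by simp
      moreover from this have "round (10 * G) = 19" by (intro round_unique) (use b(1) in auto)
      ultimately show ?thesis by blast
    next
      assume "card M = 6" "sqrt K / 6 = sqrt 35 / 6"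
      moreover from this have "G = 7 / 2 - sqrt 35 / 6" using G by simp
      moreover from this have "round (10 * G) = 25" by (intro round_unique) (use b(2) in auto)
      ultimately show ?thesis by blast
    next
      assume "card M = 8" "sqrt K / 8 = sqrt 7 / 2"
      moreover from this have "G = 9 / 2 - sqrt 7 / 2" using G by simp
      moreover from this have "round (10 * G) = 32" by (intro round_unique) (use b(3) in auto)
      ultimately show ?thesis by blast
    next
      assume "card M = 12" "sqrt K / 12 = sqrt (110 * (65 + 29 * sqrt 5)) / 60"
      moreover from this have "G = 13 / 2 - sqrt (110 * (65 + 29 * sqrt 5)) / 60" using G by simp
      moreover from this have "round (10 * G) = 45" by (intro round_unique) (use b(4) in auto)
      ultimately show ?thesis by blast
    next
      assume "card M = 20" "sqrt K / 20 = sqrt (6 * (3321 + 1483 * sqrt 5)) / 60"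
      moreover from this have "G = 21 / 2 - sqrt (6 * (3321 + 1483 * sqrt 5)) / 60" using G by simp
      moreover from this have "round (10 * G) = 72" by (intro round_unique) (use b(5) in auto)
      ultimately show ?thesis by blast
    qed
    with opt show ?thesis unfolding G_def by blast
  qed
  have scale: "sqrt K / n = sqrt L / d" if "K * d\<^sup>2 = L * n\<^sup>2" "n > 0" "d > 0" for K L n d :: real
  proof -
    have "sqrt K * d = sqrt L * n"
      using arg_cong[OF that(1), of sqrt] that(2,3) by (simp add: real_sqrt_mult)
    then show ?thesis using that(2,3) by (simp add: field_simps)
  qed
  have gold: "golden > 0" using golden_bounds by simp
  have s5: "sqrt 5 * sqrt 5 = 5" by simp
  from V(2) show ?thesis unfolding card
  proof (elim disjE conjE)
    assume M: "card M = 4" and V: "max_rank_sum ?V (20 / 3)"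
    have "sqrt (20 / 3) / 4 = sqrt 15 / 6" by (rule scale) simp_all
    moreover have "(20 / 3 :: real) > 0" by simp
    ultimately show ?thesis using reduce[OF V] M by blast
  next
    assume M: "card M = 6" and V: "max_rank_sum ?V 35"
    have "(35 :: real) > 0" by simp
    then show ?thesis using reduce[OF V] M by blast
  next
    assume M: "card M = 8" and V: "max_rank_sum ?V 112"
    have "sqrt 112 / 8 = sqrt 7 / 2" by (rule scale) simp_all
    moreover have "(112 :: real) > 0" by simp
    ultimately show ?thesis using reduce[OF V] M by blast
  next
    assume M: "card M = 12" and V: "max_rank_sum ?V ((572 + 924 * golden) / (golden + 2))"
    have "(572 + 924 * golden) * 60\<^sup>2 = (110 * (65 + 29 * sqrt 5)) * 12\<^sup>2 * (golden + 2)"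
      using s5 by (simp add: golden_def field_simps)
    then have "sqrt ((572 + 924 * golden) / (golden + 2)) / 12 = sqrt (110 * (65 + 29 * sqrt 5)) / 60"
      using gold by (intro scale) (simp_all add: field_simps)
    moreover have "(572 + 924 * golden) / (golden + 2) > 0" using gold by simp
    ultimately show ?thesis using reduce[OF V] M by blast
  next
    assume M: "card M = 20" and V: "max_rank_sum ?V ((3676 + 5932 * golden) / 3)"
    have "sqrt ((3676 + 5932 * golden) / 3) / 20 = sqrt (6 * (3321 + 1483 * sqrt 5)) / 60"
      by (intro scale) (simp_all add: golden_def field_simps)
    moreover have "(3676 + 5932 * golden) / 3 > 0" using gold by simp
    ultimately show ?thesis using reduce[OF V] M by blast
  qed
qed

end
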